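(* Let $n\ge3$ and $\mathfrak g=\mathfrak{sl}(n,\mathbb C)$. Then the $\mathfrak g$-homomorphism $\varphi_k\colon M_{\mathfrak p}(\mathrm{sym}^k_{n-1},-(1+\frac k{n-1}))\to M_{\mathfrak p}(\mathrm{triv},k-1)$ is standard for all $k\in\mathbb Z_{\ge0}$.
   Context: Let $\mathfrak g=\mathfrak{sl}(n,\mathbb C)$, $E_{i,j}$ the matrix units, $N_j^-=E_{j+1,1}$ ($1\le j\le n-1$), $\mathfrak n_-=\mathrm{span}_{\mathbb C}\{N_j^-\}$, $\mathfrak n_+=\mathrm{span}_{\mathbb C}\{E_{1,j+1}:1\le j\le n-1\}$, $\widetilde H_0=\frac1{n-1}\mathrm{diag}(n-1,-1,\dots,-1)$, $\mathfrak a=\mathbb C\widetilde H_0$, $\mathfrak m=\{\mathrm{diag}(0,X):X\in\mathfrak{sl}(n-1,\mathbb C)\}$, $\mathfrak l=\mathfrak m\oplus\mathfrak a$ and $\mathfrak p=\mathfrak l\oplus\mathfrak n_+$, the maximal parabolic subalgebra for the partition $n=1+(n-1)$. For a finite-dimensional irreducible representation $(\sigma,W)$ of $\mathfrak{sl}(n-1,\mathbb C)$ and $s\in\mathbb C$, $M_{\mathfrak p}(\sigma,s)=\mathcal U(\mathfrak g)\otimes_{\mathcal U(\mathfrak p)}W$ with $\mathfrak m$ acting by $\sigma$, $\widetilde H_0$ by the scalar $s$, $\mathfrak n_+$ by $0$. $\mathrm{sym}^k_{n-1}$ is the irreducible representation on $S^k(\mathbb C^{n-1})$. The map $\varphi_k$: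 with $e_1,\dots,e_{n-1}$ the standard basis of $\mathbb C^{n-1}$, $\varphi_k\bigl(u\otimes e_1^{k_1}\cdots e_{n-1}^{k_{n-1}}\bigr)=u\,(N_1^-)^{k_1}\cdots(N_{n-1}^-)^{k_{n-1}}\otimes1$ for $u\in\mathcal U(\mathfrak g)$ and $k_1+\cdots+k_{n-1}=k$; it is a $\mathfrak g$-homomorphism $M_{\mathfrak p}(\mathrm{sym}^k_{n-1},-(1+\frac k{n-1}))\to M_{\mathfrak p}(\mathrm{triv},k-1)$. Standard maps: Let $\mathfrak h\subset\mathfrak g$ be the diagonal Cartan subalgebra, with positive roots $\varepsilon_i-\varepsilon_j$ ($i<j$), simple roots $\varepsilon_i-\varepsilon_{i+1}$, $\rho$ half the sum of the positive roots, and $\mathfrak b\subset\mathfrak p$ the corresponding Borel subalgebra. Let $\mathbf P^+_{\mathfrak l}$ be the set of $\mu\in\mathfrak h^*$ with $\langle\mu,\alpha^\vee\rangle\in1+\mathbb Z_{\ge0}$ for every simple root $\alpha$ of $\mathfrak l$ (i.e. $\alpha=\varepsilon_i-\varepsilon_{i+1}$, $2\le i\le n-1$). For $\mu\in\mathbf P_{\mathfrak l}^+$, $N_{\mathfrak p}(\mu)=\mathcal U(\mathfrak g)\otimes_{\mathcal U(\mathfrak p)}E(\mu-\rho)$, where $E(\mu-\rho)$ is the finite-dimensional simple $\mathcal U(\mathfrak l)$-module of highest weight $\mu-\rho$ with $\mathfrak n_+$ acting trivially, and $N(\mu)=N_{\mathfrak b}(\mu)$ is the Verma module of highest weight $\mu-\rho$;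 $\mathrm{pr}_\mu\colon N(\mu)\to N_{\mathfrak p}(\mu)$ is the canonical projection. For $\mu,\eta\in\mathbf P^+_{\mathfrak l}$, any $\mathfrak g$-homomorphism $\varphi\colon N(\mu)\to N(\eta)$ satisfies $\varphi(\operatorname{Ker}\mathrm{pr}_\mu)\subset\operatorname{Ker}\mathrm{pr}_\eta$ and so induces a $\mathfrak g$-homomorphism $\varphi_{\mathrm{std}}\colon N_{\mathfrak p}(\mu)\to N_{\mathfrak p}(\eta)$ with $\varphi_{\mathrm{std}}\circ\mathrm{pr}_\mu=\mathrm{pr}_\eta\circ\varphi$. A $\mathfrak g$-homomorphism $N_{\mathfrak p}(\mu)\to N_{\mathfrak p}(\eta)$ is called standard if it is of the form $\varphi_{\mathrm{std}}$ for some $\mathfrak g$-homomorphism $\varphi\colon N(\mu)\to N(\eta)$. Here $M_{\mathfrak p}(\mathrm{sym}^k_{n-1},-(1+\frac k{n-1}))=N_{\mathfrak p}(\mu^k)$ and $M_{\mathfrak p}(\mathrm{triv},k-1)=N_{\mathfrak p}(\eta^k)$ with $\mu^k=k\omega_1-(1+\frac k{n-1})d\chi+\rho$, $\eta^k=(k-1)d\chi+\rho$, where in coordinates $d\chi=\frac1n(n-1,-1,\dots,-1)$ and $\omega_1=\frac1{n-1}(0,n-2,-1,\dots,-1)$. *)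

theory Defs
  imports "Jordan_Normal_Form.VS_Connect" "HOL-Algebra.QuotRing" "HOL-Library.Poly_Mapping"
begin

text \<open>
  Matrices and vectors are indexed from 0, so the matrix unit \<open>E\<^sub>i\<^sub>,\<^sub>j\<close> of the mathematical text is
  \<open>mat_unit n (i - 1) (j - 1)\<close>. Complex vector spaces are modules over \<^term>\<open>class_ring :: complex ring\<close>;
  the record fields \<open>mult\<close> and \<open>one\<close> play no role there.
\<close>

abbreviation \<open>CC \<equiv> (class_ring :: complex ring)\<close>


section \<open>Representations of matrix Lie algebras\<close>

definition lie_bracket :: "complex mat \<Rightarrow> complex mat \<Rightarrow> complex mat" where
  "lie_bracket X Y = X * Y - Y * X"

record 'v rep = "(complex, 'v) module" +
  act :: "complex mat \<Rightarrow> 'v \<Rightarrow> 'v"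

definition lie_rep :: "complex mat set \<Rightarrow> 'v rep \<Rightarrow> bool" where
  "lie_rep L V \<longleftrightarrow>
     vectorspace CC V \<and>
     (\<forall>X\<in>L. act V X \<in> LinearCombinations.module_hom CC V V) \<and>
     (\<forall>X\<in>L. \<forall>Y\<in>L. \<forall>v\<in>carrier V. act V (X + Y) v = act V X v \<oplus>\<^bsub>V\<^esub> act V Y v) \<and>
     (\<forall>c. \<forall>X\<in>L. \<forall>v\<in>carrier V. act V (c \<cdot>\<^sub>m X) v = c \<odot>\<^bsub>V\<^esub> act V X v) \<and>
     (\<forall>X\<in>L. \<forall>Y\<in>L. \<forall>v\<in>carrier V.
        act V (lie_bracket X Y) v = act V X (act V Y v) \<ominus>\<^bsub>V\<^esub> act V Y (act V X v))"

definition rep_hom :: "complex mat set \<Rightarrow> 'v rep \<Rightarrow> 'w rep \<Rightarrow> ('v \<Rightarrow> 'w) set" where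
  "rep_hom L V W =
     {f \<in> LinearCombinations.module_hom CC V W. \<forall>X\<in>L. \<forall>v\<in>carrier V. f (act V X v) = act W X (f v)}"

definition simple_rep :: "complex mat set \<Rightarrow> 'v rep \<Rightarrow> bool" where
  "simple_rep L V \<longleftrightarrow>
     lie_rep L V \<and> carrier V \<noteq> {\<zero>\<^bsub>V\<^esub>} \<and>
     (\<forall>W. VectorSpace.subspace CC W V \<and> (\<forall>X\<in>L. \<forall>w\<in>W. act V X w \<in> W)
        \<longrightarrow> W = {\<zero>\<^bsub>V\<^esub>} \<or> W = carrier V)"


section \<open>Universal enveloping algebras\<close>

text \<open>
  The universal enveloping algebra of a Lie algebra \<open>L\<close> of matrices is presented as the free
  associative unital algebra on the set \<open>L\<close> modulo the relations stating that \<open>L \<rightarrow> U(L)\<close> is linear and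
  turns brackets into commutators. (Dividing by the linearity relations first yields the tensor algebra
  of \<open>L\<close>.) The free algebra is the monoid algebra of the words over \<open>L\<close>: the product of
  \<^typ>\<open>'x list \<Rightarrow>\<^sub>0 complex\<close> is convolution with respect to concatenation.
\<close>

instantiation list :: (type) monoid_add
begin
definition "0 = []"
definition "xs + ys = xs @ ys"
instance by standard (simp_all add: zero_list_def plus_list_def)
end

type_synonym nc_poly = "complex mat list \<Rightarrow>\<^sub>0 complex"
type_synonym env = "nc_poly set"

definition free_alg :: "complex mat set \<Rightarrow> nc_poly ring" where
  "free_alg L =
     \<lparr>carrier = {a. \<forall>xs\<in>Poly_Mapping.keys a. set xs \<subseteq> L}, mult = (*), one = 1, zero = 0, add = (+)\<rparr>"

definition letter :: "complex mat \<Rightarrow> nc_poly" where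
  "letter X = Poly_Mapping.single [X] 1"

definition scalar :: "complex \<Rightarrow> nc_poly" where
  "scalar c = Poly_Mapping.single [] c"

definition env_rels :: "complex mat set \<Rightarrow> nc_poly set" where
  "env_rels L =
     {letter (X + Y) - letter X - letter Y | X Y. X \<in> L \<and> Y \<in> L} \<union>
     {letter (c \<cdot>\<^sub>m X) - scalar c * letter X | c X. X \<in> L} \<union>
     {letter (lie_bracket X Y) - (letter X * letter Y - letter Y * letter X) | X Y. X \<in> L \<and> Y \<in> L}"

definition env_ideal :: "complex mat set \<Rightarrow> nc_poly set" where
  "env_ideal L = Idl\<^bsub>free_alg L\<^esub> (env_rels L)"

definition env_alg :: "complex mat set \<Rightarrow> env ring" where
  "env_alg L = free_alg L Quot env_ideal L"

definition env_class :: "complex mat set \<Rightarrow> nc_poly \<Rightarrow> env" where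
  "env_class L a = env_ideal L +>\<^bsub>free_alg L\<^esub> a"

definition env_gen :: "complex mat set \<Rightarrow> complex mat \<Rightarrow> env" where
  "env_gen L X = env_class L (letter X)"

text \<open>The canonical map \<open>U(P) \<rightarrow> U(L)\<close> for a Lie subalgebra \<open>P\<close> of \<open>L\<close>.\<close>

definition env_map :: "complex mat set \<Rightarrow> complex mat set \<Rightarrow> env \<Rightarrow> env" where
  "env_map P L x = the_elem (env_class L ` x)"

text \<open>The action of \<open>U(P)\<close> on a representation of \<open>P\<close>: the word \<open>X\<^sub>1\<dots>X\<^sub>r\<close> acts as the composition of
  the actions of its letters.\<close>

definition free_act :: "'v rep \<Rightarrow> nc_poly \<Rightarrow> 'v \<Rightarrow> 'v" where
  "free_act V a v =
     (\<Oplus>\<^bsub>V\<^esub>xs\<in>Poly_Mapping.keys a. Poly_Mapping.lookup a xs \<odot>\<^bsub>V\<^esub> foldr (act V) xs v)"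

definition env_act :: "'v rep \<Rightarrow> env \<Rightarrow> 'v \<Rightarrow> 'v" where
  "env_act V x v = the_elem ((\<lambda>a. free_act V a v) ` x)"


section \<open>Induced modules\<close>

text \<open>
  \<open>induced L P V\<close> is \<open>U(L) \<otimes> V\<close>, the tensor product being over \<open>U(P)\<close>: the complex vector space freely
  spanned by the pairs \<open>(u, v)\<close>, modulo the subspace spanned by the relations making \<open>(u, v)\<close> additive
  in both arguments, linear in \<open>u\<close>, and balanced over \<open>U(P)\<close>. Homogeneity in \<open>v\<close> is the balancing
  relation for scalars.
\<close>

definition free_space :: "'a set \<Rightarrow> (complex, 'a \<Rightarrow>\<^sub>0 complex) module" where
  "free_space A =
     \<lparr>carrier = {p. Poly_Mapping.keys p \<subseteq> A}, mult = undefined, one = undefined,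
      zero = 0, add = (+), smult = (\<lambda>c. Poly_Mapping.map ((*) c))\<rparr>"

definition pairs :: "complex mat set \<Rightarrow> 'v rep \<Rightarrow> (complex, (env \<times> 'v) \<Rightarrow>\<^sub>0 complex) module" where
  "pairs L V = free_space (carrier (env_alg L) \<times> carrier V)"

abbreviation pair :: "env \<Rightarrow> 'v \<Rightarrow> (env \<times> 'v) \<Rightarrow>\<^sub>0 complex" where
  "pair u v \<equiv> Poly_Mapping.single (u, v) 1"

definition tensor_rels ::
    "complex mat set \<Rightarrow> complex mat set \<Rightarrow> 'v rep \<Rightarrow> ((env \<times> 'v) \<Rightarrow>\<^sub>0 complex) set" where
  "tensor_rels L P V =
     {pair (u \<oplus>\<^bsub>env_alg L\<^esub> u') v - pair u v - pair u' v | u u' v.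
        u \<in> carrier (env_alg L) \<and> u' \<in> carrier (env_alg L) \<and> v \<in> carrier V} \<union>
     {pair u (v \<oplus>\<^bsub>V\<^esub> v') - pair u v - pair u v' | u v v'.
        u \<in> carrier (env_alg L) \<and> v \<in> carrier V \<and> v' \<in> carrier V} \<union>
     {pair (env_class L (scalar c) \<otimes>\<^bsub>env_alg L\<^esub> u) v - c \<odot>\<^bsub>pairs L V\<^esub> pair u v | c u v.
        u \<in> carrier (env_alg L) \<and> v \<in> carrier V} \<union>
     {pair (u \<otimes>\<^bsub>env_alg L\<^esub> env_map P L x) v - pair u (env_act V x v) | u x v.
        u \<in> carrier (env_alg L) \<and> x \<in> carrier (env_alg P) \<and> v \<in> carrier V}"

definition tensor_null ::
    "complex mat set \<Rightarrow> complex mat set \<Rightarrow> 'v rep \<Rightarrow> ((env \<times> 'v) \<Rightarrow>\<^sub>0 complex) set" where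
  "tensor_null L P V = LinearCombinations.module.span CC (pairs L V) (tensor_rels L P V)"

definition tensor ::
    "complex mat set \<Rightarrow> complex mat set \<Rightarrow> 'v rep \<Rightarrow> env \<Rightarrow> 'v \<Rightarrow> ((env \<times> 'v) \<Rightarrow>\<^sub>0 complex) set" where
  "tensor L P V u v = tensor_null L P V +>\<^bsub>pairs L V\<^esub> pair u v"

text \<open>The linear extension of \<open>(u, v) \<mapsto> (X u, v)\<close>.\<close>

definition pairs_lmult ::
    "complex mat set \<Rightarrow> complex mat \<Rightarrow> ((env \<times> 'v) \<Rightarrow>\<^sub>0 complex) \<Rightarrow> ((env \<times> 'v) \<Rightarrow>\<^sub>0 complex)" where
  "pairs_lmult L X p =
     (\<Sum>(u, v)\<in>Poly_Mapping.keys p.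
        Poly_Mapping.single (env_gen L X \<otimes>\<^bsub>env_alg L\<^esub> u, v) (Poly_Mapping.lookup p (u, v)))"

definition induced ::
    "complex mat set \<Rightarrow> complex mat set \<Rightarrow> 'v rep \<Rightarrow> ((env \<times> 'v) \<Rightarrow>\<^sub>0 complex) set rep" where
  "induced L P V =
     \<lparr>carrier = a_rcosets\<^bsub>pairs L V\<^esub> (tensor_null L P V), mult = undefined, one = undefined,
      zero = tensor_null L P V, add = set_add (pairs L V),
      smult = (\<lambda>c A. \<Union>p\<in>A. tensor_null L P V +>\<^bsub>pairs L V\<^esub> (c \<odot>\<^bsub>pairs L V\<^esub> p)),
      act = (\<lambda>X A. \<Union>p\<in>A. tensor_null L P V +>\<^bsub>pairs L V\<^esub> pairs_lmult L X p)\<rparr>"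


section \<open>The special linear Lie algebra and its subalgebras\<close>

definition mat_unit :: "nat \<Rightarrow> nat \<Rightarrow> nat \<Rightarrow> complex mat" where
  "mat_unit n i j = mat n n (\<lambda>(r, c). if r = i \<and> c = j then 1 else 0)"

definition sl :: "nat \<Rightarrow> complex mat set" where
  "sl n = {A \<in> carrier_mat n n. (\<Sum>i<n. A $$ (i, i)) = 0}"

definition cartan :: "nat \<Rightarrow> complex mat set" where
  "cartan n = {A \<in> sl n. diagonal_mat A}"

definition borel :: "nat \<Rightarrow> complex mat set" where
  "borel n = {A \<in> sl n. upper_triangular A}"

definition H0 :: "nat \<Rightarrow> complex mat" where
  "H0 n = (1 / of_nat (n - 1)) \<cdot>\<^sub>m mat_diag n (\<lambda>i. if i = 0 then of_nat (n - 1) else - 1)"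

definition n_plus :: "nat \<Rightarrow> complex mat set" where
  "n_plus n = {mat n n (\<lambda>(i, j). if i = 0 \<and> j \<noteq> 0 then y j else 0) | y. True}"

definition levi_ss :: "nat \<Rightarrow> complex mat set" where
  "levi_ss n =
     {four_block_mat (0\<^sub>m 1 1) (0\<^sub>m 1 (n - 1)) (0\<^sub>m (n - 1) 1) X | X. X \<in> sl (n - 1)}"

definition levi :: "nat \<Rightarrow> complex mat set" where
  "levi n = {X + c \<cdot>\<^sub>m H0 n | X c. X \<in> levi_ss n}"

definition parabolic :: "nat \<Rightarrow> complex mat set" where
  "parabolic n = {Z + Y | Z Y. Z \<in> levi n \<and> Y \<in> n_plus n}"


section \<open>Weights\<close>

text \<open>
  A vector \<open>\<lambda>\<close> of dimension \<open>n\<close> stands for the functional \<open>\<lambda>\<^sub>1\<epsilon>\<^sub>1 + \<dots> + \<lambda>\<^sub>n\<epsilon>\<^sub>n\<close> on the diagonal Cartan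
  subalgebra. On an upper triangular matrix, \<open>weight\<close> is its extension by 0 to the strictly upper
  triangular matrices.
\<close>

definition weight :: "complex vec \<Rightarrow> complex mat \<Rightarrow> complex" where
  "weight lam H = (\<Sum>i<dim_vec lam. lam $ i * H $$ (i, i))"

definition coroot :: "nat \<Rightarrow> nat \<Rightarrow> nat \<Rightarrow> complex mat" where
  "coroot n i j = mat_unit n i i - mat_unit n j j"

definition rho :: "nat \<Rightarrow> complex vec" where
  "rho n = vec n (\<lambda>l. 1 / 2 * (\<Sum>(i, j)\<in>{(i, j). i < j \<and> j < n}. (unit_vec n i - unit_vec n j) $ l))"

definition P_levi :: "nat \<Rightarrow> complex vec set" where
  "P_levi n =
     {mu \<in> carrier_vec n. \<forall>i\<in>{1..<n - 1}. \<exists>d::nat. weight mu (coroot n i (i + 1)) = 1 + of_nat d}"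

definition highest_weight_vector :: "nat \<Rightarrow> complex vec \<Rightarrow> 'v rep \<Rightarrow> 'v \<Rightarrow> bool" where
  "highest_weight_vector n lam V v \<longleftrightarrow>
     v \<in> carrier V \<and> v \<noteq> \<zero>\<^bsub>V\<^esub> \<and>
     (\<forall>H\<in>cartan n. act V H v = weight lam H \<odot>\<^bsub>V\<^esub> v) \<and>
     (\<forall>i j. 1 \<le> i \<and> i < j \<and> j < n \<longrightarrow> act V (mat_unit n i j) v = \<zero>\<^bsub>V\<^esub>)"

text \<open>\<open>is_E n lam V\<close>: \<open>V\<close> is a model of \<open>E(\<lambda>)\<close>, which is determined up to isomorphism, as a
  representation of the parabolic subalgebra.\<close>

definition is_E :: "nat \<Rightarrow> complex vec \<Rightarrow> 'v rep \<Rightarrow> bool" where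
  "is_E n lam V \<longleftrightarrow>
     lie_rep (parabolic n) V \<and>
     (\<forall>Y\<in>n_plus n. \<forall>v\<in>carrier V. act V Y v = \<zero>\<^bsub>V\<^esub>) \<and>
     vectorspace.fin_dim CC V \<and>
     simple_rep (levi n) V \<and>
     (\<exists>v. highest_weight_vector n lam V v)"


section \<open>Standard homomorphisms\<close>

definition weight_rep :: "complex vec \<Rightarrow> complex rep" where
  "weight_rep lam =
     \<lparr>carrier = UNIV, mult = undefined, one = undefined, zero = 0, add = (+), smult = (*),
      act = (\<lambda>X c. weight lam X * c)\<rparr>"

text \<open>The Verma module \<open>N(\<mu>)\<close>; note the shift by \<open>\<rho>\<close>.\<close>

definition verma :: "nat \<Rightarrow> complex vec \<Rightarrow> ((env \<times> complex) \<Rightarrow>\<^sub>0 complex) set rep" where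
  "verma n mu = induced (sl n) (borel n) (weight_rep (mu - rho n))"

text \<open>The canonical projection \<open>N(\<mu>) \<rightarrow> N\<^sub>p(\<mu>)\<close>, \<open>u \<otimes> c \<mapsto> u \<otimes> c v\<close>, where \<open>v\<close> is a highest weight
  vector of \<open>V = E(\<mu> - \<rho>)\<close>.\<close>

definition canonical_proj :: "nat \<Rightarrow> complex vec \<Rightarrow> 'v rep \<Rightarrow> 'v \<Rightarrow>
    ((env \<times> complex) \<Rightarrow>\<^sub>0 complex) set \<Rightarrow> ((env \<times> 'v) \<Rightarrow>\<^sub>0 complex) set" where
  "canonical_proj n mu V v =
     (THE f. f \<in> LinearCombinations.module_hom CC (verma n mu) (induced (sl n) (parabolic n) V) \<and>
        f \<in> extensional (carrier (verma n mu)) \<and>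
        (\<forall>u\<in>carrier (env_alg (sl n)). \<forall>c.
           f (tensor (sl n) (borel n) (weight_rep (mu - rho n)) u c) =
             tensor (sl n) (parabolic n) V u (c \<odot>\<^bsub>V\<^esub> v)))"

text \<open>
  \<open>standard_hom n mu eta V W f\<close>: \<open>V\<close> and \<open>W\<close> are models of \<open>E(\<mu> - \<rho>)\<close> and \<open>E(\<eta> - \<rho>)\<close>, and \<open>f\<close> is a
  standard homomorphism \<open>N\<^sub>p(\<mu>) \<rightarrow> N\<^sub>p(\<eta>)\<close>. The highest weight vectors \<open>v\<close> and \<open>w\<close> defining the canonical
  projections are unique up to nonzero scalars, which can be absorbed into \<open>\<phi>\<close>.
\<close>

definition standard_hom :: "nat \<Rightarrow> complex vec \<Rightarrow> complex vec \<Rightarrow> 'v rep \<Rightarrow> 'w rep \<Rightarrow>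
    (((env \<times> 'v) \<Rightarrow>\<^sub>0 complex) set \<Rightarrow> ((env \<times> 'w) \<Rightarrow>\<^sub>0 complex) set) \<Rightarrow> bool" where
  "standard_hom n mu eta V W f \<longleftrightarrow>
     mu \<in> P_levi n \<and> eta \<in> P_levi n \<and> is_E n (mu - rho n) V \<and> is_E n (eta - rho n) W \<and>
     f \<in> rep_hom (sl n) (induced (sl n) (parabolic n) V) (induced (sl n) (parabolic n) W) \<and>
     (\<exists>v w phi. highest_weight_vector n (mu - rho n) V v \<and>
        highest_weight_vector n (eta - rho n) W w \<and>
        phi \<in> rep_hom (sl n) (verma n mu) (verma n eta) \<and>
        (\<forall>x\<in>carrier (verma n mu).
           f (canonical_proj n mu V v x) = canonical_proj n eta W w (phi x)))"


section \<open>The generalized Verma modules and the homomorphism\<close>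

text \<open>
  The representation of the parabolic subalgebra obtained from a representation \<open>\<sigma>\<close> of \<open>sl(n-1)\<close> and
  \<open>s\<close>. Since the upper left entry of \<^term>\<open>H0 n\<close> is 1, the component along \<^term>\<open>H0 n\<close> of an element \<open>X\<close>
  is \<open>X\<^sub>1\<^sub>1\<close>, and the component in \<^term>\<open>levi_ss n\<close> is the lower right block of the rest.
\<close>

definition levi_ss_part :: "nat \<Rightarrow> complex mat \<Rightarrow> complex mat" where
  "levi_ss_part n X =
     mat (n - 1) (n - 1) (\<lambda>(i, j). (X - X $$ (0, 0) \<cdot>\<^sub>m H0 n) $$ (i + 1, j + 1))"

definition parabolic_rep :: "nat \<Rightarrow> 'v rep \<Rightarrow> complex \<Rightarrow> 'v rep" where
  "parabolic_rep n sigma s =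
     sigma\<lparr>act := (\<lambda>X v. act sigma (levi_ss_part n X) v
                        \<oplus>\<^bsub>sigma\<^esub> (s * X $$ (0, 0)) \<odot>\<^bsub>sigma\<^esub> v)\<rparr>"

definition M_par :: "nat \<Rightarrow> 'v rep \<Rightarrow> complex \<Rightarrow> ((env \<times> 'v) \<Rightarrow>\<^sub>0 complex) set rep" where
  "M_par n sigma s = induced (sl n) (parabolic n) (parabolic_rep n sigma s)"

definition triv_rep :: "complex rep" where
  "triv_rep =
     \<lparr>carrier = UNIV, mult = undefined, one = undefined, zero = 0, add = (+), smult = (*),
      act = (\<lambda>X c. 0)\<rparr>"

text \<open>
  The symmetric power \<open>S\<^sup>k(\<complex>\<^sup>m)\<close> is realised as the space of homogeneous polynomials of degree \<open>k\<close> in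
  the basis vectors (numbered from 0); the monomial with exponents \<open>K\<close> is \<open>Poly_Mapping.single K 1\<close>.
  A matrix acts as the derivation extending its action on \<open>\<complex>\<^sup>m\<close>.
\<close>

type_synonym sym = "(nat \<Rightarrow>\<^sub>0 nat) \<Rightarrow>\<^sub>0 complex"

definition exponents :: "nat \<Rightarrow> nat \<Rightarrow> (nat \<Rightarrow>\<^sub>0 nat) set" where
  "exponents m k = {K. Poly_Mapping.keys K \<subseteq> {..<m} \<and> (\<Sum>i<m. Poly_Mapping.lookup K i) = k}"

definition partial_deriv :: "nat \<Rightarrow> sym \<Rightarrow> sym" where
  "partial_deriv j f =
     (\<Sum>K\<in>Poly_Mapping.keys f.
        Poly_Mapping.single (K - Poly_Mapping.single j 1)
          (of_nat (Poly_Mapping.lookup K j) * Poly_Mapping.lookup f K))"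

definition sym_rep :: "nat \<Rightarrow> nat \<Rightarrow> sym rep" where
  "sym_rep m k =
     \<lparr>carrier = {f. Poly_Mapping.keys f \<subseteq> exponents m k}, mult = undefined, one = undefined,
      zero = 0, add = (+), smult = (\<lambda>c. Poly_Mapping.map ((*) c)),
      act = (\<lambda>X f. \<Sum>i<m. \<Sum>j<m.
               Poly_Mapping.single (Poly_Mapping.single i 1) (X $$ (i, j)) * partial_deriv j f)\<rparr>"

text \<open>The element \<open>(N\<^sub>1)\<^bsup>k\<^sub>1\<^esup> \<dots> (N\<^sub>n\<^sub>-\<^sub>1)\<^bsup>k\<^sub>n\<^sub>-\<^sub>1\<^esup>\<close> of \<open>U(sl(n))\<close>.\<close>

definition N_monomial :: "nat \<Rightarrow> (nat \<Rightarrow>\<^sub>0 nat) \<Rightarrow> env" where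
  "N_monomial n K =
     foldr (\<lambda>i a. (env_gen (sl n) (mat_unit n (i + 1) 0) [^]\<^bsub>env_alg (sl n)\<^esub> Poly_Mapping.lookup K i)
                    \<otimes>\<^bsub>env_alg (sl n)\<^esub> a)
       [0..<n - 1] \<one>\<^bsub>env_alg (sl n)\<^esub>"

definition sym_param :: "nat \<Rightarrow> nat \<Rightarrow> complex" where
  "sym_param n k = - (1 + of_nat k / of_nat (n - 1))"

definition phi :: "nat \<Rightarrow> nat \<Rightarrow>
    ((env \<times> sym) \<Rightarrow>\<^sub>0 complex) set \<Rightarrow> ((env \<times> complex) \<Rightarrow>\<^sub>0 complex) set" where
  "phi n k =
     (THE f. f \<in> LinearCombinations.module_hom CC (M_par n (sym_rep (n - 1) k) (sym_param n k))
                               (M_par n triv_rep (of_nat k - 1)) \<and>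
        f \<in> extensional (carrier (M_par n (sym_rep (n - 1) k) (sym_param n k))) \<and>
        (\<forall>u\<in>carrier (env_alg (sl n)). \<forall>K\<in>exponents (n - 1) k.
           f (tensor (sl n) (parabolic n) (parabolic_rep n (sym_rep (n - 1) k) (sym_param n k))
                u (Poly_Mapping.single K 1)) =
           tensor (sl n) (parabolic n) (parabolic_rep n triv_rep (of_nat k - 1))
             (u \<otimes>\<^bsub>env_alg (sl n)\<^esub> N_monomial n K) 1))"

definition dchi :: "nat \<Rightarrow> complex vec" where
  "dchi n = (1 / of_nat n) \<cdot>\<^sub>v vec n (\<lambda>i. if i = 0 then of_nat (n - 1) else - 1)"

definition omega1 :: "nat \<Rightarrow> complex vec" where
  "omega1 n = (1 / of_nat (n - 1)) \<cdot>\<^sub>v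
     vec n (\<lambda>i. if i = 0 then 0 else if i = 1 then of_nat (n - 2) else - 1)"

definition mu :: "nat \<Rightarrow> nat \<Rightarrow> complex vec" where
  "mu n k = of_nat k \<cdot>\<^sub>v omega1 n + sym_param n k \<cdot>\<^sub>v dchi n + rho n"

definition eta :: "nat \<Rightarrow> nat \<Rightarrow> complex vec" where
  "eta n k = (of_nat k - 1) \<cdot>\<^sub>v dchi n + rho n"

end

theory Submission
  imports Defs
begin

text \<open>
  The map \<open>\<phi>\<^sub>k\<close> is standard because the vector that determines it is singular already in the Verma module
  \<open>N(\<eta>)\<close>. The canonical projection sends the generator of \<open>N(\<mu>)\<close> to \<open>1 \<otimes> e\<^sub>1\<^sup>k\<close>, and \<open>\<phi>\<^sub>k\<close> sends this vector to
  \<open>N\<^sub>1\<^sup>k \<otimes> 1\<close>, where \<open>N\<^sub>1 = E\<^sub>2\<^sub>1\<close>. The Verma module \<open>N(\<eta>)\<close> contains the vector \<open>N\<^sub>1\<^sup>k \<otimes> 1\<close> as well. The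
  highest weight of \<open>N(\<eta>)\<close> takes the value \<open>k - 1\<close> on the first simple coroot, so the computation in
  \<open>sl\<^sub>2\<close> shows that the Borel subalgebra acts on \<open>N\<^sub>1\<^sup>k \<otimes> 1\<close> through the character \<open>\<mu> - \<rho>\<close>. Hence there is
  a homomorphism \<open>N(\<mu>) \<rightarrow> N(\<eta>)\<close> carrying the generator to \<open>N\<^sub>1\<^sup>k \<otimes> 1\<close>, and the square formed by it, \<open>\<phi>\<^sub>k\<close>
  and the two canonical projections commutes because it commutes on the generator.

  All four maps of this square are homomorphisms out of an induced module, and each of them comes from
  Frobenius reciprocity (\<open>frobenius_reciprocity\<close>): a linear map \<open>V \<rightarrow> W\<close> that intertwines the action of \<open>P\<close>
  extends to \<open>U(L) \<otimes> V \<rightarrow> W\<close>. What has to be supplied is an equivariant map on the small space each time.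
  For the canonical projections this is the choice of a highest weight vector (\<open>canonical_proj\<close>). For
  the map of Verma modules it is the vector \<open>N\<^sub>1\<^sup>k \<otimes> 1\<close> (\<open>borel_act_lowered\<close>, \<open>verma_hom\<close>). For \<open>\<phi>\<^sub>k\<close> it is
  the map \<open>f \<mapsto> f(N\<^sub>1, \<dots>, N\<^sub>n\<^sub>-\<^sub>1) \<otimes> 1\<close> on homogeneous polynomials of degree \<open>k\<close>. This makes sense as the
  \<open>N\<^sub>i\<close> commute, the Levi subalgebra acts on the \<open>N\<^sub>i\<close> by derivations, and the nilradical contributes the
  factor \<open>s - k + 1\<close>, which vanishes for the parameter \<open>s = k - 1\<close> (\<open>parabolic_act_poly_vec\<close>, \<open>phi_hom\<close>).

  It remains to see that the two inducing representations are models of \<open>E(\<mu> - \<rho>)\<close> and \<open>E(\<eta> - \<rho>)\<close>.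
  Apart from a computation of weights, this is the simplicity of the symmetric powers: from any nonzero
  polynomial the operators \<open>x\<^sub>0 \<partial>\<^sub>j\<close> lead to a nonzero multiple of \<open>x\<^sub>0\<^sup>k\<close>, and from there the operators
  \<open>x\<^sub>j \<partial>\<^sub>0\<close> reach every monomial; indeterminates are numbered from 0 (\<open>simple_rep_sym_rep\<close>).

  Elements of \<open>U(L)\<close> are cosets in the free algebra on \<open>L\<close>. Identities in \<open>U(L)\<close> are stated for
  representatives, as membership of a difference in the ideal \<open>env_ideal L\<close>, so that they can be proved by
  computing in the ring \<^typ>\<open>nc_poly\<close>.
\<close>

section \<open>Linear extension of functions\<close>

abbreviation linear_maps :: "(complex, 'v, 'm) module_scheme \<Rightarrow> (complex, 'w, 'k) module_scheme \<Rightarrow> ('v \<Rightarrow> 'w) set" where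
  "linear_maps V W \<equiv> LinearCombinations.module_hom CC V W"

abbreviation "single \<equiv> Poly_Mapping.single"
abbreviation "keys \<equiv> Poly_Mapping.keys"
abbreviation "lookup \<equiv> Poly_Mapping.lookup"
abbreviation "scale c \<equiv> Poly_Mapping.map ((*) c)"

lemma sum_keys_superset:
  assumes "finite S" "keys p \<subseteq> S" "\<And>x. g x 0 = 0"
  shows "(\<Sum>x\<in>keys p. g x (lookup p x)) = (\<Sum>x\<in>S. g x (lookup p x))"
  by (rule sum.mono_neutral_left) (use assms in \<open>simp_all add: in_keys_iff\<close>)

lemma sum_keys_add:
  assumes zero: "\<And>x. g x 0 = 0" and add: "\<And>x a b. g x (a + b) = g x a + g x b"
  shows "(\<Sum>x\<in>keys (p + q). g x (lookup (p + q) x))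
    = (\<Sum>x\<in>keys p. g x (lookup p x)) + (\<Sum>x\<in>keys q. g x (lookup q x))"
proof -
  let ?S = "keys p \<union> keys q"
  have "(\<Sum>x\<in>keys r. g x (lookup r x)) = (\<Sum>x\<in>?S. g x (lookup r x))" if "keys r \<subseteq> ?S" for r
    by (rule sum_keys_superset) (use that zero in simp_all)
  from this[OF Poly_Mapping.keys_add] this[of p] this[of q] show ?thesis
    by (simp add: lookup_add add sum.distrib)
qed

text \<open>
  Every finitely supported function is a sum of point masses, so linear statements about such functions
  only have to be checked on those.
\<close>

lemma keys_induct [consumes 1, case_names zero single add]:
  fixes p :: "'a \<Rightarrow>\<^sub>0 'b::comm_monoid_add"
  assumes "keys p \<subseteq> A"
    and "P 0"
    and "\<And>x c. x \<in> A \<Longrightarrow> P (single x c)"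
    and "\<And>p q. keys p \<subseteq> A \<Longrightarrow> keys q \<subseteq> A \<Longrightarrow> P p \<Longrightarrow> P q \<Longrightarrow> P (p + q)"
  shows "P p"
  using assms(1)
proof (induction p rule: update_induct)
  case const
  show ?case by (rule assms(2))
next
  case (update f a b)
  have split: "Poly_Mapping.update a b f = f + single a b"
    using update.hyps(1)
    by (intro poly_mapping_eqI) (auto simp add: lookup_update lookup_add lookup_single in_keys_iff when_def)
  have keys: "keys f \<subseteq> A" "a \<in> A"
    using update.prems update.hyps(2) by (simp_all add: keys_update)
  show ?case
    unfolding split using keys by (intro assms(4)) (simp_all add: update.IH assms(3))
qed

lemma keys_add_subset:
  "keys p \<subseteq> A \<Longrightarrow> keys q \<subseteq> A \<Longrightarrow> keys (p + q) \<subseteq> A"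
  by (rule order_trans[OF Poly_Mapping.keys_add Un_least])

lemma lookup_scale: "lookup (scale c p) x = c * lookup p x"
  for c :: "'a::semiring_0"
  by (simp add: Poly_Mapping.map.rep_eq when_def)

lemma keys_scale_subset:
  fixes c :: "'a::semiring_0"
  shows "keys p \<subseteq> A \<Longrightarrow> keys (scale c p) \<subseteq> A"
  unfolding subset_iff in_keys_iff lookup_scale by (metis mult_zero_right)

lemma keys_uminus_subset:
  "keys p \<subseteq> A \<Longrightarrow> keys (- p :: 'a \<Rightarrow>\<^sub>0 'b::ab_group_add) \<subseteq> A"
  unfolding subset_iff in_keys_iff lookup_uminus by simp

lemma keys_diff_subset:
  fixes p q :: "'a \<Rightarrow>\<^sub>0 'b::ab_group_add"
  shows "keys p \<subseteq> A \<Longrightarrow> keys q \<subseteq> A \<Longrightarrow> keys (p - q) \<subseteq> A"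
  using keys_add_subset[of p A "- q"] keys_uminus_subset[of q A] by simp

lemma field_CC: "field CC"
  by (rule class_field.field_axioms)

lemma cring_CC: "cring CC"
  by (rule class_cring.cring_axioms)

lemma scale_add_left:
  "scale (a + b) p = scale a p + scale b p"
  for a :: "'a::semiring_0"
  by (intro poly_mapping_eqI) (simp add: lookup_scale lookup_add distrib_right)

lemma scale_add_right:
  "scale a (p + q) = scale a p + scale a q"
  for a :: "'a::semiring_0"
  by (intro poly_mapping_eqI) (simp add: lookup_scale lookup_add distrib_left)

lemma scale_assoc:
  "scale (a * b) p = scale a (scale b p)"
  for a :: "'a::semiring_0"
  by (intro poly_mapping_eqI) (simp add: lookup_scale mult.assoc)

lemma scale_zero: "scale a 0 = 0"
  for a :: "'a::semiring_0"
  by (intro poly_mapping_eqI) (simp add: lookup_scale)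

lemma scale_one: "scale 1 p = p"
  for p :: "_ \<Rightarrow>\<^sub>0 'a::semiring_1"
  by (intro poly_mapping_eqI) (simp add: lookup_scale)

lemma scale_minus_one: "scale (-1) p = - p"
  for p :: "_ \<Rightarrow>\<^sub>0 'a::ring_1"
  by (intro poly_mapping_eqI) (simp add: lookup_scale)

lemma scale_single: "scale a (single x b) = single x (a * b)"
  for a :: "'a::semiring_0"
  by (intro poly_mapping_eqI) (simp add: lookup_scale lookup_single when_def)

lemma vectorspace_CCI:
  fixes V :: "(complex, 'v, 'm) module_scheme"
  assumes "module CC V"
  shows "vectorspace CC V"
  using assms field_CC by (rule vectorspace.intro)

text \<open>
  Stated for an arbitrary record with the pointwise operations, so that it covers both
  \<^const>\<open>free_space\<close> and the polynomials of \<^const>\<open>sym_rep\<close>.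
\<close>

lemma module_finsupp:
  assumes "carrier V = {p. keys p \<subseteq> A}" "\<zero>\<^bsub>V\<^esub> = 0" "add V = (+)"
    and "\<And>c. (\<odot>\<^bsub>V\<^esub>) c = scale c"
  shows "module CC V"
proof (rule module_criteria)
  show "\<forall>v\<in>carrier V. \<exists>w\<in>carrier V. v \<oplus>\<^bsub>V\<^esub> w = \<zero>\<^bsub>V\<^esub>"
  proof
    fix v assume "v \<in> carrier V"
    then show "\<exists>w\<in>carrier V. v \<oplus>\<^bsub>V\<^esub> w = \<zero>\<^bsub>V\<^esub>"
      by (intro bexI[of _ "- v"]) (use assms keys_uminus_subset[of v A] in auto)
  qed
qed (simp_all add: assms cring_CC scale_add_left scale_add_right scale_assoc scale_one ac_simps
       keys_add_subset keys_scale_subset)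

lemma module_free_space: "module CC (free_space A)"
  by (rule module_finsupp) (simp_all add: free_space_def)

lemmas linear_map_closed = LinearCombinations.module_hom_closed
lemmas linear_map_add = LinearCombinations.module_hom_add
lemmas linear_map_smult = LinearCombinations.module_hom_smult
lemmas linear_maps_def = LinearCombinations.module_hom_def

text \<open>
  The action of the free algebra on a representation, the linear maps out of an induced module and the
  substitution of operators into polynomials are all of this form.
\<close>

definition lin_ext :: "(complex, 'v, 'm) module_scheme \<Rightarrow> ('a \<Rightarrow> 'v) \<Rightarrow> ('a \<Rightarrow>\<^sub>0 complex) \<Rightarrow> 'v" where
  "lin_ext V h p = (\<Oplus>\<^bsub>V\<^esub>x\<in>keys p. lookup p x \<odot>\<^bsub>V\<^esub> h x)"

text \<open>
  The module laws are restated for scalars of type \<^typ>\<open>complex\<close>, which turns them into rewrite rules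
  without side conditions on the scalars.
\<close>

locale CC_module = Module.module CC V for V :: "(complex, 'v, 'm) module_scheme" (structure)
begin

lemma smult_closed' [simp, intro]: "x \<in> carrier V \<Longrightarrow> c \<odot> x \<in> carrier V"
  by (rule smult_closed) simp_all

lemma smult_add_left: "x \<in> carrier V \<Longrightarrow> (a + b) \<odot> x = a \<odot> x \<oplus> b \<odot> x"
  using smult_l_distr[of a b x] by simp

lemma smult_add_right: "x \<in> carrier V \<Longrightarrow> y \<in> carrier V \<Longrightarrow> a \<odot> (x \<oplus> y) = a \<odot> x \<oplus> a \<odot> y"
  using smult_r_distr[of a x y] by simp

lemma smult_mult: "x \<in> carrier V \<Longrightarrow> (a * b) \<odot> x = a \<odot> (b \<odot> x)"
  using smult_assoc1[of a b x] by simp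

lemma smult_1 [simp]: "x \<in> carrier V \<Longrightarrow> 1 \<odot> x = x"
  using smult_one[of x] by simp

lemma smult_0 [simp]: "x \<in> carrier V \<Longrightarrow> 0 \<odot> x = \<zero>"
  using smult_l_null[of x] by simp

lemma smult_zero_right [simp]: "a \<odot> \<zero> = \<zero>"
  using smult_r_null[of a] by simp

lemma smult_minus1: "x \<in> carrier V \<Longrightarrow> (-1) \<odot> x = \<ominus> x"
  using smult_l_minus[of 1 x] by (simp add: class_ring_simps)

lemma lin_ext_superset:
  assumes "finite S" "keys p \<subseteq> S" "\<And>x. x \<in> S \<Longrightarrow> h x \<in> carrier V"
  shows "lin_ext V h p = (\<Oplus>x\<in>S. lookup p x \<odot> h x)"
  unfolding lin_ext_def
  by (rule add.finprod_mono_neutral_cong_left)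
     (use assms in \<open>auto simp: in_keys_iff Pi_iff\<close>)

lemma lin_ext_closed:
  "keys p \<subseteq> A \<Longrightarrow> h \<in> A \<rightarrow> carrier V \<Longrightarrow> lin_ext V h p \<in> carrier V"
  unfolding lin_ext_def by (rule finsum_closed) auto

lemma lin_ext_add:
  assumes "keys p \<subseteq> A" "keys q \<subseteq> A" "h \<in> A \<rightarrow> carrier V"
  shows "lin_ext V h (p + q) = lin_ext V h p \<oplus> lin_ext V h q"
proof -
  let ?S = "keys p \<union> keys q"
  have h: "h x \<in> carrier V" if "x \<in> ?S" for x
    using that assms by auto
  have "lin_ext V h (p + q) = (\<Oplus>x\<in>?S. lookup (p + q) x \<odot> h x)"
    by (rule lin_ext_superset) (use Poly_Mapping.keys_add[of p q] h in auto)
  also have "\<dots> = (\<Oplus>x\<in>?S. lookup p x \<odot> h x \<oplus> lookup q x \<odot> h x)"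
    by (rule finsum_cong) (use h in \<open>auto simp: lookup_add smult_add_left simp_implies_def\<close>)
  also have "\<dots> = (\<Oplus>x\<in>?S. lookup p x \<odot> h x) \<oplus> (\<Oplus>x\<in>?S. lookup q x \<odot> h x)"
    by (rule finsum_addf) (use h in auto)
  also have "\<dots> = lin_ext V h p \<oplus> lin_ext V h q"
    using lin_ext_superset[of ?S p h] lin_ext_superset[of ?S q h] h by simp
  finally show ?thesis .
qed

lemma lin_ext_single: "h x \<in> carrier V \<Longrightarrow> lin_ext V h (single x c) = c \<odot> h x"
  by (subst lin_ext_superset[of "{x}"]) (auto simp: finsum_singleton)

lemma lin_ext_zero: "lin_ext V h 0 = \<zero>"
  by (simp add: lin_ext_def)

lemma lin_ext_scale:
  assumes "keys p \<subseteq> A" "h \<in> A \<rightarrow> carrier V"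
  shows "lin_ext V h (scale c p) = c \<odot> lin_ext V h p"
  using assms(1)
proof (induction p rule: keys_induct)
  case zero
  show ?case by (simp add: scale_zero lin_ext_zero)
next
  case (single x a)
  then have "h x \<in> carrier V" using assms(2) by auto
  then show ?case by (simp add: scale_single lin_ext_single smult_mult)
next
  case (add p q)
  with assms(2) show ?case
    by (simp add: scale_add_right lin_ext_add[of _ A] keys_scale_subset[of _ A] lin_ext_closed[of _ A]
        smult_add_right)
qed

end

section \<open>Universal enveloping algebras\<close>

locale matrix_lie_algebra =
  fixes L :: "complex mat set"
  assumes L_add: "X \<in> L \<Longrightarrow> Y \<in> L \<Longrightarrow> X + Y \<in> L"
    and L_smult: "X \<in> L \<Longrightarrow> c \<cdot>\<^sub>m X \<in> L"
    and L_bracket: "X \<in> L \<Longrightarrow> Y \<in> L \<Longrightarrow> lie_bracket X Y \<in> L"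

text \<open>
  The carrier of \<^const>\<open>free_alg\<close>, as a constant of its own so that membership is decided by closure
  rules and not by unfolding supports.
\<close>

definition free_elems :: "complex mat set \<Rightarrow> nc_poly set" where
  "free_elems L = {a. keys a \<subseteq> {xs. set xs \<subseteq> L}}"

lemma carrier_free_alg: "carrier (free_alg L) = free_elems L"
  by (auto simp: free_alg_def free_elems_def)

lemma free_alg_simps:
  "mult (free_alg L) = (*)" "one (free_alg L) = 1" "zero (free_alg L) = 0" "add (free_alg L) = (+)"
  by (simp_all add: free_alg_def)

lemma single_mult_list:
  "single xs c * single ys d = single (xs @ ys) (c * d)"
  by (simp add: mult_single plus_list_def)

lemma one_eq_single_Nil: "1 = single [] 1"
  by (metis single_one zero_list_def)

lemma free_elems_zero [simp]: "0 \<in> free_elems L"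
  by (simp add: free_elems_def)

lemma free_elems_one [simp]: "1 \<in> free_elems L"
  by (simp add: one_eq_single_Nil free_elems_def)

lemma free_elems_letter [simp]: "X \<in> L \<Longrightarrow> letter X \<in> free_elems L"
  by (simp add: letter_def free_elems_def)

lemma free_elems_scalar [simp]: "scalar c \<in> free_elems L"
  by (simp add: scalar_def free_elems_def)

lemma free_elems_add [simp]: "a \<in> free_elems L \<Longrightarrow> b \<in> free_elems L \<Longrightarrow> a + b \<in> free_elems L"
  unfolding free_elems_def by (simp add: keys_add_subset)

lemma free_elems_diff [simp]: "a \<in> free_elems L \<Longrightarrow> b \<in> free_elems L \<Longrightarrow> a - b \<in> free_elems L"
  unfolding free_elems_def by (simp add: keys_diff_subset)

lemma free_elems_uminus [simp]: "a \<in> free_elems L \<Longrightarrow> - a \<in> free_elems L"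
  by (simp add: free_elems_def)

lemma free_elems_mult [simp]:
  assumes "a \<in> free_elems L" "b \<in> free_elems L"
  shows "a * b \<in> free_elems L"
proof -
  have "keys (a * b) \<subseteq> {x + y |x y. x \<in> keys a \<and> y \<in> keys b}"
    by (rule keys_mult)
  with assms show ?thesis unfolding free_elems_def by (force simp: plus_list_def)
qed

lemma free_elems_power [simp]: "a \<in> free_elems L \<Longrightarrow> a ^ m \<in> free_elems L"
  by (induction m) (simp_all)

lemma free_elems_mono: "P \<subseteq> L \<Longrightarrow> a \<in> free_elems P \<Longrightarrow> a \<in> free_elems L"
  unfolding free_elems_def by blast

lemma free_elems_induct [consumes 1, case_names zero single add]:
  assumes "a \<in> free_elems K" "Q 0"
    and "\<And>xs c. set xs \<subseteq> K \<Longrightarrow> Q (single xs c)"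
    and "\<And>a b. a \<in> free_elems K \<Longrightarrow> b \<in> free_elems K \<Longrightarrow> Q a \<Longrightarrow> Q b \<Longrightarrow> Q (a + b)"
  shows "Q a"
  using assms(1) unfolding free_elems_def mem_Collect_eq
  by (rule keys_induct) (use assms(2-) in \<open>simp_all add: free_elems_def\<close>)

lemma scalar_central: "scalar c * a = a * scalar c"
proof -
  have "keys a \<subseteq> UNIV" by simp
  then show ?thesis
    by (induction a rule: keys_induct)
       (simp_all add: scalar_def single_mult_list mult.commute distrib_left distrib_right)
qed

lemma scalar_zero: "scalar 0 = 0"
  by (simp add: scalar_def)

lemma scalar_minus_one: "scalar (-1) = -1"
  by (simp add: scalar_def one_eq_single_Nil single_uminus)

lemma ring_free_alg: "ring (free_alg L)"
proof (rule ringI)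
  show "abelian_group (free_alg L)"
  proof (rule abelian_groupI)
    fix a assume "a \<in> carrier (free_alg L)"
    then show "\<exists>b\<in>carrier (free_alg L). b \<oplus>\<^bsub>free_alg L\<^esub> a = \<zero>\<^bsub>free_alg L\<^esub>"
      by (intro bexI[of _ "- a"])
         (simp_all add: carrier_free_alg free_alg_simps)
  qed (simp_all add: carrier_free_alg free_alg_simps ac_simps)
  show "monoid (free_alg L)"
    by (rule monoidI)
       (simp_all add: carrier_free_alg free_alg_simps ac_simps)
qed (simp_all add: carrier_free_alg free_alg_simps distrib_left distrib_right)

context matrix_lie_algebra
begin

lemma env_rels_subset: "env_rels L \<subseteq> free_elems L"
  unfolding env_rels_def
  using L_add L_smult L_bracket
  by auto

lemma ideal_env_ideal: "ideal (env_ideal L) (free_alg L)"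
  unfolding env_ideal_def
  by (rule ring.genideal_ideal[OF ring_free_alg]) (use env_rels_subset in \<open>simp add: carrier_free_alg\<close>)

lemma env_rels_in_ideal: "env_rels L \<subseteq> env_ideal L"
  unfolding env_ideal_def
  by (rule ring.genideal_self[OF ring_free_alg]) (use env_rels_subset in \<open>simp add: carrier_free_alg\<close>)

text \<open>
  Every fact that descends from the free algebra to \<open>U(L)\<close> is proved with this: the elements for which it
  holds form a two-sided ideal containing the defining relations.
\<close>

lemma env_ideal_least:
  assumes "J \<subseteq> free_elems L" "env_rels L \<subseteq> J" "0 \<in> J"
    and "\<And>a b. a \<in> J \<Longrightarrow> b \<in> J \<Longrightarrow> a + b \<in> J"
    and "\<And>a b. a \<in> free_elems L \<Longrightarrow> b \<in> J \<Longrightarrow> a * b \<in> J"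
    and "\<And>a b. a \<in> J \<Longrightarrow> b \<in> free_elems L \<Longrightarrow> a * b \<in> J"
  shows "env_ideal L \<subseteq> J"
  unfolding env_ideal_def
proof (rule ring.genideal_minimal[OF ring_free_alg _ assms(2)], rule idealI[OF ring_free_alg])
  have uminus: "- a \<in> J" if "a \<in> J" for a
    using assms(5)[OF free_elems_uminus[OF free_elems_one] that] by simp
  interpret ring "free_alg L" by (rule ring_free_alg)
  show "subgroup J (add_monoid (free_alg L))"
  proof (rule add.subgroupI)
    show "J \<subseteq> carrier (free_alg L)" using assms(1) by (simp add: carrier_free_alg)
    show "J \<noteq> {}" using assms(3) by auto
    fix a assume a: "a \<in> J"
    then have "\<ominus>\<^bsub>free_alg L\<^esub> a = - a"
      using assms(1) uminus[OF a]
      by (intro minus_equality) (auto simp: carrier_free_alg free_alg_simps)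
    then show "\<ominus>\<^bsub>free_alg L\<^esub> a \<in> J" using uminus[OF a] by simp
  qed (use assms(4) in \<open>simp add: free_alg_simps\<close>)
qed (use assms(5,6) in \<open>simp_all add: carrier_free_alg free_alg_simps\<close>)

lemma env_ideal_subset: "a \<in> env_ideal L \<Longrightarrow> a \<in> free_elems L"
  using ideal.Icarr[OF ideal_env_ideal] by (simp add: carrier_free_alg)

lemma env_ideal_zero: "0 \<in> env_ideal L"
  using additive_subgroup.zero_closed[OF ideal.axioms(1)[OF ideal_env_ideal]]
  by (simp add: free_alg_simps)

lemma env_ideal_add: "a \<in> env_ideal L \<Longrightarrow> b \<in> env_ideal L \<Longrightarrow> a + b \<in> env_ideal L"
  using additive_subgroup.a_closed[OF ideal.axioms(1)[OF ideal_env_ideal]]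
  by (simp add: free_alg_simps)

lemma env_ideal_lmult: "a \<in> free_elems L \<Longrightarrow> b \<in> env_ideal L \<Longrightarrow> a * b \<in> env_ideal L"
  using ideal.I_l_closed[OF ideal_env_ideal] by (simp add: free_alg_simps carrier_free_alg)

lemma env_ideal_rmult: "a \<in> env_ideal L \<Longrightarrow> b \<in> free_elems L \<Longrightarrow> a * b \<in> env_ideal L"
  using ideal.I_r_closed[OF ideal_env_ideal] by (simp add: free_alg_simps carrier_free_alg)

lemma env_ideal_uminus: "a \<in> env_ideal L \<Longrightarrow> - a \<in> env_ideal L"
  using env_ideal_lmult[OF free_elems_uminus[OF free_elems_one]] by fastforce

lemma env_ideal_diff: "a \<in> env_ideal L \<Longrightarrow> b \<in> env_ideal L \<Longrightarrow> a - b \<in> env_ideal L"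
  using env_ideal_add[OF _ env_ideal_uminus] by fastforce

lemma env_class_eq: "env_class L a = {j + a | j. j \<in> env_ideal L}"
  by (auto simp: env_class_def a_r_coset_def r_coset_def free_alg_simps)

lemma env_class_eq_iff: "env_class L a = env_class L b \<longleftrightarrow> a - b \<in> env_ideal L"
proof
  assume "env_class L a = env_class L b"
  moreover have "a \<in> env_class L a" unfolding env_class_eq using env_ideal_zero by force
  ultimately show "a - b \<in> env_ideal L" unfolding env_class_eq by auto
next
  assume ab: "a - b \<in> env_ideal L"
  have "\<exists>j'. j + a = j' + b \<and> j' \<in> env_ideal L" if "j \<in> env_ideal L" for j
    by (rule exI[of _ "j + (a - b)"]) (use env_ideal_add[OF that ab] in simp)
  moreover have "\<exists>j'. j + b = j' + a \<and> j' \<in> env_ideal L" if "j \<in> env_ideal L" for j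
    by (rule exI[of _ "j - (a - b)"]) (use env_ideal_diff[OF that ab] in simp)
  ultimately show "env_class L a = env_class L b" unfolding env_class_eq by blast
qed

lemma ring_env_alg: "ring (env_alg L)"
  unfolding env_alg_def by (rule ideal.quotient_is_ring[OF ideal_env_ideal])

lemma env_class_ring_hom: "env_class L \<in> Ring.ring_hom (free_alg L) (env_alg L)"
  using ideal.rcos_ring_hom[OF ideal_env_ideal] by (simp add: env_alg_def env_class_def[abs_def])

lemma env_class_closed [simp]: "a \<in> free_elems L \<Longrightarrow> env_class L a \<in> carrier (env_alg L)"
  using ring_hom_closed[OF env_class_ring_hom] by (simp add: carrier_free_alg)

lemma env_class_add:
  "a \<in> free_elems L \<Longrightarrow> b \<in> free_elems L \<Longrightarrow>
    env_class L (a + b) = env_class L a \<oplus>\<^bsub>env_alg L\<^esub> env_class L b"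
  using ring_hom_add[OF env_class_ring_hom, of a b] by (simp add: carrier_free_alg free_alg_simps)

lemma env_class_mult:
  "a \<in> free_elems L \<Longrightarrow> b \<in> free_elems L \<Longrightarrow>
    env_class L (a * b) = env_class L a \<otimes>\<^bsub>env_alg L\<^esub> env_class L b"
  using ring_hom_mult[OF env_class_ring_hom, of a b] by (simp add: carrier_free_alg free_alg_simps)

lemma env_class_one: "env_class L 1 = \<one>\<^bsub>env_alg L\<^esub>"
  using ring_hom_one[OF env_class_ring_hom] by (simp add: free_alg_simps)

lemma carrier_env_alg: "carrier (env_alg L) = env_class L ` free_elems L"
  by (auto simp: env_alg_def FactRing_def A_RCOSETS_def RCOSETS_def env_class_def a_r_coset_def
      carrier_free_alg)

lemma env_algE:
  assumes "u \<in> carrier (env_alg L)"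
  obtains a where "a \<in> free_elems L" "u = env_class L a"
  using assms unfolding carrier_env_alg by blast

lemma env_class_power:
  "a \<in> free_elems L \<Longrightarrow> env_class L (a ^ m) = env_class L a [^]\<^bsub>env_alg L\<^esub> m"
proof (induction m)
  case (Suc m)
  then show ?case
    by (simp add: power_Suc2 env_class_mult del: power_Suc mem_Collect_eq)
qed (simp add: env_class_one)

text \<open>
  Functions that are constant on cosets of the ideal descend to \<open>U(L)\<close>; both \<^const>\<open>env_map\<close> and
  \<^const>\<open>env_act\<close> are obtained in this way.
\<close>

lemma the_elem_image_env_class:
  assumes "\<And>j. j \<in> env_ideal L \<Longrightarrow> f (j + a) = f a"
  shows "the_elem (f ` env_class L a) = f a"
proof -
  have "f ` env_class L a = {f a}"
    unfolding env_class_eq using assms env_ideal_zero by (auto simp: image_iff)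
  then show ?thesis by simp
qed

text \<open>
  The elements of the free algebra on \<open>P\<close> that vanish in \<open>U(L)\<close> form an ideal containing the relations
  of \<open>U(P)\<close>, so \<open>U(P) \<rightarrow> U(L)\<close> is well defined.
\<close>

lemma env_map_class:
  assumes "matrix_lie_algebra P" "P \<subseteq> L" "a \<in> free_elems P"
  shows "env_map P L (env_class P a) = env_class L a"
proof -
  interpret P: matrix_lie_algebra P by fact
  have "env_ideal P \<subseteq> env_ideal L \<inter> free_elems P"
  proof (rule P.env_ideal_least)
    have "env_rels P \<subseteq> env_rels L" unfolding env_rels_def using assms(2) by fast
    then show "env_rels P \<subseteq> env_ideal L \<inter> free_elems P"
      using env_rels_in_ideal P.env_rels_subset by blast
  qed (use free_elems_mono[OF assms(2)] in
      \<open>auto intro: env_ideal_zero env_ideal_add env_ideal_lmult env_ideal_rmult\<close>)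
  then show ?thesis
    unfolding env_map_def by (intro P.the_elem_image_env_class) (auto simp: env_class_eq_iff)
qed

end

section \<open>Representations as modules over the enveloping algebra\<close>

locale lie_representation = matrix_lie_algebra L for L +
  fixes V :: "'v rep" (structure)
  assumes lie_rep: "lie_rep L V"

sublocale lie_representation \<subseteq> CC_module V
  using lie_rep by (simp add: CC_module_def lie_rep_def vectorspace_def)

context lie_representation
begin

lemma act_hom: "X \<in> L \<Longrightarrow> act V X \<in> linear_maps V V"
  using lie_rep by (simp add: lie_rep_def)

lemma act_closed [simp]: "X \<in> L \<Longrightarrow> v \<in> carrier V \<Longrightarrow> act V X v \<in> carrier V"
  using act_hom[of X] by (auto simp: linear_maps_def)

lemma act_add: "X \<in> L \<Longrightarrow> v \<in> carrier V \<Longrightarrow> w \<in> carrier V \<Longrightarrow> act V X (v \<oplus> w) = act V X v \<oplus> act V X w"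
  using act_hom[of X] by (auto simp: linear_maps_def)

lemma act_smult: "X \<in> L \<Longrightarrow> v \<in> carrier V \<Longrightarrow> act V X (c \<odot> v) = c \<odot> act V X v"
  using act_hom[of X] by (auto simp: linear_maps_def)

lemma act_mat_add: "X \<in> L \<Longrightarrow> Y \<in> L \<Longrightarrow> v \<in> carrier V \<Longrightarrow> act V (X + Y) v = act V X v \<oplus> act V Y v"
  using lie_rep by (simp add: lie_rep_def)

lemma act_mat_smult: "X \<in> L \<Longrightarrow> v \<in> carrier V \<Longrightarrow> act V (c \<cdot>\<^sub>m X) v = c \<odot> act V X v"
  using lie_rep by (simp add: lie_rep_def)

lemma act_bracket: "X \<in> L \<Longrightarrow> Y \<in> L \<Longrightarrow> v \<in> carrier V \<Longrightarrow>
    act V (lie_bracket X Y) v = act V X (act V Y v) \<ominus> act V Y (act V X v)"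
  using lie_rep by (simp add: lie_rep_def)

lemma act_act: "X \<in> L \<Longrightarrow> Y \<in> L \<Longrightarrow> v \<in> carrier V \<Longrightarrow>
    act V X (act V Y v) = act V (lie_bracket X Y) v \<oplus> act V Y (act V X v)"
  by (simp add: act_bracket a_minus_def a_assoc l_neg)

lemma word_closed: "set xs \<subseteq> L \<Longrightarrow> v \<in> carrier V \<Longrightarrow> foldr (act V) xs v \<in> carrier V"
  by (induction xs) simp_all

lemma word_add: "set xs \<subseteq> L \<Longrightarrow> v \<in> carrier V \<Longrightarrow> w \<in> carrier V \<Longrightarrow>
    foldr (act V) xs (v \<oplus> w) = foldr (act V) xs v \<oplus> foldr (act V) xs w"
  by (induction xs) (simp_all add: act_add word_closed)

lemma word_smult: "set xs \<subseteq> L \<Longrightarrow> v \<in> carrier V \<Longrightarrow>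
    foldr (act V) xs (c \<odot> v) = c \<odot> foldr (act V) xs v"
  by (induction xs) (simp_all add: act_smult word_closed)

lemma free_act_lin_ext: "free_act V a v = lin_ext V (\<lambda>xs. foldr (act V) xs v) a"
  by (simp add: free_act_def lin_ext_def)

lemma word_Pi: "v \<in> carrier V \<Longrightarrow> (\<lambda>xs. foldr (act V) xs v) \<in> {xs. set xs \<subseteq> L} \<rightarrow> carrier V"
  by (simp add: word_closed)

lemma free_act_closed [simp]: "a \<in> free_elems L \<Longrightarrow> v \<in> carrier V \<Longrightarrow> free_act V a v \<in> carrier V"
  unfolding free_act_lin_ext by (rule lin_ext_closed[OF _ word_Pi]) (simp_all add: free_elems_def)

lemma free_act_add: "a \<in> free_elems L \<Longrightarrow> b \<in> free_elems L \<Longrightarrow> v \<in> carrier V \<Longrightarrow>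
    free_act V (a + b) v = free_act V a v \<oplus> free_act V b v"
  unfolding free_act_lin_ext by (rule lin_ext_add[OF _ _ word_Pi]) (simp_all add: free_elems_def)

lemma free_act_single: "set xs \<subseteq> L \<Longrightarrow> v \<in> carrier V \<Longrightarrow>
    free_act V (single xs c) v = c \<odot> foldr (act V) xs v"
  unfolding free_act_lin_ext by (rule lin_ext_single) (simp add: word_closed)

lemma free_act_zero: "free_act V 0 v = \<zero>"
  by (simp add: free_act_lin_ext lin_ext_zero)

lemma free_act_letter: "X \<in> L \<Longrightarrow> v \<in> carrier V \<Longrightarrow> free_act V (letter X) v = act V X v"
  by (simp add: letter_def free_act_single)

lemma free_act_scalar: "v \<in> carrier V \<Longrightarrow> free_act V (scalar c) v = c \<odot> v"
  by (simp add: scalar_def free_act_single)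

lemma free_act_vec_add:
  assumes "a \<in> free_elems L" "v \<in> carrier V" "w \<in> carrier V"
  shows "free_act V a (v \<oplus> w) = free_act V a v \<oplus> free_act V a w"
  using assms(1)
  by (induction a rule: free_elems_induct)
     (use assms(2,3) in \<open>simp_all add: free_act_zero free_act_single free_act_add word_add word_closed
        smult_add_right a_ac\<close>)

lemma free_act_vec_smult:
  assumes "a \<in> free_elems L" "v \<in> carrier V"
  shows "free_act V a (c \<odot> v) = c \<odot> free_act V a v"
  using assms(1)
  by (induction a rule: free_elems_induct)
     (use assms(2) in \<open>simp_all add: free_act_zero free_act_single free_act_add word_smult word_closed
        smult_add_right flip: smult_mult\<close>, simp_all add: mult.commute)

lemma free_act_single_mult:
  assumes xs: "set xs \<subseteq> L" and b: "b \<in> free_elems L" and v: "v \<in> carrier V"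
  shows "free_act V (single xs c * b) v = c \<odot> foldr (act V) xs (free_act V b v)"
  using b
proof (induction b rule: free_elems_induct)
  case zero
  have "foldr (act V) xs \<zero> = \<zero>"
    using word_smult[OF xs zero_closed, of 0] word_closed[OF xs zero_closed] by simp
  then show ?case by (simp add: free_act_zero)
next
  case (single ys d)
  then show ?case
    using xs v by (simp add: single_mult_list free_act_single word_closed word_smult smult_mult)
next
  case (add a b)
  have "single xs c \<in> free_elems L" using xs by (simp add: free_elems_def)
  with add xs v show ?case
    by (simp add: distrib_left free_act_add word_add word_closed smult_add_right)
qed

text \<open>
  Concatenation of words is composition of their actions, and both sides are linear in either factor.
\<close>

lemma free_act_mult:
  assumes "a \<in> free_elems L" "b \<in> free_elems L" "v \<in> carrier V"
  shows "free_act V (a * b) v = free_act V a (free_act V b v)"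
  using assms(1)
  by (induction a rule: free_elems_induct)
     (use assms(2,3) in \<open>simp_all add: free_act_zero free_act_single_mult free_act_single
        distrib_right free_act_add\<close>)

lemma free_act_diff:
  assumes "a \<in> free_elems L" "b \<in> free_elems L" "v \<in> carrier V"
  shows "free_act V (a - b) v = free_act V a v \<ominus> free_act V b v"
proof -
  have "free_act V a v = free_act V (a - b) v \<oplus> free_act V b v"
    using free_act_add[of "a - b" b v] assms by simp
  then show ?thesis
    using assms by (simp add: a_minus_def a_assoc r_neg)
qed

text \<open>
  The annihilator of a representation is a two-sided ideal, and the laws of a representation say
  that it contains the relations of \<open>U(L)\<close>.
\<close>

lemma free_act_env_ideal:
  assumes "a \<in> env_ideal L" "v \<in> carrier V"
  shows "free_act V a v = \<zero>"
proof -
  let ?J = "{a \<in> free_elems L. \<forall>v\<in>carrier V. free_act V a v = \<zero>}"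
  have zero: "free_act V a \<zero> = \<zero>" if "a \<in> free_elems L" for a
    using free_act_vec_smult[OF that zero_closed, of 0] that by simp
  have cancel: "x \<oplus> (y \<oplus> (\<ominus> x \<oplus> \<ominus> y)) = \<zero>" if "x \<in> carrier V" "y \<in> carrier V" for x y
    using that by (simp add: a_lcomm[of y "\<ominus> x" "\<ominus> y"] r_neg)
  have "env_ideal L \<subseteq> ?J"
  proof (rule env_ideal_least)
    show "env_rels L \<subseteq> ?J"
    proof (intro subsetI CollectI conjI ballI)
      fix r v assume "r \<in> env_rels L" and v: "v \<in> carrier V"
      then show "free_act V r v = \<zero>"
        unfolding env_rels_def
        using L_add L_smult L_bracket
        by (auto simp: free_act_diff free_act_letter free_act_mult free_act_scalar act_mat_add
            act_mat_smult act_bracket cancel a_minus_def minus_add a_ac r_neg r_neg1 r_neg2 l_neg)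
    qed (use env_rels_subset in blast)
  qed (auto simp: free_act_zero free_act_add free_act_mult zero)
  then show ?thesis using assms by blast
qed

lemma env_act_class:
  "a \<in> free_elems L \<Longrightarrow> v \<in> carrier V \<Longrightarrow> env_act V (env_class L a) v = free_act V a v"
  unfolding env_act_def
  by (rule the_elem_image_env_class) (simp add: free_act_add free_act_env_ideal env_ideal_subset)

end

section \<open>Induced modules\<close>

lemma pairs_lmult_eq: "pairs_lmult L X p =
    (\<Sum>x\<in>keys p. single (env_gen L X \<otimes>\<^bsub>env_alg L\<^esub> fst x, snd x) (lookup p x))"
  by (simp add: pairs_lmult_def case_prod_unfold)

lemma pairs_lmult_add: "pairs_lmult L X (p + q) = pairs_lmult L X p + pairs_lmult L X q"
  unfolding pairs_lmult_eq by (rule sum_keys_add) (simp_all add: single_add)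

lemma pairs_lmult_zero: "pairs_lmult L X 0 = 0"
  by (simp add: pairs_lmult_def)

lemma pairs_lmult_single:
  "pairs_lmult L X (single (u, v) c) = single (env_gen L X \<otimes>\<^bsub>env_alg L\<^esub> u, v) c"
  by (simp add: pairs_lmult_eq)

lemma pairs_lmult_scale:
  "pairs_lmult L X (scale c p) = scale c (pairs_lmult L X p)"
proof -
  have "keys p \<subseteq> UNIV" by simp
  then show ?thesis
  proof (induction p rule: keys_induct)
    case (single x a)
    then show ?case by (cases x rule: prod.exhaust) (simp add: scale_single pairs_lmult_single)
  qed (simp_all add: scale_zero pairs_lmult_zero scale_add_right pairs_lmult_add)
qed

lemma pairs_lmult_uminus: "pairs_lmult L X (- p) = - pairs_lmult L X p"
  using pairs_lmult_scale[of L X "-1" p] by (simp add: scale_minus_one)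

lemma pairs_lmult_diff: "pairs_lmult L X (p - q) = pairs_lmult L X p - pairs_lmult L X q"
  using pairs_lmult_add[of L X p "- q"] by (simp add: pairs_lmult_uminus)

locale induced_rep = L: matrix_lie_algebra L + lie_representation P V for L P and V :: "'v rep" (structure) +
  assumes P_subset: "P \<subseteq> L"
begin

definition formal :: "((env \<times> 'v) \<Rightarrow>\<^sub>0 complex) set" where
  "formal = {p. keys p \<subseteq> carrier (env_alg L) \<times> carrier V}"

definition coset :: "((env \<times> 'v) \<Rightarrow>\<^sub>0 complex) \<Rightarrow> ((env \<times> 'v) \<Rightarrow>\<^sub>0 complex) set" where
  "coset p = {j + p | j. j \<in> tensor_null L P V}"

lemma pairs_simps:
  "carrier (pairs L V) = formal" "zero (pairs L V) = 0" "add (pairs L V) = (+)"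
  "smult (pairs L V) c = scale c"
  by (simp_all add: pairs_def free_space_def formal_def)

lemma module_pairs: "Module.module CC (pairs L V)"
  unfolding pairs_def by (rule module_free_space)

lemma formal_zero [simp]: "0 \<in> formal"
  by (simp add: formal_def)

lemma formal_add [simp]: "p \<in> formal \<Longrightarrow> q \<in> formal \<Longrightarrow> p + q \<in> formal"
  by (simp add: formal_def keys_add_subset)

lemma formal_diff [simp]: "p \<in> formal \<Longrightarrow> q \<in> formal \<Longrightarrow> p - q \<in> formal"
  by (simp add: formal_def keys_diff_subset)

lemma formal_scale [simp]: "p \<in> formal \<Longrightarrow> scale c p \<in> formal"
  by (simp add: formal_def keys_scale_subset)

lemma formal_single [simp]:
  "u \<in> carrier (env_alg L) \<Longrightarrow> v \<in> carrier V \<Longrightarrow> single (u, v) c \<in> formal"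
  by (simp add: formal_def)

lemma formal_induct [consumes 1, case_names zero single add]:
  assumes "p \<in> formal" "Q 0"
    and "\<And>u v c. u \<in> carrier (env_alg L) \<Longrightarrow> v \<in> carrier V \<Longrightarrow> Q (single (u, v) c)"
    and "\<And>p q. p \<in> formal \<Longrightarrow> q \<in> formal \<Longrightarrow> Q p \<Longrightarrow> Q q \<Longrightarrow> Q (p + q)"
  shows "Q p"
  using assms(1) unfolding formal_def mem_Collect_eq
  by (rule keys_induct) (use assms(2-) in \<open>auto simp: formal_def\<close>)

lemma env_map_closed: "x \<in> carrier (env_alg P) \<Longrightarrow> env_map P L x \<in> carrier (env_alg L)"
  using L.env_map_class[OF matrix_lie_algebra_axioms P_subset] free_elems_mono[OF P_subset]
  by (auto elim!: env_algE)

lemma env_act_closed: "x \<in> carrier (env_alg P) \<Longrightarrow> v \<in> carrier V \<Longrightarrow> env_act V x v \<in> carrier V"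
  by (auto elim!: env_algE simp: env_act_class)

lemma tensor_rels_subset: "tensor_rels L P V \<subseteq> formal"
proof -
  interpret U: Ring.ring "env_alg L" by (rule L.ring_env_alg)
  show ?thesis
    unfolding tensor_rels_def pairs_simps
    by (auto simp: env_map_closed env_act_closed)
qed

lemma null_submodule: "LinearCombinations.submodule CC (tensor_null L P V) (pairs L V)"
  unfolding tensor_null_def
  by (rule module.span_is_submodule[OF module_pairs]) (use tensor_rels_subset in \<open>simp add: pairs_simps\<close>)

lemma rels_in_null: "tensor_rels L P V \<subseteq> tensor_null L P V"
  unfolding tensor_null_def
  by (rule module.in_own_span[OF module_pairs]) (use tensor_rels_subset in \<open>simp add: pairs_simps\<close>)

lemma null_least:
  assumes "tensor_rels L P V \<subseteq> N" "N \<subseteq> formal" "0 \<in> N"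
    and "\<And>p q. p \<in> N \<Longrightarrow> q \<in> N \<Longrightarrow> p + q \<in> N"
    and "\<And>c p. p \<in> N \<Longrightarrow> scale c p \<in> N"
  shows "tensor_null L P V \<subseteq> N"
  unfolding tensor_null_def
proof (rule module.span_is_subset[OF module_pairs assms(1)])
  show "LinearCombinations.submodule CC N (pairs L V)"
    by (rule LinearCombinations.submodule.intro[OF module_pairs])
       (use assms(2-) in \<open>simp_all add: pairs_simps\<close>)
qed

lemma null_subset: "p \<in> tensor_null L P V \<Longrightarrow> p \<in> formal"
  using LinearCombinations.submodule.subset[OF null_submodule] by (auto simp: pairs_simps)

lemma null_zero: "0 \<in> tensor_null L P V"
  using LinearCombinations.submodule.zero_closed[OF null_submodule] by (simp add: pairs_simps)

lemma null_add: "p \<in> tensor_null L P V \<Longrightarrow> q \<in> tensor_null L P V \<Longrightarrow> p + q \<in> tensor_null L P V"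
  using LinearCombinations.submodule.m_closed[OF null_submodule] by (simp add: pairs_simps)

lemma null_scale: "p \<in> tensor_null L P V \<Longrightarrow> scale c p \<in> tensor_null L P V"
  using LinearCombinations.submodule.smult_closed[OF null_submodule, of c p] by (simp add: pairs_simps)

lemma null_uminus: "p \<in> tensor_null L P V \<Longrightarrow> - p \<in> tensor_null L P V"
  using null_scale[of p "-1"] by (simp add: scale_minus_one)

lemma null_diff: "p \<in> tensor_null L P V \<Longrightarrow> q \<in> tensor_null L P V \<Longrightarrow> p - q \<in> tensor_null L P V"
  using null_add[of p "- q"] by (simp add: null_uminus)

lemma coset_eq: "tensor_null L P V +>\<^bsub>pairs L V\<^esub> p = coset p"
  by (auto simp: coset_def a_r_coset_def r_coset_def pairs_simps)

lemma coset_eq_iff: "coset p = coset q \<longleftrightarrow> p - q \<in> tensor_null L P V"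
proof
  assume "coset p = coset q"
  moreover have "p \<in> coset p" unfolding coset_def using null_zero by force
  ultimately show "p - q \<in> tensor_null L P V" unfolding coset_def by auto
next
  assume pq: "p - q \<in> tensor_null L P V"
  have "\<exists>j'. j + p = j' + q \<and> j' \<in> tensor_null L P V" if "j \<in> tensor_null L P V" for j
    by (rule exI[of _ "j + (p - q)"]) (use null_add[OF that pq] in simp)
  moreover have "\<exists>j'. j + q = j' + p \<and> j' \<in> tensor_null L P V" if "j \<in> tensor_null L P V" for j
    by (rule exI[of _ "j - (p - q)"]) (use null_diff[OF that pq] in simp)
  ultimately show "coset p = coset q" unfolding coset_def by blast
qed

lemma coset_self: "p \<in> coset p"
  unfolding coset_def using null_zero by force

text \<open>
  The operations of \<^const>\<open>induced\<close> are unions over all representatives of a coset; if the result does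
  not depend on the representative, the union can be evaluated at any of them.
\<close>

lemma UN_coset:
  assumes "\<And>q. q - p \<in> tensor_null L P V \<Longrightarrow> f q = f p"
  shows "(\<Union>q\<in>coset p. f q) = f p"
proof -
  have "f q = f p" if "q \<in> coset p" for q
    using that assms unfolding coset_def by auto
  then show ?thesis using coset_self[of p] by blast
qed

lemma coset_zero: "coset 0 = tensor_null L P V"
  by (simp add: coset_def)

lemma carrier_induced: "carrier (induced L P V) = coset ` formal"
  by (auto simp: induced_def A_RCOSETS_def RCOSETS_def pairs_simps a_r_coset_def coset_eq[symmetric])

lemma induced_zero: "\<zero>\<^bsub>induced L P V\<^esub> = coset 0"
  by (simp add: induced_def coset_zero)

lemma induced_add: "coset p \<oplus>\<^bsub>induced L P V\<^esub> coset q = coset (p + q)"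
proof -
  have "\<exists>j. (j1 + p) + (j2 + q) = j + (p + q) \<and> j \<in> tensor_null L P V"
    if "j1 \<in> tensor_null L P V" "j2 \<in> tensor_null L P V" for j1 j2
    by (rule exI[of _ "j1 + j2"]) (use null_add[OF that] in \<open>simp add: ac_simps\<close>)
  moreover have "\<exists>x\<in>coset p. \<exists>y\<in>coset q. j + (p + q) = x + y" if "j \<in> tensor_null L P V" for j
    by (rule bexI[of _ "j + p"], rule bexI[of _ q])
       (use that coset_self in \<open>auto simp: coset_def ac_simps\<close>)
  ultimately show ?thesis
    by (auto simp: induced_def set_add_def set_mult_def pairs_simps coset_def[of p] coset_def[of q]
        coset_def[of "p + q"])
qed

lemma induced_smult: "c \<odot>\<^bsub>induced L P V\<^esub> coset p = coset (scale c p)"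
  unfolding induced_def coset_eq pairs_simps module.simps
proof (rule UN_coset)
  fix q assume "q - p \<in> tensor_null L P V"
  then have "scale c (q - p) \<in> tensor_null L P V"
    by (rule null_scale)
  moreover have "scale c (q - p) = scale c q - scale c p"
    by (intro poly_mapping_eqI) (simp add: lookup_scale lookup_minus right_diff_distrib)
  ultimately show "coset (scale c q) = coset (scale c p)"
    by (simp add: coset_eq_iff)
qed

end

context induced_rep
begin

lemma env_gen_closed: "X \<in> L \<Longrightarrow> env_gen L X \<in> carrier (env_alg L)"
  by (simp add: env_gen_def)

lemma env_scalar_central:
  assumes "u \<in> carrier (env_alg L)"
  shows "env_class L (scalar c) \<otimes>\<^bsub>env_alg L\<^esub> u = u \<otimes>\<^bsub>env_alg L\<^esub> env_class L (scalar c)"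
  using assms by (elim L.env_algE) (simp add: scalar_central flip: L.env_class_mult)

lemma rels_add_left:
  "u \<in> carrier (env_alg L) \<Longrightarrow> u' \<in> carrier (env_alg L) \<Longrightarrow> v \<in> carrier V \<Longrightarrow>
    pair (u \<oplus>\<^bsub>env_alg L\<^esub> u') v - pair u v - pair u' v \<in> tensor_rels L P V"
  unfolding tensor_rels_def by (intro UnI1) blast

lemma rels_add_right:
  "u \<in> carrier (env_alg L) \<Longrightarrow> v \<in> carrier V \<Longrightarrow> v' \<in> carrier V \<Longrightarrow>
    pair u (v \<oplus> v') - pair u v - pair u v' \<in> tensor_rels L P V"
  unfolding tensor_rels_def by (rule UnI1, rule UnI1, rule UnI2) blast

lemma rels_scalar:
  "u \<in> carrier (env_alg L) \<Longrightarrow> v \<in> carrier V \<Longrightarrow>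
    pair (env_class L (scalar c) \<otimes>\<^bsub>env_alg L\<^esub> u) v - c \<odot>\<^bsub>pairs L V\<^esub> pair u v \<in> tensor_rels L P V"
  unfolding tensor_rels_def by (rule UnI1, rule UnI2) blast

lemma rels_balanced:
  "u \<in> carrier (env_alg L) \<Longrightarrow> x \<in> carrier (env_alg P) \<Longrightarrow> v \<in> carrier V \<Longrightarrow>
    pair (u \<otimes>\<^bsub>env_alg L\<^esub> env_map P L x) v - pair u (env_act V x v) \<in> tensor_rels L P V"
  unfolding tensor_rels_def by (rule UnI2) blast

text \<open>
  Left multiplication by \<open>X\<close> maps each of the four families of tensor relations to itself, since \<open>U(L)\<close> is
  an associative algebra with central scalars. This makes the action on the induced module well defined.
\<close>

lemma null_lmult:
  assumes X: "X \<in> L" and p: "p \<in> tensor_null L P V"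
  shows "pairs_lmult L X p \<in> tensor_null L P V"
proof -
  interpret U: Ring.ring "env_alg L" by (rule L.ring_env_alg)
  note G = env_gen_closed[OF X]
  have "tensor_null L P V \<subseteq> {p \<in> formal. pairs_lmult L X p \<in> tensor_null L P V}" (is "_ \<subseteq> ?N")
  proof (rule null_least)
    have "pairs_lmult L X r \<in> tensor_rels L P V" if "r \<in> tensor_rels L P V" for r
      using that[unfolded tensor_rels_def]
    proof (elim UnE CollectE exE conjE)
      fix u u' v
      assume "r = pair (u \<oplus>\<^bsub>env_alg L\<^esub> u') v - pair u v - pair u' v"
        "u \<in> carrier (env_alg L)" "u' \<in> carrier (env_alg L)" "v \<in> carrier V"
      then show "pairs_lmult L X r \<in> tensor_rels L P V"
        using rels_add_left[of "env_gen L X \<otimes>\<^bsub>env_alg L\<^esub> u" "env_gen L X \<otimes>\<^bsub>env_alg L\<^esub> u'" v] G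
        by (simp add: pairs_lmult_diff pairs_lmult_single U.r_distr)
    next
      fix u v v'
      assume "r = pair u (v \<oplus> v') - pair u v - pair u v'"
        "u \<in> carrier (env_alg L)" "v \<in> carrier V" "v' \<in> carrier V"
      then show "pairs_lmult L X r \<in> tensor_rels L P V"
        using rels_add_right[of "env_gen L X \<otimes>\<^bsub>env_alg L\<^esub> u" v v'] G
        by (simp add: pairs_lmult_diff pairs_lmult_single)
    next
      fix c u v
      assume r: "r = pair (env_class L (scalar c) \<otimes>\<^bsub>env_alg L\<^esub> u) v - c \<odot>\<^bsub>pairs L V\<^esub> pair u v"
        "u \<in> carrier (env_alg L)" "v \<in> carrier V"
      have "env_gen L X \<otimes>\<^bsub>env_alg L\<^esub> (env_class L (scalar c) \<otimes>\<^bsub>env_alg L\<^esub> u)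
          = env_class L (scalar c) \<otimes>\<^bsub>env_alg L\<^esub> (env_gen L X \<otimes>\<^bsub>env_alg L\<^esub> u)"
        using G r(2) env_scalar_central[OF G, of c] U.m_assoc[of "env_gen L X" "env_class L (scalar c)" u]
          U.m_assoc[of "env_class L (scalar c)" "env_gen L X" u]
        by simp
      then show "pairs_lmult L X r \<in> tensor_rels L P V"
        using rels_scalar[of "env_gen L X \<otimes>\<^bsub>env_alg L\<^esub> u" v c] G r
        by (simp add: pairs_lmult_diff pairs_lmult_single pairs_simps pairs_lmult_scale)
    next
      fix u x v
      assume "r = pair (u \<otimes>\<^bsub>env_alg L\<^esub> env_map P L x) v - pair u (env_act V x v)"
        "u \<in> carrier (env_alg L)" "x \<in> carrier (env_alg P)" "v \<in> carrier V"
      then show "pairs_lmult L X r \<in> tensor_rels L P V"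
        using rels_balanced[of "env_gen L X \<otimes>\<^bsub>env_alg L\<^esub> u" x v] G
        by (simp add: pairs_lmult_diff pairs_lmult_single U.m_assoc env_map_closed)
    qed
    then show "tensor_rels L P V \<subseteq> ?N"
      using rels_in_null tensor_rels_subset by blast
  qed (auto simp: pairs_lmult_zero pairs_lmult_add pairs_lmult_scale null_zero null_add null_scale)
  then show ?thesis using p by blast
qed

lemma formal_lmult: "X \<in> L \<Longrightarrow> p \<in> formal \<Longrightarrow> pairs_lmult L X p \<in> formal"
proof -
  interpret U: Ring.ring "env_alg L" by (rule L.ring_env_alg)
  assume X: "X \<in> L" and "p \<in> formal"
  from this(2) show "pairs_lmult L X p \<in> formal"
    by (induction p rule: formal_induct)
       (use env_gen_closed[OF X] in \<open>simp_all add: pairs_lmult_zero pairs_lmult_add pairs_lmult_single\<close>)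
qed

lemma induced_act: "X \<in> L \<Longrightarrow> act (induced L P V) X (coset p) = coset (pairs_lmult L X p)"
  unfolding induced_def coset_eq rep.simps
  by (rule UN_coset) (simp add: coset_eq_iff null_lmult flip: pairs_lmult_diff)

lemma module_induced: "Module.module CC (induced L P V)"
proof (rule module_criteria)
  let ?M = "induced L P V"
  show "\<forall>v\<in>carrier ?M. \<exists>w\<in>carrier ?M. v \<oplus>\<^bsub>?M\<^esub> w = \<zero>\<^bsub>?M\<^esub>"
  proof
    fix v assume "v \<in> carrier ?M"
    then obtain p where "p \<in> formal" "v = coset p" by (auto simp: carrier_induced)
    then show "\<exists>w\<in>carrier ?M. v \<oplus>\<^bsub>?M\<^esub> w = \<zero>\<^bsub>?M\<^esub>"
      using formal_diff[OF formal_zero]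
      by (intro bexI[of _ "coset (- p)"]) (auto simp: carrier_induced induced_add induced_zero)
  qed
qed (auto simp: carrier_induced induced_add induced_zero induced_smult cring_CC
      scale_add_left scale_add_right scale_assoc scale_one ac_simps)

text \<open>
  Pure tensors given by a representative of the first factor in the free algebra.
\<close>

abbreviation tens :: "nc_poly \<Rightarrow> 'v \<Rightarrow> ((env \<times> 'v) \<Rightarrow>\<^sub>0 complex) set" where
  "tens a v \<equiv> tensor L P V (env_class L a) v"

lemma tensor_eq: "tensor L P V u v = coset (pair u v)"
  by (simp add: tensor_def coset_eq)

lemma tensor_closed:
  "u \<in> carrier (env_alg L) \<Longrightarrow> v \<in> carrier V \<Longrightarrow> tensor L P V u v \<in> carrier (induced L P V)"
  by (simp add: tensor_eq carrier_induced)

lemma tens_closed [simp]: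
  "a \<in> free_elems L \<Longrightarrow> v \<in> carrier V \<Longrightarrow> tens a v \<in> carrier (induced L P V)"
  by (simp add: tensor_closed)

lemma tens_eqI: "a - b \<in> env_ideal L \<Longrightarrow> tens a v = tens b v"
  using L.env_class_eq_iff by metis

lemma coset_eqI:
  assumes "p - q - r \<in> tensor_rels L P V"
  shows "coset p = coset (q + r)"
  using assms rels_in_null by (auto simp: coset_eq_iff diff_diff_add)

lemma tens_add_left:
  assumes "a \<in> free_elems L" "b \<in> free_elems L" "v \<in> carrier V"
  shows "tens (a + b) v = tens a v \<oplus>\<^bsub>induced L P V\<^esub> tens b v"
  unfolding tensor_eq induced_add
  by (rule coset_eqI) (use assms rels_add_left in \<open>simp add: L.env_class_add\<close>)

lemma tens_add_right:
  assumes "a \<in> free_elems L" "v \<in> carrier V" "w \<in> carrier V"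
  shows "tens a (v \<oplus> w) = tens a v \<oplus>\<^bsub>induced L P V\<^esub> tens a w"
  unfolding tensor_eq induced_add
  by (rule coset_eqI) (use assms rels_add_right in simp)

lemma tens_scalar:
  assumes "a \<in> free_elems L" "v \<in> carrier V"
  shows "tens (scalar c * a) v = c \<odot>\<^bsub>induced L P V\<^esub> tens a v"
  unfolding tensor_eq induced_smult coset_eq_iff
  by (rule subsetD[OF rels_in_null])
     (use assms rels_scalar in \<open>simp add: L.env_class_mult pairs_simps\<close>)

lemma tens_balanced:
  assumes "a \<in> free_elems L" "b \<in> free_elems P" "v \<in> carrier V"
  shows "tens (a * b) v = tens a (free_act V b v)"
proof -
  have b: "b \<in> free_elems L" using assms(2) P_subset free_elems_mono by blast
  have "pair (env_class L a \<otimes>\<^bsub>env_alg L\<^esub> env_map P L (env_class P b)) v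
      - pair (env_class L a) (env_act V (env_class P b) v) \<in> tensor_rels L P V"
    using assms by (simp add: rels_balanced)
  then show ?thesis
    using assms b rels_in_null
    by (auto simp: tensor_eq coset_eq_iff L.env_class_mult env_act_class
        L.env_map_class[OF matrix_lie_algebra_axioms P_subset])
qed

lemma tens_letter:
  "a \<in> free_elems L \<Longrightarrow> X \<in> P \<Longrightarrow> v \<in> carrier V \<Longrightarrow> tens (a * letter X) v = tens a (act V X v)"
  by (simp add: tens_balanced free_act_letter)

lemma tens_smult:
  assumes "a \<in> free_elems L" "v \<in> carrier V"
  shows "tens a (c \<odot> v) = c \<odot>\<^bsub>induced L P V\<^esub> tens a v"
  using tens_balanced[OF assms(1) free_elems_scalar assms(2), of c] assms
  by (simp add: free_act_scalar tens_scalar flip: scalar_central)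

lemma act_tens:
  assumes "X \<in> L" "a \<in> free_elems L" "v \<in> carrier V"
  shows "act (induced L P V) X (tens a v) = tens (letter X * a) v"
  using assms by (simp add: tensor_eq induced_act pairs_lmult_single env_gen_def L.env_class_mult)

lemma tens_zero: "v \<in> carrier V \<Longrightarrow> tens 0 v = \<zero>\<^bsub>induced L P V\<^esub>"
proof -
  interpret M: CC_module "induced L P V" by (simp add: CC_module_def module_induced)
  show "v \<in> carrier V \<Longrightarrow> ?thesis"
    using tens_scalar[of 0 v 0] by (simp add: scalar_zero)
qed

text \<open>
  Scalars can be moved into the first factor of a pure tensor, so sums of pure tensors exhaust the induced
  module.
\<close>

lemma induced_induct [consumes 1, case_names tens add]:
  assumes "x \<in> carrier (induced L P V)"
    and "\<And>a v. a \<in> free_elems L \<Longrightarrow> v \<in> carrier V \<Longrightarrow> Q (tens a v)"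
    and "\<And>x y. x \<in> carrier (induced L P V) \<Longrightarrow> y \<in> carrier (induced L P V) \<Longrightarrow> Q x \<Longrightarrow> Q y \<Longrightarrow>
      Q (x \<oplus>\<^bsub>induced L P V\<^esub> y)"
  shows "Q x"
proof -
  from assms(1) obtain p where p: "p \<in> formal" "x = coset p" by (auto simp: carrier_induced)
  from p(1) have "Q (coset p)"
  proof (induction p rule: formal_induct)
    case zero
    show ?case
      using assms(2)[OF free_elems_zero zero_closed] tens_zero[OF zero_closed] by (simp add: induced_zero)
  next
    case (single u v c)
    then obtain a where a: "a \<in> free_elems L" "u = env_class L a" by (elim L.env_algE)
    have "coset (single (u, v) c) = tens (scalar c * a) v"
      using a single tens_scalar[OF a(1), of v c] by (simp add: tensor_eq induced_smult scale_single)
    then show ?case using assms(2) a single by simp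
  next
    case (add p q)
    then show ?case using assms(3)[of "coset p" "coset q"] by (simp add: carrier_induced induced_add)
  qed
  then show ?thesis using p by simp
qed

lemma induced_hom_eqI:
  assumes f: "f \<in> linear_maps (induced L P V) M"
    and g: "g \<in> linear_maps (induced L P V) M"
    and fg: "\<And>a v. a \<in> free_elems L \<Longrightarrow> v \<in> carrier V \<Longrightarrow> f (tens a v) = g (tens a v)"
    and x: "x \<in> carrier (induced L P V)"
  shows "f x = g x"
  using x
  by (induction x rule: induced_induct)
     (simp_all add: fg linear_map_add[OF f] linear_map_add[OF g])

text \<open>
  Each law need only be verified on pure tensors, where it is a defining relation of \<open>U(L)\<close> multiplied
  from the right by the first factor.
\<close>

lemma lie_rep_induced: "lie_rep L (induced L P V)"
proof -
  let ?M = "induced L P V"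
  interpret M: CC_module ?M by (simp add: CC_module_def module_induced)
  have cl: "act ?M X x \<in> carrier ?M" if "X \<in> L" "x \<in> carrier ?M" for X x
    using that by (auto simp: carrier_induced induced_act formal_lmult)
  have hadd: "act ?M X (x \<oplus>\<^bsub>?M\<^esub> y) = act ?M X x \<oplus>\<^bsub>?M\<^esub> act ?M X y"
    if "X \<in> L" "x \<in> carrier ?M" "y \<in> carrier ?M" for X x y
    using that by (auto simp: carrier_induced induced_act induced_add pairs_lmult_add)
  have smult: "act ?M X (c \<odot>\<^bsub>?M\<^esub> x) = c \<odot>\<^bsub>?M\<^esub> act ?M X x"
    if "X \<in> L" "x \<in> carrier ?M" for X x c
    using that by (auto simp: carrier_induced induced_act induced_smult pairs_lmult_scale)
  have rel: "tens (r * a) v = tens (s * a) v"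
    if "r - s \<in> env_rels L" "a \<in> free_elems L" for r s a v
  proof (rule tens_eqI)
    show "r * a - s * a \<in> env_ideal L"
      using L.env_ideal_rmult[OF subsetD[OF L.env_rels_in_ideal that(1)] that(2)]
      by (simp add: left_diff_distrib)
  qed
  have madd: "act ?M (X + Y) x = act ?M X x \<oplus>\<^bsub>?M\<^esub> act ?M Y x"
    if X: "X \<in> L" "Y \<in> L" and "x \<in> carrier ?M" for X Y x
    using that(3)
  proof (induction x rule: induced_induct)
    case (tens a v)
    have "letter (X + Y) - (letter X + letter Y) \<in> env_rels L"
      unfolding env_rels_def using X by (auto simp: diff_diff_add[symmetric])
    from rel[OF this tens(1)] show ?case
      using X tens by (simp add: act_tens L.L_add distrib_right tens_add_left)
  next
    case (add x y)
    then show ?case using X by (simp add: hadd L.L_add cl M.a_ac)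
  qed
  have msmult: "act ?M (c \<cdot>\<^sub>m X) x = c \<odot>\<^bsub>?M\<^esub> act ?M X x"
    if X: "X \<in> L" and "x \<in> carrier ?M" for c X x
    using that(2)
  proof (induction x rule: induced_induct)
    case (tens a v)
    have "letter (c \<cdot>\<^sub>m X) - scalar c * letter X \<in> env_rels L"
      unfolding env_rels_def using X by blast
    from rel[OF this tens(1)] show ?case
      using X tens by (simp add: act_tens L.L_smult mult.assoc tens_scalar)
  next
    case (add x y)
    then show ?case using X by (simp add: hadd L.L_smult cl M.smult_add_right)
  qed
  have bracket: "act ?M (lie_bracket X Y) x = act ?M X (act ?M Y x) \<ominus>\<^bsub>?M\<^esub> act ?M Y (act ?M X x)"
    if X: "X \<in> L" "Y \<in> L" and "x \<in> carrier ?M" for X Y x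
    using that(3)
  proof (induction x rule: induced_induct)
    case (tens a v)
    have "letter (lie_bracket X Y) - (letter X * letter Y - letter Y * letter X) \<in> env_rels L"
      unfolding env_rels_def using X by blast
    from rel[OF this tens(1)]
    have "act ?M (lie_bracket X Y) (tens a v) =
        tens (letter X * (letter Y * a) + scalar (-1) * (letter Y * (letter X * a))) v"
      using X tens by (simp add: act_tens L.L_bracket left_diff_distrib mult.assoc scalar_minus_one)
    also have "\<dots> = act ?M X (act ?M Y (tens a v)) \<oplus>\<^bsub>?M\<^esub> (-1) \<odot>\<^bsub>?M\<^esub> act ?M Y (act ?M X (tens a v))"
      using X tens by (simp add: tens_add_left tens_scalar act_tens)
    also have "\<dots> = act ?M X (act ?M Y (tens a v)) \<ominus>\<^bsub>?M\<^esub> act ?M Y (act ?M X (tens a v))"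
      using X tens by (simp add: M.smult_minus1 cl a_minus_def)
    finally show ?case .
  next
    case (add x y)
    then show ?case
      using X by (simp add: hadd L.L_bracket cl M.a_ac M.minus_add a_minus_def)
  qed
  show ?thesis
    unfolding lie_rep_def
    using module_induced cl hadd smult madd msmult bracket
    by (auto intro: vectorspace_CCI simp: linear_maps_def)
qed

end

sublocale induced_rep \<subseteq> M: lie_representation L "induced L P V"
  by unfold_locales (rule lie_rep_induced)

section \<open>Frobenius reciprocity\<close>

context induced_rep
begin

lemma free_act_tens:
  assumes "a \<in> free_elems L" "b \<in> free_elems L" "v \<in> carrier V"
  shows "free_act (induced L P V) a (tens b v) = tens (a * b) v"
  using assms(1)
proof (induction a rule: free_elems_induct)
  case zero
  then show ?case using assms by (simp add: M.free_act_zero tens_zero)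
next
  case (single xs c)
  have xs: "foldr (act (induced L P V)) xs (tens b v) = tens (single xs 1 * b) v"
    using single
  proof (induction xs)
    case Nil
    then show ?case by (simp flip: one_eq_single_Nil)
  next
    case (Cons X xs)
    then have "single xs 1 \<in> free_elems L" by (simp add: free_elems_def)
    then show ?case
      using Cons assms by (simp add: act_tens letter_def single_mult_list flip: mult.assoc)
  qed
  have xs1: "single xs 1 \<in> free_elems L" using single by (simp add: free_elems_def)
  have "free_act (induced L P V) (single xs c) (tens b v)
      = c \<odot>\<^bsub>induced L P V\<^esub> tens (single xs 1 * b) v"
    using single assms xs by (simp add: M.free_act_single)
  also have "\<dots> = tens (scalar c * (single xs 1 * b)) v"
    using xs1 assms by (simp add: tens_scalar)
  also have "scalar c * (single xs 1 * b) = single xs c * b"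
    by (simp add: scalar_def single_mult_list flip: mult.assoc)
  finally show ?case .
next
  case (add a a')
  then show ?case using assms by (simp add: M.free_act_add distrib_right tens_add_left)
qed

text \<open>
  The extension is \<open>a \<otimes> v \<mapsto> a (g v)\<close>. Extend \<open>(u, v) \<mapsto> u (g v)\<close> linearly to formal sums of pairs. The
  result kills the balancing relations because \<open>g\<close> intertwines the action of \<open>P\<close>, hence that of \<open>U(P)\<close>; the
  other relations express that the action on \<open>W\<close> and the map \<open>g\<close> are linear.
\<close>

lemma frobenius_reciprocity:
  fixes W :: "'w rep"
  assumes W: "lie_representation L W"
    and g: "g \<in> linear_maps V W"
    and equiv: "\<And>X v. X \<in> P \<Longrightarrow> v \<in> carrier V \<Longrightarrow> g (act V X v) = act W X (g v)"
  obtains F where "F \<in> rep_hom L (induced L P V) W" "F \<in> extensional (carrier (induced L P V))"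
    "\<And>a v. a \<in> free_elems L \<Longrightarrow> v \<in> carrier V \<Longrightarrow> F (tens a v) = free_act W a (g v)"
proof -
  interpret W: lie_representation L W by (rule W)
  interpret U: Ring.ring "env_alg L" by (rule L.ring_env_alg)
  have g_closed: "g v \<in> carrier W" if "v \<in> carrier V" for v
    using linear_map_closed[OF g] that by auto
  have g_add: "g (v \<oplus> w) = g v \<oplus>\<^bsub>W\<^esub> g w" if "v \<in> carrier V" "w \<in> carrier V" for v w
    using linear_map_add[OF g] that by auto
  have g_smult: "g (c \<odot> v) = c \<odot>\<^bsub>W\<^esub> g v" if "v \<in> carrier V" for v c
    using linear_map_smult[OF g, of c] that by simp
  have g_zero: "g \<zero> = \<zero>\<^bsub>W\<^esub>"
    using g_smult[OF zero_closed, of 0] g_closed[OF zero_closed] by simp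
  have g_free_act: "g (free_act V b v) = free_act W b (g v)"
    if b: "b \<in> free_elems P" and v: "v \<in> carrier V" for b v
    using b
  proof (induction b rule: free_elems_induct)
    case (single xs c)
    have PL: "set xs \<subseteq> L" using single P_subset by simp
    have "g (foldr (act V) xs v) = foldr (act W) xs (g v)"
      using single by (induction xs) (simp_all add: equiv word_closed v)
    then show ?case
      using single PL v by (simp add: free_act_single W.free_act_single g_smult g_closed word_closed)
  next
    case (add a b)
    then show ?case
      using v free_elems_mono[OF P_subset]
      by (simp add: free_act_add W.free_act_add g_add g_closed)
  qed (simp add: free_act_zero W.free_act_zero g_zero)
  \<comment> \<open>The extension is built on formal sums of pairs first and passes to cosets as \<open>G\<close>.\<close>
  define h where "h = (\<lambda>(u, v). env_act W u (g v))"
  have h: "h (env_class L a, v) = free_act W a (g v)" if "a \<in> free_elems L" "v \<in> carrier V" for a v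
    using that by (simp add: h_def W.env_act_class g_closed)
  have h_Pi: "h \<in> carrier (env_alg L) \<times> carrier V \<rightarrow> carrier W"
    by (auto simp: h g_closed elim!: L.env_algE)
  define F where "F = lin_ext W h"
  have F_add: "F (p + q) = F p \<oplus>\<^bsub>W\<^esub> F q" if "p \<in> formal" "q \<in> formal" for p q
    using that unfolding F_def formal_def by (intro W.lin_ext_add[OF _ _ h_Pi]) auto
  have F_scale: "F (scale c p) = c \<odot>\<^bsub>W\<^esub> F p" if "p \<in> formal" for c p
    using that unfolding F_def formal_def by (intro W.lin_ext_scale[OF _ h_Pi]) auto
  have F_closed: "F p \<in> carrier W" if "p \<in> formal" for p
    using that unfolding F_def formal_def by (intro W.lin_ext_closed[OF _ h_Pi]) auto
  have F_diff: "F (p - q) = F p \<ominus>\<^bsub>W\<^esub> F q" if "p \<in> formal" "q \<in> formal" for p q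
    using F_add[OF formal_diff[OF that] that(2)] that F_closed
    by (simp add: a_minus_def W.a_assoc W.r_neg)
  have F_single: "F (single (env_class L a, v) c) = c \<odot>\<^bsub>W\<^esub> free_act W a (g v)"
    if "a \<in> free_elems L" "v \<in> carrier V" for a v c
    using that unfolding F_def by (subst W.lin_ext_single) (simp_all add: h g_closed)
  have F_zero: "F 0 = \<zero>\<^bsub>W\<^esub>"
    by (simp add: F_def W.lin_ext_zero)
  have cancel: "(x \<oplus>\<^bsub>W\<^esub> y) \<ominus>\<^bsub>W\<^esub> x \<ominus>\<^bsub>W\<^esub> y = \<zero>\<^bsub>W\<^esub>" if "x \<in> carrier W" "y \<in> carrier W" for x y
    using that by (simp add: a_minus_def W.a_ac W.r_neg W.r_neg2 W.a_lcomm[of y "\<ominus>\<^bsub>W\<^esub> x" "\<ominus>\<^bsub>W\<^esub> y"])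
  have null: "F p = \<zero>\<^bsub>W\<^esub>" if "p \<in> tensor_null L P V" for p
  proof -
    have "F r = \<zero>\<^bsub>W\<^esub>" if "r \<in> tensor_rels L P V" for r
      using that[unfolded tensor_rels_def]
    proof (elim UnE CollectE exE conjE)
      fix u u' v
      assume r: "r = pair (u \<oplus>\<^bsub>env_alg L\<^esub> u') v - pair u v - pair u' v"
        "u \<in> carrier (env_alg L)" "u' \<in> carrier (env_alg L)" "v \<in> carrier V"
      obtain a a' where a: "a \<in> free_elems L" "u = env_class L a" "a' \<in> free_elems L" "u' = env_class L a'"
        using r L.env_algE by metis
      then show ?thesis
        using r by (simp add: F_diff F_single W.free_act_add g_closed cancel flip: L.env_class_add)
    next
      fix u v v'
      assume r: "r = pair u (v \<oplus> v') - pair u v - pair u v'"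
        "u \<in> carrier (env_alg L)" "v \<in> carrier V" "v' \<in> carrier V"
      obtain a where a: "a \<in> free_elems L" "u = env_class L a"
        using r L.env_algE by metis
      then show ?thesis
        using r by (simp add: F_diff F_single g_add W.free_act_vec_add g_closed cancel)
    next
      fix c u v
      assume r: "r = pair (env_class L (scalar c) \<otimes>\<^bsub>env_alg L\<^esub> u) v - c \<odot>\<^bsub>pairs L V\<^esub> pair u v"
        "u \<in> carrier (env_alg L)" "v \<in> carrier V"
      obtain a where a: "a \<in> free_elems L" "u = env_class L a"
        using r L.env_algE by metis
      then show ?thesis
        using r by (simp add: F_diff F_single pairs_simps F_scale W.free_act_mult W.free_act_scalar g_closed
            a_minus_def W.r_neg flip: L.env_class_mult)
    next
      fix u x v
      assume r: "r = pair (u \<otimes>\<^bsub>env_alg L\<^esub> env_map P L x) v - pair u (env_act V x v)"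
        "u \<in> carrier (env_alg L)" "x \<in> carrier (env_alg P)" "v \<in> carrier V"
      obtain a where a: "a \<in> free_elems L" "u = env_class L a"
        using r L.env_algE by metis
      obtain b where b: "b \<in> free_elems P" "x = env_class P b"
        using r env_algE by metis
      have "b \<in> free_elems L" using b free_elems_mono[OF P_subset] by blast
      then show ?thesis
        using r a b
        by (simp add: F_diff F_single L.env_map_class[OF matrix_lie_algebra_axioms P_subset] env_act_class
            W.free_act_mult g_closed g_free_act a_minus_def W.r_neg flip: L.env_class_mult)
    qed
    then have "tensor_null L P V \<subseteq> {p \<in> formal. F p = \<zero>\<^bsub>W\<^esub>}"
      using tensor_rels_subset
      by (intro null_least) (auto simp: F_zero F_add F_scale)
    then show ?thesis using that by blast
  qed
  define G where "G = restrict (\<lambda>x. the_elem (F ` x)) (carrier (induced L P V))"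
  have G_coset: "G (coset p) = F p" if "p \<in> formal" for p
  proof -
    have "F q = F p" if q: "q \<in> coset p" for q
    proof -
      obtain j where j: "q = j + p" "j \<in> tensor_null L P V"
        using q unfolding coset_def by blast
      show ?thesis
        unfolding j(1) F_add[OF null_subset[OF j(2)] \<open>p \<in> formal\<close>] null[OF j(2)]
        by (simp add: F_closed \<open>p \<in> formal\<close>)
    qed
    then have "F ` coset p = {F p}" using coset_self[of p] by blast
    moreover have "coset p \<in> carrier (induced L P V)" using that by (simp add: carrier_induced)
    ultimately show ?thesis by (simp add: G_def)
  qed
  have G_tens: "G (tens a v) = free_act W a (g v)" if "a \<in> free_elems L" "v \<in> carrier V" for a v
    using that by (simp add: tensor_eq G_coset F_single g_closed)
  have G_hom: "G \<in> linear_maps (induced L P V) W"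
    by (auto simp: linear_maps_def carrier_induced G_coset induced_add induced_smult
        F_add F_scale F_closed)
  have "G (act (induced L P V) X x) = act W X (G x)" if X: "X \<in> L" and "x \<in> carrier (induced L P V)" for X x
    using that(2)
  proof (induction x rule: induced_induct)
    case (tens a v)
    then show ?case
      using X by (simp add: act_tens G_tens W.free_act_mult W.free_act_letter g_closed)
  next
    case (add x y)
    have "G x \<in> carrier W" "G y \<in> carrier W"
      using add linear_map_closed[OF G_hom] by auto
    with add X show ?case
      by (simp add: M.act_add W.act_add linear_map_add[OF G_hom])
  qed
  then have "G \<in> rep_hom L (induced L P V) W"
    using G_hom by (simp add: rep_hom_def)
  moreover have "G \<in> extensional (carrier (induced L P V))"
    by (simp add: G_def)
  ultimately show thesis using G_tens that by blast
qed

end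

section \<open>Subalgebras of the special linear Lie algebra\<close>

lemma lie_bracket_carrier: "X \<in> carrier_mat n n \<Longrightarrow> Y \<in> carrier_mat n n \<Longrightarrow> lie_bracket X Y \<in> carrier_mat n n"
  by (auto simp: lie_bracket_def)

lemma mat_mult_index:
  fixes X Y :: "complex mat"
  shows "X \<in> carrier_mat n n \<Longrightarrow> Y \<in> carrier_mat n n \<Longrightarrow> i < n \<Longrightarrow> j < n \<Longrightarrow>
    (X * Y) $$ (i, j) = (\<Sum>l<n. X $$ (i, l) * Y $$ (l, j))"
  by (simp add: scalar_prod_def lessThan_atLeast0)

lemma lie_bracket_index:
  "X \<in> carrier_mat n n \<Longrightarrow> Y \<in> carrier_mat n n \<Longrightarrow> i < n \<Longrightarrow> j < n \<Longrightarrow>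
    lie_bracket X Y $$ (i, j) = (\<Sum>l<n. X $$ (i, l) * Y $$ (l, j)) - (\<Sum>l<n. Y $$ (i, l) * X $$ (l, j))"
  by (simp add: lie_bracket_def mat_mult_index[symmetric])

lemma sl_carrier: "X \<in> sl n \<Longrightarrow> X \<in> carrier_mat n n"
  by (simp add: sl_def)

lemma sl_trace: "X \<in> sl n \<Longrightarrow> (\<Sum>i<n. X $$ (i, i)) = 0"
  by (simp add: sl_def)

lemma sl_add: "X \<in> sl n \<Longrightarrow> Y \<in> sl n \<Longrightarrow> X + Y \<in> sl n"
  by (auto simp: sl_def sum.distrib)

lemma sl_smult: "X \<in> sl n \<Longrightarrow> c \<cdot>\<^sub>m X \<in> sl n"
  by (auto simp: sl_def simp flip: sum_distrib_left)

lemma lie_bracket_sl: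
  assumes "X \<in> carrier_mat n n" "Y \<in> carrier_mat n n"
  shows "lie_bracket X Y \<in> sl n"
proof -
  have "(\<Sum>i<n. \<Sum>l<n. Y $$ (i, l) * X $$ (l, i)) = (\<Sum>i<n. \<Sum>l<n. X $$ (i, l) * Y $$ (l, i))"
    by (subst sum.swap) (simp add: mult.commute)
  then show ?thesis
    using assms by (simp add: sl_def lie_bracket_carrier lie_bracket_index sum_subtractf)
qed

lemma matrix_lie_algebra_sl: "matrix_lie_algebra (sl n)"
  by unfold_locales (auto simp: sl_add sl_smult lie_bracket_sl sl_carrier)

lemma mat_unit_index: "i < n \<Longrightarrow> j < n \<Longrightarrow> mat_unit n a b $$ (i, j) = (if i = a \<and> j = b then 1 else 0)"
  by (simp add: mat_unit_def)

lemma mat_unit_carrier [simp]: "mat_unit n i j \<in> carrier_mat n n"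
  by (simp add: mat_unit_def)

lemma mat_unit_sl: "i \<noteq> j \<Longrightarrow> mat_unit n i j \<in> sl n"
  by (auto simp: sl_def mat_unit_index intro!: sum.neutral)

lemma borel_D: "X \<in> borel n \<Longrightarrow> j < i \<Longrightarrow> i < n \<Longrightarrow> X $$ (i, j) = 0"
  by (auto simp: borel_def sl_def)

lemma borelI: "X \<in> sl n \<Longrightarrow> (\<And>i j. j < i \<Longrightarrow> i < n \<Longrightarrow> X $$ (i, j) = 0) \<Longrightarrow> X \<in> borel n"
  by (auto simp: borel_def sl_def)

lemma borel_sl: "X \<in> borel n \<Longrightarrow> X \<in> sl n"
  by (simp add: borel_def)

text \<open>
  For upper triangular matrices and \<open>j \<le> i\<close>, the product of the entries \<open>(i, l)\<close> and \<open>(l, j)\<close> can only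
  be nonzero if \<open>i \<le> l \<le> j\<close>.
\<close>

lemma borel_mult_index:
  assumes "X \<in> borel n" "Y \<in> borel n" "j \<le> i" "i < n"
  shows "(\<Sum>l<n. X $$ (i, l) * Y $$ (l, j)) = (if i = j then X $$ (i, i) * Y $$ (i, i) else 0)"
proof -
  have "X $$ (i, l) * Y $$ (l, j) = (if l = i then if i = j then X $$ (i, i) * Y $$ (i, i) else 0 else 0)"
    if "l < n" for l
    using that borel_D[OF assms(1), of l i] borel_D[OF assms(2), of j l] assms(3,4)
    by (cases "l < i"; cases "l = i") auto
  then have "(\<Sum>l<n. X $$ (i, l) * Y $$ (l, j)) =
      (\<Sum>l<n. if l = i then if i = j then X $$ (i, i) * Y $$ (i, i) else 0 else 0)"
    by (intro sum.cong) auto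
  then show ?thesis using assms(4) by simp
qed

lemma borel_bracket_index:
  assumes "X \<in> borel n" "Y \<in> borel n" "j \<le> i" "i < n"
  shows "lie_bracket X Y $$ (i, j) = 0"
  using assms by (simp add: lie_bracket_index[of _ n] borel_mult_index sl_carrier borel_sl)

lemma matrix_lie_algebra_borel: "matrix_lie_algebra (borel n)"
proof
  fix X Y c assume X: "X \<in> borel n"
  note Xc = sl_carrier[OF borel_sl[OF X]]
  show "c \<cdot>\<^sub>m X \<in> borel n"
    using X Xc by (intro borelI) (auto simp: borel_sl sl_smult borel_D)
  assume Y: "Y \<in> borel n"
  note Yc = sl_carrier[OF borel_sl[OF Y]]
  show "X + Y \<in> borel n"
    using X Y Xc Yc by (intro borelI) (auto simp: borel_sl sl_add borel_D)
  show "lie_bracket X Y \<in> borel n"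
    using X Y Xc Yc by (intro borelI) (auto simp: lie_bracket_sl borel_bracket_index)
qed

lemma borel_subset_sl: "borel n \<subseteq> sl n"
  by (auto simp: borel_def)

lemma H0_carrier [simp]: "H0 n \<in> carrier_mat n n"
  by (simp add: H0_def mat_diag_def)

lemma H0_dim [simp]: "dim_row (H0 n) = n" "dim_col (H0 n) = n"
  using carrier_matD[OF H0_carrier] by simp_all

lemma H0_index: "i < n \<Longrightarrow> j < n \<Longrightarrow>
    H0 n $$ (i, j) = (if i = j then if i = 0 then of_nat (n - 1) / of_nat (n - 1) else - 1 / of_nat (n - 1) else 0)"
  by (simp add: H0_def mat_diag_def)

lemma levi_ss_part_carrier [simp]:
  "levi_ss_part n X \<in> carrier_mat (n - 1) (n - 1)"
  "levi_ss_part n X \<in> carrier_mat (n - Suc 0) (n - Suc 0)"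
  by (simp_all add: levi_ss_part_def)

lemma levi_ss_part_dim [simp]: "dim_row (levi_ss_part n X) = n - 1" "dim_col (levi_ss_part n X) = n - 1"
  by (simp_all add: levi_ss_part_def)

lemma levi_ss_part_index:
  "X \<in> carrier_mat n n \<Longrightarrow> i < n - 1 \<Longrightarrow> j < n - 1 \<Longrightarrow>
    levi_ss_part n X $$ (i, j) = X $$ (i + 1, j + 1) + (if i = j then X $$ (0, 0) / of_nat (n - 1) else 0)"
  by (simp add: levi_ss_part_def H0_index)

definition levi_embed :: "nat \<Rightarrow> complex mat \<Rightarrow> complex mat" where
  "levi_embed n X = four_block_mat (0\<^sub>m 1 1) (0\<^sub>m 1 (n - 1)) (0\<^sub>m (n - 1) 1) X"

lemma levi_embed_carrier: "X \<in> carrier_mat (n - 1) (n - 1) \<Longrightarrow> n \<ge> 1 \<Longrightarrow> levi_embed n X \<in> carrier_mat n n"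
  unfolding levi_embed_def using four_block_carrier_mat[of "0\<^sub>m 1 1" 1 1 X "n - 1" "n - 1"] by simp

lemma levi_embed_index:
  "X \<in> carrier_mat (n - 1) (n - 1) \<Longrightarrow> i < n \<Longrightarrow> j < n \<Longrightarrow>
    levi_embed n X $$ (i, j) = (if i = 0 \<or> j = 0 then 0 else X $$ (i - 1, j - 1))"
  by (auto simp: levi_embed_def)

lemma levi_ss_eq: "levi_ss n = levi_embed n ` sl (n - 1)"
  by (auto simp: levi_ss_def levi_embed_def)

lemma sum_lessThan_shift: "n \<ge> 1 \<Longrightarrow> (\<Sum>i<n. f i) = f 0 + (\<Sum>i<n - 1. f (Suc i))"
  for f :: "nat \<Rightarrow> 'a::comm_monoid_add"
  using sum.lessThan_Suc_shift[of f "n - 1"] by simp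

text \<open>
  The parabolic subalgebra consists of the block upper triangular matrices of trace 0. Conversely such a
  matrix is the sum of its component along \<^term>\<open>H0 n\<close>, read off from the upper left entry, its component in
  \<^term>\<open>levi_ss n\<close>, given by \<^const>\<open>levi_ss_part\<close>, and the rest of its first row.
\<close>

lemma parabolic_eq:
  assumes n: "n \<ge> 2"
  shows "parabolic n = {X \<in> sl n. \<forall>i. 1 \<le> i \<and> i < n \<longrightarrow> X $$ (i, 0) = 0}" (is "_ = ?R")
proof
  show "parabolic n \<subseteq> ?R"
  proof
    fix A assume "A \<in> parabolic n"
    then obtain X c y where A: "X \<in> sl (n - 1)"
      "A = (levi_embed n X + c \<cdot>\<^sub>m H0 n) + mat n n (\<lambda>(i, j). if i = 0 \<and> j \<noteq> 0 then y j else 0)"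
      by (auto simp: parabolic_def levi_def levi_ss_eq n_plus_def)
    have Xc: "X \<in> carrier_mat (n - 1) (n - 1)" using A sl_carrier by blast
    have idx: "A $$ (i, j) = (if i = 0 \<or> j = 0 then 0 else X $$ (i - 1, j - 1)) + c * H0 n $$ (i, j)
        + (if i = 0 \<and> j \<noteq> 0 then y j else 0)" if "i < n" "j < n" for i j
      using that Xc levi_embed_carrier[OF Xc] n by (simp add: A(2) levi_embed_index)
    have "A \<in> carrier_mat n n" using levi_embed_carrier[OF Xc] n by (simp add: A(2))
    moreover have "(\<Sum>i<n. A $$ (i, i)) = 0"
      using n sl_trace[OF A(1)]
      by (simp add: idx sum_lessThan_shift[of n] H0_index sum.distrib of_nat_diff field_simps)
    moreover have "A $$ (i, 0) = 0" if "1 \<le> i" "i < n" for i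
      using that by (simp add: idx H0_index)
    ultimately show "A \<in> ?R" by (auto simp: sl_def)
  qed
  show "?R \<subseteq> parabolic n"
  proof
    fix A assume A: "A \<in> ?R"
    then have Ac: "A \<in> carrier_mat n n" by (simp add: sl_carrier)
    define X where "X = levi_ss_part n A"
    have Xc: "X \<in> carrier_mat (n - 1) (n - 1)" by (simp add: X_def)
    have tr: "A $$ (0, 0) + (\<Sum>i<n - 1. A $$ (Suc i, Suc i)) = 0"
      using A n sum_lessThan_shift[of n "\<lambda>i. A $$ (i, i)"] by (simp add: sl_trace)
    have "(\<Sum>i<n - 1. X $$ (i, i)) = 0"
      using n tr Ac by (simp add: X_def levi_ss_part_index sum.distrib add.commute)
    then have X: "X \<in> sl (n - 1)" using Xc by (simp add: sl_def)
    define Y where "Y = mat n n (\<lambda>(i, j). if i = 0 \<and> j \<noteq> 0 then A $$ (0, j) else 0)"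
    have "A = (levi_embed n X + A $$ (0, 0) \<cdot>\<^sub>m H0 n) + Y"
    proof (rule eq_matI)
      fix i j assume "i < dim_row ((levi_embed n X + A $$ (0, 0) \<cdot>\<^sub>m H0 n) + Y)"
        "j < dim_col ((levi_embed n X + A $$ (0, 0) \<cdot>\<^sub>m H0 n) + Y)"
      then have ij: "i < n" "j < n" by (auto simp: Y_def)
      show "A $$ (i, j) = ((levi_embed n X + A $$ (0, 0) \<cdot>\<^sub>m H0 n) + Y) $$ (i, j)"
        using ij n levi_embed_carrier[OF Xc] Xc Ac A
        by (cases i; cases j) (auto simp: Y_def levi_embed_index H0_index X_def levi_ss_part_index)
    qed (use Ac levi_embed_carrier[OF Xc] n in \<open>auto simp: Y_def\<close>)
    moreover have "Y \<in> n_plus n"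
      by (auto simp: n_plus_def Y_def)
    ultimately show "A \<in> parabolic n"
      using X unfolding parabolic_def levi_def levi_ss_eq by blast
  qed
qed

lemma parabolic_sl: "n \<ge> 2 \<Longrightarrow> X \<in> parabolic n \<Longrightarrow> X \<in> sl n"
  by (simp add: parabolic_eq)

lemma parabolic_D: "n \<ge> 2 \<Longrightarrow> X \<in> parabolic n \<Longrightarrow> 1 \<le> i \<Longrightarrow> i < n \<Longrightarrow> X $$ (i, 0) = 0"
  by (simp add: parabolic_eq)

lemma parabolic_carrier: "n \<ge> 2 \<Longrightarrow> X \<in> parabolic n \<Longrightarrow> X \<in> carrier_mat n n"
  by (simp add: parabolic_sl sl_carrier)

lemma borel_subset_parabolic: "n \<ge> 2 \<Longrightarrow> borel n \<subseteq> parabolic n"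
  by (auto simp: parabolic_eq borel_sl borel_D)

lemma parabolic_bracket_0:
  assumes "n \<ge> 2" "X \<in> parabolic n" "Y \<in> parabolic n" "i < n"
  shows "lie_bracket X Y $$ (i, 0) = 0"
  using assms parabolic_carrier[OF assms(1,2)] parabolic_carrier[OF assms(1,3)]
    parabolic_D[OF assms(1,2)] parabolic_D[OF assms(1,3)]
  by (cases "i = 0") (simp_all add: lie_bracket_index sum_lessThan_shift[of n])

lemma matrix_lie_algebra_parabolic:
  assumes n: "n \<ge> 2"
  shows "matrix_lie_algebra (parabolic n)"
proof
  fix X Y c assume X: "X \<in> parabolic n"
  note Xc = parabolic_carrier[OF n X]
  show "c \<cdot>\<^sub>m X \<in> parabolic n"
    using Xc sl_smult[OF parabolic_sl[OF n X]] parabolic_D[OF n X] by (simp add: parabolic_eq[OF n])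
  assume Y: "Y \<in> parabolic n"
  note Yc = parabolic_carrier[OF n Y]
  show "X + Y \<in> parabolic n"
    using Xc Yc sl_add[OF parabolic_sl[OF n X] parabolic_sl[OF n Y]] parabolic_D[OF n X] parabolic_D[OF n Y]
    by (simp add: parabolic_eq[OF n])
  show "lie_bracket X Y \<in> parabolic n"
    using lie_bracket_sl[OF Xc Yc] parabolic_bracket_0[OF n X Y] by (simp add: parabolic_eq[OF n])
qed

lemma parabolic_subset_sl: "n \<ge> 2 \<Longrightarrow> parabolic n \<subseteq> sl n"
  using parabolic_sl by blast

lemma levi_subset_parabolic: "levi n \<subseteq> parabolic n"
proof
  fix Z assume Z: "Z \<in> levi n"
  have "0\<^sub>m n n = mat n n (\<lambda>(i, j). if i = 0 \<and> j \<noteq> 0 then (0 :: complex) else 0)"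
    by (intro eq_matI) auto
  then have "0\<^sub>m n n \<in> n_plus n" unfolding n_plus_def by (intro CollectI exI[of _ "\<lambda>_. 0"]) simp
  moreover have "Z \<in> carrier_mat n n"
    using Z H0_carrier[of n] unfolding levi_def by auto
  then have "Z = Z + 0\<^sub>m n n" by simp
  ultimately show "Z \<in> parabolic n"
    using Z unfolding parabolic_def by blast
qed

lemma levi_embed_levi:
  assumes "X \<in> sl (n - 1)" "n \<ge> 2"
  shows "levi_embed n X \<in> levi n"
proof -
  have "levi_embed n X = levi_embed n X + 0 \<cdot>\<^sub>m H0 n"
    using levi_embed_carrier[OF sl_carrier[OF assms(1)]] assms(2) by (intro eq_matI) auto
  then show ?thesis unfolding levi_def levi_ss_eq using assms(1) by blast
qed

lemma levi_ss_part_sl: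
  assumes "n \<ge> 2" "X \<in> parabolic n"
  shows "levi_ss_part n X \<in> sl (n - 1)"
proof -
  have "X $$ (0, 0) + (\<Sum>i<n - 1. X $$ (Suc i, Suc i)) = 0"
    using assms sum_lessThan_shift[of n "\<lambda>i. X $$ (i, i)"] by (simp add: sl_trace parabolic_sl)
  then show ?thesis
    using assms parabolic_carrier[OF assms]
    by (simp add: sl_def levi_ss_part_index sum.distrib add.commute)
qed

lemma levi_ss_part_add:
  "X \<in> carrier_mat n n \<Longrightarrow> Y \<in> carrier_mat n n \<Longrightarrow> n \<ge> 2 \<Longrightarrow>
    levi_ss_part n (X + Y) = levi_ss_part n X + levi_ss_part n Y"
  by (intro eq_matI)
     (auto simp: levi_ss_part_index add_divide_distrib)

lemma levi_ss_part_smult: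
  "X \<in> carrier_mat n n \<Longrightarrow> n \<ge> 2 \<Longrightarrow> levi_ss_part n (c \<cdot>\<^sub>m X) = c \<cdot>\<^sub>m levi_ss_part n X"
  by (intro eq_matI)
     (auto simp: levi_ss_part_index distrib_left)

text \<open>
  Up to a multiple of the identity, which is central, \<^const>\<open>levi_ss_part\<close> is the lower right block, and
  passing to this block is multiplicative on block upper triangular matrices.
\<close>

lemma levi_ss_part_bracket:
  assumes n: "n \<ge> 2" and X: "X \<in> parabolic n" and Y: "Y \<in> parabolic n"
  shows "levi_ss_part n (lie_bracket X Y) = lie_bracket (levi_ss_part n X) (levi_ss_part n Y)"
proof (rule eq_matI)
  note Xc = parabolic_carrier[OF n X] and Yc = parabolic_carrier[OF n Y]
  have dim: "lie_bracket (levi_ss_part n X) (levi_ss_part n Y) \<in> carrier_mat (n - 1) (n - 1)"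
    by (rule lie_bracket_carrier) simp_all
  then show "dim_row (levi_ss_part n (lie_bracket X Y)) = dim_row (lie_bracket (levi_ss_part n X) (levi_ss_part n Y))"
    "dim_col (levi_ss_part n (lie_bracket X Y)) = dim_col (lie_bracket (levi_ss_part n X) (levi_ss_part n Y))"
    by (auto simp only: carrier_matD levi_ss_part_dim)
  fix i j assume "i < dim_row (lie_bracket (levi_ss_part n X) (levi_ss_part n Y))"
    "j < dim_col (lie_bracket (levi_ss_part n X) (levi_ss_part n Y))"
  with dim have ij: "i < n - 1" "j < n - 1" by auto
  \<comment> \<open>The correction terms are symmetric in \<open>A\<close> and \<open>B\<close> and therefore cancel in the bracket.\<close>
  have prod: "(\<Sum>l<n - 1. levi_ss_part n A $$ (i, l) * levi_ss_part n B $$ (l, j)) =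
      (\<Sum>l<n - 1. A $$ (Suc i, Suc l) * B $$ (Suc l, Suc j))
      + A $$ (0, 0) / of_nat (n - 1) * B $$ (Suc i, Suc j)
      + A $$ (Suc i, Suc j) * (B $$ (0, 0) / of_nat (n - 1))
      + (if i = j then A $$ (0, 0) / of_nat (n - 1) * (B $$ (0, 0) / of_nat (n - 1)) else 0)"
    if "A \<in> carrier_mat n n" "B \<in> carrier_mat n n" for A B
  proof -
    have "(\<Sum>l<n - 1. levi_ss_part n A $$ (i, l) * levi_ss_part n B $$ (l, j)) =
      (\<Sum>l<n - 1. A $$ (Suc i, Suc l) * B $$ (Suc l, Suc j)
        + (if l = i then A $$ (0, 0) / of_nat (n - 1) * B $$ (Suc i, Suc j) else 0)
        + (if l = j then A $$ (Suc i, Suc j) * (B $$ (0, 0) / of_nat (n - 1)) else 0)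
        + (if l = i then if i = j then A $$ (0, 0) / of_nat (n - 1) * (B $$ (0, 0) / of_nat (n - 1)) else 0 else 0))"
      using that ij by (intro sum.cong) (auto simp: levi_ss_part_index algebra_simps)
    also have "\<dots> = (\<Sum>l<n - 1. A $$ (Suc i, Suc l) * B $$ (Suc l, Suc j))
      + A $$ (0, 0) / of_nat (n - 1) * B $$ (Suc i, Suc j)
      + A $$ (Suc i, Suc j) * (B $$ (0, 0) / of_nat (n - 1))
      + (if i = j then A $$ (0, 0) / of_nat (n - 1) * (B $$ (0, 0) / of_nat (n - 1)) else 0)"
      using ij unfolding sum.distrib by (simp add: sum.delta)
    finally show ?thesis .
  qed
  have X0: "X $$ (Suc i, 0) = 0" and Y0: "Y $$ (Suc i, 0) = 0"
    using parabolic_D[OF n X, of "Suc i"] parabolic_D[OF n Y, of "Suc i"] ij by simp_all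
  have "levi_ss_part n (lie_bracket X Y) $$ (i, j) = lie_bracket X Y $$ (Suc i, Suc j)"
    using ij n parabolic_bracket_0[OF n X Y, of 0] lie_bracket_carrier[OF Xc Yc]
    by (simp add: levi_ss_part_index)
  also have "\<dots> = (\<Sum>l<n - 1. X $$ (Suc i, Suc l) * Y $$ (Suc l, Suc j))
      - (\<Sum>l<n - 1. Y $$ (Suc i, Suc l) * X $$ (Suc l, Suc j))"
    using ij n X0 Y0 Xc Yc by (simp add: lie_bracket_index sum_lessThan_shift[of n])
  also have "\<dots> = lie_bracket (levi_ss_part n X) (levi_ss_part n Y) $$ (i, j)"
    unfolding lie_bracket_index[OF levi_ss_part_carrier(1) levi_ss_part_carrier(1) ij]
      prod[OF Xc Yc] prod[OF Yc Xc]
    by (simp add: algebra_simps)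
  finally show "levi_ss_part n (lie_bracket X Y) $$ (i, j)
      = lie_bracket (levi_ss_part n X) (levi_ss_part n Y) $$ (i, j)" .
qed

lemma levi_ss_part_embed:
  assumes "X \<in> carrier_mat (n - 1) (n - 1)" "n \<ge> 2"
  shows "levi_ss_part n (levi_embed n X) = X" "levi_embed n X $$ (0, 0) = 0"
  using assms levi_embed_carrier[OF assms(1)]
  by (auto intro!: eq_matI simp: levi_ss_part_index levi_embed_index)

lemma n_plus_D:
  assumes "Y \<in> n_plus n" "n \<ge> 2"
  shows "levi_ss_part n Y = 0\<^sub>m (n - 1) (n - 1)" "Y $$ (0, 0) = 0"
  using assms
  by (auto intro!: eq_matI simp: n_plus_def levi_ss_part_index)

section \<open>Representations of the parabolic subalgebra\<close>

lemma lie_rep_subset: "lie_rep L V \<Longrightarrow> K \<subseteq> L \<Longrightarrow> lie_rep K V"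
  unfolding lie_rep_def by (blast dest: subsetD)

lemma vectorspace_act_update:
  "vectorspace CC (sigma\<lparr>act := f\<rparr>) \<longleftrightarrow> vectorspace CC (sigma :: 'v rep)"
proof -
  have "Module.module CC (sigma\<lparr>act := f\<rparr>) \<longleftrightarrow> Module.module CC sigma"
    by (simp add: Module.module_def module_axioms_def abelian_group_def abelian_monoid_def
        abelian_group_axioms_def)
  then show ?thesis by (simp add: vectorspace_def)
qed

lemma span_act_update:
  "LinearCombinations.module.span CC (sigma\<lparr>act := f\<rparr>) = LinearCombinations.module.span CC (sigma :: 'v rep)"
  if "vectorspace CC sigma"
proof -
  have m: "Module.module CC sigma" "Module.module CC (sigma\<lparr>act := f\<rparr>)"
    using that vectorspace_act_update[of f sigma] by (simp_all add: vectorspace_def)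
  show ?thesis
    by (intro ext) (simp add: LinearCombinations.module.span_def[OF m(1)] LinearCombinations.module.span_def[OF m(2)]
        LinearCombinations.module.lincomb_def[OF m(1)] LinearCombinations.module.lincomb_def[OF m(2)] finsum_def)
qed

lemma fin_dim_act_update:
  assumes "vectorspace CC (sigma :: 'v rep)" "vectorspace.fin_dim CC sigma"
  shows "vectorspace.fin_dim CC (sigma\<lparr>act := f\<rparr>)"
  using assms vectorspace_act_update[of f sigma] span_act_update[OF assms(1), of f]
  by (simp add: vectorspace.fin_dim_def)

lemma parabolic_rep_simps [simp]:
  "carrier (parabolic_rep n sigma s) = carrier sigma"
  "zero (parabolic_rep n sigma s) = zero sigma"
  "add (parabolic_rep n sigma s) = add sigma"
  "smult (parabolic_rep n sigma s) = smult sigma"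
  "act (parabolic_rep n sigma s) X v =
     act sigma (levi_ss_part n X) v \<oplus>\<^bsub>sigma\<^esub> (s * X $$ (0, 0)) \<odot>\<^bsub>sigma\<^esub> v"
  by (simp_all add: parabolic_rep_def)

lemma parabolic_rep_a_minus [simp]:
  "a_minus (parabolic_rep n sigma s) = a_minus (sigma :: 'v rep)"
  by (intro ext) (simp add: a_minus_def a_inv_def m_inv_def)

locale levi_rep = lie_representation "sl (n - 1)" sigma for n and sigma :: "'v rep" (structure) +
  assumes n: "n \<ge> 2"
begin

lemma vectorspace_sigma: "vectorspace CC sigma"
  using lie_rep by (simp add: lie_rep_def)

text \<open>
  The upper left entry vanishes on brackets of block upper triangular matrices, so it is a character of
  the parabolic subalgebra, by which \<open>sigma\<close> may be twisted.
\<close>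

lemma lie_rep_parabolic_rep: "lie_rep (parabolic n) (parabolic_rep n sigma s)"
  unfolding lie_rep_def
proof (intro conjI ballI allI)
  show "vectorspace CC (parabolic_rep n sigma s)"
    using vectorspace_sigma by (simp add: parabolic_rep_def vectorspace_act_update)
  fix X assume X: "X \<in> parabolic n"
  note Xc = parabolic_carrier[OF n X]
  note ss = levi_ss_part_sl[OF n]
  let ?V = "parabolic_rep n sigma s"
  show "act ?V X \<in> linear_maps ?V ?V"
    using ss[OF X]
    by (auto simp: linear_maps_def act_add act_smult smult_add_right a_ac
        simp flip: smult_mult) (simp_all add: mult.commute)
  fix v assume "v \<in> carrier ?V"
  then have v: "v \<in> carrier sigma" by simp
  show "act ?V (c \<cdot>\<^sub>m X) v = c \<odot>\<^bsub>?V\<^esub> act ?V X v" for c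
    using ss[OF X] v Xc n
    by (simp add: levi_ss_part_smult act_mat_smult smult_add_right mult.left_commute flip: smult_mult)
  fix Y assume Y: "Y \<in> parabolic n"
  note Yc = parabolic_carrier[OF n Y]
  show "act ?V (X + Y) v = act ?V X v \<oplus>\<^bsub>?V\<^esub> act ?V Y v"
    using ss[OF X] ss[OF Y] v Xc Yc n
    by (simp add: levi_ss_part_add act_mat_add smult_add_left distrib_left a_ac)
  let ?x = "act sigma (levi_ss_part n X)" and ?y = "act sigma (levi_ss_part n Y)"
  let ?a = "s * X $$ (0, 0)" and ?b = "s * Y $$ (0, 0)"
  have cl: "?x w \<in> carrier sigma" "?y w \<in> carrier sigma" if "w \<in> carrier sigma" for w
    using ss[OF X] ss[OF Y] that by simp_all
  \<comment> \<open>The terms that involve the character are symmetric in \<open>X\<close> and \<open>Y\<close>.\<close>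
  have "act ?V X (act ?V Y v) \<ominus>\<^bsub>?V\<^esub> act ?V Y (act ?V X v)
      = (?x (?y v) \<oplus> (?b \<odot> ?x v \<oplus> ?a \<odot> ?y v \<oplus> (?a * ?b) \<odot> v))
        \<ominus> (?y (?x v) \<oplus> (?b \<odot> ?x v \<oplus> ?a \<odot> ?y v \<oplus> (?a * ?b) \<odot> v))"
    using v cl ss[OF X] ss[OF Y]
    by (simp add: act_add act_smult smult_add_right a_ac mult.commute flip: smult_mult)
  also have "\<dots> = ?x (?y v) \<ominus> ?y (?x v)"
  proof -
    have "(p \<oplus> r) \<ominus> (q \<oplus> r) = p \<ominus> q" if "p \<in> carrier sigma" "q \<in> carrier sigma" "r \<in> carrier sigma" for p q r
      using that by (simp add: a_minus_def minus_add a_ac r_neg1 r_neg2 r_neg a_lcomm[of r])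
    then show ?thesis using v cl by simp
  qed
  also have "\<dots> = act ?V (lie_bracket X Y) v"
    using parabolic_bracket_0[OF n X Y, of 0] n v ss[OF X] ss[OF Y] cl
    by (simp add: levi_ss_part_bracket[OF n X Y] act_bracket)
  finally show "act ?V (lie_bracket X Y) v = act ?V X (act ?V Y v) \<ominus>\<^bsub>?V\<^esub> act ?V Y (act ?V X v)" ..
qed

lemma act_zero_mat: "v \<in> carrier sigma \<Longrightarrow> act sigma (0\<^sub>m (n - 1) (n - 1)) v = \<zero>"
proof -
  have 0: "0\<^sub>m (n - 1) (n - 1) \<in> sl (n - 1)" by (simp add: sl_def)
  moreover have "0 \<cdot>\<^sub>m 0\<^sub>m (n - 1) (n - 1) = (0\<^sub>m (n - 1) (n - 1) :: complex mat)"
    by (intro eq_matI) simp_all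
  ultimately show "v \<in> carrier sigma \<Longrightarrow> ?thesis"
    using act_mat_smult[OF 0, of v 0] act_closed[OF 0] by simp
qed

lemma n_plus_acts_trivially:
  "Y \<in> n_plus n \<Longrightarrow> v \<in> carrier sigma \<Longrightarrow> act (parabolic_rep n sigma s) Y v = \<zero>"
  using n_plus_D[OF _ n, of Y] act_zero_mat[of v] by simp

text \<open>
  The copy of \<open>sl(n - 1)\<close> in the Levi subalgebra acts through \<open>sigma\<close> alone.
\<close>

lemma simple_rep_parabolic_rep:
  assumes "simple_rep (sl (n - 1)) sigma"
  shows "simple_rep (levi n) (parabolic_rep n sigma s)"
  unfolding simple_rep_def
proof (intro conjI allI impI)
  let ?V = "parabolic_rep n sigma s"
  show "lie_rep (levi n) ?V"
    using lie_rep_subset[OF lie_rep_parabolic_rep levi_subset_parabolic] .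
  show "carrier ?V \<noteq> {\<zero>\<^bsub>?V\<^esub>}"
    using assms by (simp add: simple_rep_def)
  fix W assume W: "VectorSpace.subspace CC W ?V \<and> (\<forall>X\<in>levi n. \<forall>w\<in>W. act ?V X w \<in> W)"
  then have sub: "LinearCombinations.submodule CC W ?V" by (simp add: subspace_def)
  have Wc: "W \<subseteq> carrier sigma"
    using LinearCombinations.submodule.subset[OF sub] by simp
  have "VectorSpace.subspace CC W sigma"
    using sub vectorspace_sigma
    by (simp add: subspace_def LinearCombinations.submodule_def vectorspace_def)
  moreover have "act sigma X w \<in> W" if "X \<in> sl (n - 1)" "w \<in> W" for X w
  proof -
    have "act ?V (levi_embed n X) w = act sigma X w"
      using that Wc levi_ss_part_embed[OF sl_carrier[OF that(1)] n] by auto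
    then show ?thesis
      using W that levi_embed_levi[OF that(1) n] by metis
  qed
  ultimately show "W = {\<zero>\<^bsub>?V\<^esub>} \<or> W = carrier ?V"
    using assms by (simp add: simple_rep_def)
qed

lemma is_E_parabolic_rep:
  assumes "simple_rep (sl (n - 1)) sigma" "vectorspace.fin_dim CC sigma"
    and "highest_weight_vector n lam (parabolic_rep n sigma s) v"
  shows "is_E n lam (parabolic_rep n sigma s)"
proof -
  have "vectorspace.fin_dim CC (parabolic_rep n sigma s)"
    using fin_dim_act_update[OF vectorspace_sigma assms(2)] by (simp add: parabolic_rep_def)
  then show ?thesis
    unfolding is_E_def
    using lie_rep_parabolic_rep n_plus_acts_trivially simple_rep_parabolic_rep[OF assms(1)] assms(3)
    by (auto simp del: parabolic_rep_simps(5))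
qed

end

lemma induced_rep_parabolic:
  assumes "n \<ge> 2" "lie_rep (parabolic n) V"
  shows "induced_rep (sl n) (parabolic n) V"
  using assms
  by (intro induced_rep.intro lie_representation.intro lie_representation_axioms.intro
      induced_rep_axioms.intro matrix_lie_algebra_sl matrix_lie_algebra_parabolic parabolic_subset_sl)

lemma levi_repI: "n \<ge> 2 \<Longrightarrow> lie_rep (sl (n - 1)) sigma \<Longrightarrow> levi_rep n sigma"
  by (intro levi_rep.intro lie_representation.intro lie_representation_axioms.intro levi_rep_axioms.intro
      matrix_lie_algebra_sl)

section \<open>Weights as characters of the Borel subalgebra\<close>

lemma weight_eq: "lam \<in> carrier_vec n \<Longrightarrow> weight lam X = (\<Sum>i<n. lam $ i * X $$ (i, i))"
  by (auto simp: weight_def)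

text \<open>
  The bracket of two upper triangular matrices has zero diagonal, so a weight is a character of the
  Borel subalgebra.
\<close>

lemma lie_rep_weight_rep:
  assumes lam: "lam \<in> carrier_vec n"
  shows "lie_rep (borel n) (weight_rep lam)"
proof -
  have mod: "Module.module CC (weight_rep lam)"
    by (rule module_criteria)
       (auto simp: weight_rep_def cring_CC algebra_simps intro: exI[of _ "- _"])
  interpret CC_module "weight_rep lam" by (simp add: CC_module_def mod)
  have minus: "x \<ominus>\<^bsub>weight_rep lam\<^esub> y = x - y" for x y
    using smult_minus1[of y] by (simp add: a_minus_def weight_rep_def)
  have "weight lam (lie_bracket X Y) = 0" if "X \<in> borel n" "Y \<in> borel n" for X Y
    using that by (simp add: weight_eq[OF lam] borel_bracket_index)
  moreover have "weight lam (X + Y) = weight lam X + weight lam Y" if "X \<in> borel n" "Y \<in> borel n" for X Y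
    using sl_carrier[OF borel_sl[OF that(1)]] sl_carrier[OF borel_sl[OF that(2)]]
    by (simp add: weight_eq[OF lam] distrib_left sum.distrib)
  moreover have "weight lam (c \<cdot>\<^sub>m X) = c * weight lam X" if "X \<in> borel n" for c X
    using that sl_carrier[OF borel_sl[OF that]]
    by (auto simp: weight_eq[OF lam] sum_distrib_left algebra_simps intro!: sum.cong)
  ultimately show ?thesis
    unfolding lie_rep_def minus using vectorspace_CCI[OF mod]
    by (simp add: linear_maps_def weight_rep_def algebra_simps)
qed

section \<open>Symmetric powers\<close>

lemma exponents_iff:
  "K \<in> exponents m k \<longleftrightarrow> (\<forall>l\<ge>m. lookup K l = 0) \<and> (\<Sum>i<m. lookup K i) = k"
  by (auto simp: exponents_def subset_iff in_keys_iff not_less[symmetric])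

lemma exponents_lookup_le:
  assumes "K \<in> exponents m k"
  shows "lookup K i \<le> k"
proof (cases "i < m")
  case True
  then show ?thesis
    using assms member_le_sum[of i "{..<m}" "lookup K"] by (auto simp: exponents_iff)
qed (use assms in \<open>auto simp: exponents_iff\<close>)

lemma finite_exponents: "finite (exponents m k)"
proof -
  have "inj_on lookup (exponents m k)"
    by (intro inj_onI poly_mapping_eqI) simp
  moreover have "lookup ` exponents m k \<subseteq>
      {f. \<forall>i. (i \<in> {..<m} \<longrightarrow> f i \<in> {..k}) \<and> (i \<notin> {..<m} \<longrightarrow> f i = 0)}"
    using exponents_lookup_le by (force simp: exponents_iff)
  moreover have "finite {f. \<forall>i. (i \<in> {..<m} \<longrightarrow> f i \<in> {..k}) \<and> (i \<notin> {..<m} \<longrightarrow> f i = (0 :: nat))}"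
    by (rule finite_set_of_finite_funs) simp_all
  ultimately show ?thesis
    using finite_subset finite_imageD by blast
qed

definition unit_exp :: "nat \<Rightarrow> nat \<Rightarrow>\<^sub>0 nat" where
  "unit_exp i = single i 1"

lemma lookup_unit_exp: "lookup (unit_exp i) l = (if i = l then 1 else 0)"
  by (simp add: unit_exp_def lookup_single when_def)

lemma unit_exp_cancel: "lookup K j \<noteq> 0 \<Longrightarrow> unit_exp j + (K - unit_exp j) = K"
  by (intro poly_mapping_eqI) (auto simp: lookup_add lookup_minus lookup_unit_exp)

abbreviation indet :: "nat \<Rightarrow> sym" where
  "indet i \<equiv> single (unit_exp i) 1"

abbreviation const :: "complex \<Rightarrow> sym" where
  "const c \<equiv> single 0 c"

text \<open>
  The effect of \<open>x\<^sub>i \<partial>\<^sub>j\<close> on exponents.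
\<close>

lemma exponents_move:
  assumes "K \<in> exponents m k" "i < m" "lookup K j > 0"
  shows "unit_exp i + (K - unit_exp j) \<in> exponents m k"
proof -
  have j: "j < m" using assms(1,3) by (metis exponents_iff not_less neq0_conv)
  have "(\<Sum>l<m. lookup (unit_exp i + (K - unit_exp j)) l) + 1 =
      (\<Sum>l<m. lookup (unit_exp i) l) + (\<Sum>l<m. lookup (K - unit_exp j) l)
        + (\<Sum>l<m. lookup (unit_exp j) l)"
    using j by (simp add: lookup_add sum.distrib lookup_unit_exp)
  also have "\<dots> = 1 + (\<Sum>l<m. lookup (K - unit_exp j) l + lookup (unit_exp j) l)"
    using assms(2) by (simp add: lookup_unit_exp sum.distrib)
  also have "(\<Sum>l<m. lookup (K - unit_exp j) l + lookup (unit_exp j) l)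
      = (\<Sum>l<m. lookup K l)"
    using assms(3) by (intro sum.cong) (auto simp: lookup_minus lookup_unit_exp)
  finally show ?thesis
    using assms j by (auto simp: exponents_iff lookup_add lookup_minus lookup_unit_exp)
qed

lemma indet_mult_single: "indet i * single K c = single (unit_exp i + K) c"
  by (simp add: mult_single)

lemma const_mult_eq_scale: "const c * p = scale c p"
  by (simp add: mult_map_scale_conv_mult)

lemma single_unit_exp: "single (unit_exp i) c = const c * indet i"
  by (simp add: mult_single)

lemma partial_deriv_add: "partial_deriv j (f + g) = partial_deriv j f + partial_deriv j g"
  unfolding partial_deriv_def by (rule sum_keys_add) (simp_all add: single_add distrib_left)

lemma partial_deriv_zero: "partial_deriv j 0 = 0"
  by (simp add: partial_deriv_def)

lemma partial_deriv_single:
  "partial_deriv j (single K c) = single (K - unit_exp j) (of_nat (lookup K j) * c)"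
  by (simp add: partial_deriv_def unit_exp_def)

lemma sym_induct [case_names zero single add]:
  fixes f :: sym
  assumes "P 0" "\<And>K c. P (single K c)" "\<And>f g. P f \<Longrightarrow> P g \<Longrightarrow> P (f + g)"
  shows "P f"
proof -
  have "keys f \<subseteq> UNIV" by simp
  then show ?thesis by (rule keys_induct) (use assms in simp_all)
qed

lemma partial_deriv_const_mult: "partial_deriv j (const c * f) = const c * partial_deriv j f"
  by (induction f rule: sym_induct)
     (simp_all add: partial_deriv_zero partial_deriv_add partial_deriv_single distrib_left mult_single
       mult.left_commute)

lemma partial_deriv_sum: "partial_deriv j (\<Sum>i\<in>A. f i) = (\<Sum>i\<in>A. partial_deriv j (f i))"
  by (induction A rule: infinite_finite_induct) (simp_all add: partial_deriv_zero partial_deriv_add)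

text \<open>
  In terms of coefficients it is evident that partial derivatives commute.
\<close>

lemma lookup_partial_deriv: "lookup (partial_deriv j f) M =
    of_nat (lookup M j + 1) * lookup f (M + unit_exp j)"
proof (induction f rule: sym_induct)
  case (single K c)
  show ?case
  proof (cases "lookup K j = 0")
    case True
    then have "K \<noteq> M + unit_exp j" by (auto simp: lookup_add lookup_unit_exp)
    with True show ?thesis by (simp add: partial_deriv_single lookup_single)
  next
    case False
    then have K: "K = (K - unit_exp j) + unit_exp j"
      by (metis unit_exp_cancel add.commute)
    show ?thesis
    proof (cases "K = M + unit_exp j")
      case True
      then show ?thesis by (simp add: partial_deriv_single lookup_add lookup_unit_exp)
    next
      case False
      with K have "K - unit_exp j \<noteq> M" by auto
      with False show ?thesis by (simp add: partial_deriv_single lookup_single)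
    qed
  qed
qed (simp_all add: partial_deriv_zero partial_deriv_add lookup_add distrib_left)

lemma partial_deriv_commute: "partial_deriv i (partial_deriv j f) = partial_deriv j (partial_deriv i f)"
  by (intro poly_mapping_eqI)
     (simp add: lookup_partial_deriv lookup_add lookup_unit_exp ac_simps)

lemma partial_deriv_indet_mult:
  "partial_deriv j (indet i * f) = (if i = j then f else 0) + indet i * partial_deriv j f"
proof (induction f rule: sym_induct)
  case (single K c)
  show ?case
  proof (cases "i = j")
    case True
    have K: "lookup K j = 0 \<or> unit_exp j + (K - unit_exp j) = K"
      using unit_exp_cancel by blast
    have "unit_exp j + K - unit_exp j = K" by simp
    then show ?thesis
      using True K
      by (auto simp: indet_mult_single partial_deriv_single lookup_add lookup_unit_exp distrib_right single_add)
  next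
    case False
    then have "unit_exp i + K - unit_exp j = unit_exp i + (K - unit_exp j)"
      by (intro poly_mapping_eqI) (simp add: lookup_add lookup_minus lookup_unit_exp)
    then show ?thesis
      using False by (simp add: indet_mult_single partial_deriv_single lookup_add lookup_unit_exp)
  qed
qed (simp_all add: partial_deriv_zero partial_deriv_add distrib_left)

lemma euler_formula:
  assumes "keys f \<subseteq> exponents m k"
  shows "(\<Sum>i<m. indet i * partial_deriv i f) = const (of_nat k) * f"
  using assms
proof (induction f rule: keys_induct)
  case (single K c)
  have "indet i * partial_deriv i (single K c)
      = single K (of_nat (lookup K i) * c)" for i
  proof (cases "lookup K i = 0")
    case False
    then have "unit_exp i + (K - unit_exp i) = K" by (rule unit_exp_cancel)
    then show ?thesis by (simp add: partial_deriv_single indet_mult_single)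
  qed (simp add: partial_deriv_single)
  moreover have "(\<Sum>i<m. single K (of_nat (lookup K i) * c)) =
      single K (of_nat (\<Sum>i<m. lookup K i) * c)"
    by (induction m) (simp_all add: single_add distrib_right)
  ultimately show ?case
    using single unfolding exponents_iff by (simp add: mult_single del: single_of_nat of_nat_sum)
qed (simp_all add: partial_deriv_zero partial_deriv_add distrib_left sum.distrib)

text \<open>
  The linear vector field \<open>\<Sum> X\<^sub>i\<^sub>j x\<^sub>i \<partial>\<^sub>j\<close>, which is the action of \<open>X\<close> on polynomials of all degrees.
\<close>

definition derivation :: "nat \<Rightarrow> complex mat \<Rightarrow> sym \<Rightarrow> sym" where
  "derivation m X f = (\<Sum>i<m. \<Sum>j<m. const (X $$ (i, j)) * (indet i * partial_deriv j f))"

lemma sym_rep_simps [simp]: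
  "carrier (sym_rep m k) = {f. keys f \<subseteq> exponents m k}"
  "zero (sym_rep m k) = 0" "add (sym_rep m k) = (+)"
  "smult (sym_rep m k) c = scale c"
  "act (sym_rep m k) X = derivation m X"
proof -
  show "act (sym_rep m k) X = derivation m X"
    unfolding derivation_def[abs_def] sym_rep_def rep.simps unit_exp_def[symmetric]
    by (subst single_unit_exp) (simp only: mult.assoc)
qed (simp_all add: sym_rep_def)

lemma module_sym_rep: "Module.module CC (sym_rep m k)"
  by (rule module_finsupp[where A = "exponents m k"]) simp_all

lemma sym_rep_a_minus: "f \<in> carrier (sym_rep m k) \<Longrightarrow> g \<in> carrier (sym_rep m k) \<Longrightarrow> f \<ominus>\<^bsub>sym_rep m k\<^esub> g = f - g"
proof -
  interpret CC_module "sym_rep m k" by (simp add: CC_module_def module_sym_rep)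
  assume fg: "f \<in> carrier (sym_rep m k)" "g \<in> carrier (sym_rep m k)"
  then have "\<ominus>\<^bsub>sym_rep m k\<^esub> g = - g"
    using smult_minus1[OF fg(2)] by (simp add: scale_minus_one)
  then show ?thesis by (simp add: a_minus_def)
qed

lemma derivation_add: "derivation m X (f + g) = derivation m X f + derivation m X g"
  by (simp add: derivation_def partial_deriv_add distrib_left sum.distrib)

lemma derivation_zero: "derivation m X 0 = 0"
  by (simp add: derivation_def partial_deriv_zero)

lemma derivation_const_mult: "derivation m X (const c * f) = const c * derivation m X f"
  by (simp add: derivation_def partial_deriv_const_mult sum_distrib_left mult.left_commute)

lemma derivation_closed:
  assumes "keys f \<subseteq> exponents m k"
  shows "keys (derivation m X f) \<subseteq> exponents m k"
  using assms
proof (induction f rule: keys_induct)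
  case (single K c)
  have "keys (const a * (indet i * partial_deriv j (single K c))) \<subseteq> exponents m k"
    if "i < m" for i j a
    using exponents_move[OF single(1) that, of j]
    by (cases "lookup K j = 0")
       (simp_all add: partial_deriv_single indet_mult_single mult_single)
  then show ?case
    unfolding derivation_def
    by (intro order.trans[OF keys_sum] UN_least) simp
qed (simp_all add: derivation_zero derivation_add keys_add_subset)

text \<open>
  A product of two vector fields is the vector field \<open>A\<close> of the matrix product plus a second order operator
  \<open>S\<close>. The latter is symmetric in \<open>X\<close> and \<open>Y\<close> and cancels in the commutator.
\<close>

lemma derivation_bracket:
  assumes X: "X \<in> carrier_mat m m" and Y: "Y \<in> carrier_mat m m"
  shows "derivation m (lie_bracket X Y) f = derivation m X (derivation m Y f) - derivation m Y (derivation m X f)"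
proof -
  define A where "A X Y = (\<Sum>i<m. \<Sum>l<m. const (\<Sum>j<m. X $$ (i, j) * Y $$ (j, l)) * (indet i * partial_deriv l f))"
    for X Y :: "complex mat"
  define S where "S X Y = (\<Sum>i<m. \<Sum>j<m. \<Sum>a<m. \<Sum>b<m. const (X $$ (i, j)) * const (Y $$ (a, b)) *
      (indet i * (indet a * partial_deriv j (partial_deriv b f))))" for X Y :: "complex mat"
  have comp: "derivation m X (derivation m Y f) = A X Y + S X Y" for X Y
  proof -
    have "partial_deriv j (derivation m Y f) =
        (\<Sum>b<m. const (Y $$ (j, b)) * partial_deriv b f) +
        (\<Sum>a<m. \<Sum>b<m. const (Y $$ (a, b)) * (indet a * partial_deriv j (partial_deriv b f)))" if "j < m" for j
    proof -
      have "partial_deriv j (derivation m Y f) = (\<Sum>a<m. \<Sum>b<m.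
          (if a = j then const (Y $$ (a, b)) * partial_deriv b f else 0) +
          const (Y $$ (a, b)) * (indet a * partial_deriv j (partial_deriv b f)))"
        unfolding derivation_def partial_deriv_sum partial_deriv_const_mult partial_deriv_indet_mult
        by (intro sum.cong refl) (simp add: distrib_left)
      also have "\<dots> = (\<Sum>b<m. \<Sum>a<m. if a = j then const (Y $$ (a, b)) * partial_deriv b f else 0) +
        (\<Sum>a<m. \<Sum>b<m. const (Y $$ (a, b)) * (indet a * partial_deriv j (partial_deriv b f)))"
        unfolding sum.distrib by (subst sum.swap) (rule refl)
      finally show ?thesis using that by simp
    qed
    then have "derivation m X (derivation m Y f) = (\<Sum>i<m. \<Sum>j<m. const (X $$ (i, j)) * (indet i *
        ((\<Sum>b<m. const (Y $$ (j, b)) * partial_deriv b f) +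
        (\<Sum>a<m. \<Sum>b<m. const (Y $$ (a, b)) * (indet a * partial_deriv j (partial_deriv b f))))))"
      unfolding derivation_def[of m X] by simp
    also have "\<dots> = (\<Sum>i<m. \<Sum>j<m. \<Sum>b<m. const (X $$ (i, j)) * const (Y $$ (j, b)) * (indet i * partial_deriv b f))
        + S X Y"
      unfolding S_def by (simp add: distrib_left sum.distrib sum_distrib_left ac_simps)
    also have "(\<Sum>i<m. \<Sum>j<m. \<Sum>b<m. const (X $$ (i, j)) * const (Y $$ (j, b)) * (indet i * partial_deriv b f))
        = A X Y"
    proof -
      have const_sum: "const (\<Sum>j<m. g j) = (\<Sum>j<m. const (g j))" for g
        by (induction m) (simp_all add: single_add)
      show ?thesis
        unfolding A_def const_sum sum_distrib_right
        by (rule sum.cong[OF refl], subst sum.swap) (simp add: mult_single)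
    qed
    finally show ?thesis .
  qed
  have "S X Y = S Y X"
  proof -
    have "S X Y = (\<Sum>i<m. \<Sum>a<m. \<Sum>j<m. \<Sum>b<m. const (X $$ (i, j)) * const (Y $$ (a, b)) *
        (indet i * (indet a * partial_deriv j (partial_deriv b f))))"
      unfolding S_def by (rule sum.cong[OF refl], rule sum.swap)
    also have "\<dots> = (\<Sum>a<m. \<Sum>i<m. \<Sum>b<m. \<Sum>j<m. const (X $$ (i, j)) * const (Y $$ (a, b)) *
        (indet i * (indet a * partial_deriv j (partial_deriv b f))))"
      by (subst sum.swap, rule sum.cong[OF refl], rule sum.cong[OF refl], rule sum.swap)
    also have "\<dots> = (\<Sum>a<m. \<Sum>b<m. \<Sum>i<m. \<Sum>j<m. const (Y $$ (a, b)) * const (X $$ (i, j)) *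
        (indet a * (indet i * partial_deriv b (partial_deriv j f))))"
      by (rule sum.cong[OF refl], subst sum.swap) (simp add: ac_simps partial_deriv_commute)
    finally show ?thesis unfolding S_def .
  qed
  moreover have "derivation m (lie_bracket X Y) f = A X Y - A Y X"
    unfolding derivation_def A_def sum_subtractf[symmetric]
    by (intro sum.cong refl)
       (simp add: lie_bracket_index[OF X Y] single_diff left_diff_distrib)
  ultimately show ?thesis by (simp add: comp)
qed

lemma lie_rep_sym_rep: "lie_rep (sl m) (sym_rep m k)"
  unfolding lie_rep_def
proof (intro conjI ballI allI)
  show "vectorspace CC (sym_rep m k)" by (rule vectorspace_CCI[OF module_sym_rep])
  fix X assume "X \<in> sl m"
  then have X: "X \<in> carrier_mat m m" by (rule sl_carrier)
  show "act (sym_rep m k) X \<in> linear_maps (sym_rep m k) (sym_rep m k)"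
    by (simp add: linear_maps_def derivation_add derivation_closed
        derivation_const_mult flip: const_mult_eq_scale)
  fix f assume f: "f \<in> carrier (sym_rep m k)"
  show "act (sym_rep m k) (c \<cdot>\<^sub>m X) f = c \<odot>\<^bsub>sym_rep m k\<^esub> act (sym_rep m k) X f" for c
    using X
    by (simp add: derivation_def sum_distrib_left mult_single flip: const_mult_eq_scale mult.assoc)
  fix Y assume "Y \<in> sl m"
  then have Y: "Y \<in> carrier_mat m m" by (rule sl_carrier)
  show "act (sym_rep m k) (X + Y) f = act (sym_rep m k) X f \<oplus>\<^bsub>sym_rep m k\<^esub> act (sym_rep m k) Y f"
    using X Y by (simp add: derivation_def single_add distrib_right sum.distrib)
  show "act (sym_rep m k) (lie_bracket X Y) f =
      act (sym_rep m k) X (act (sym_rep m k) Y f) \<ominus>\<^bsub>sym_rep m k\<^esub> act (sym_rep m k) Y (act (sym_rep m k) X f)"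
    using f by (simp add: sym_rep_a_minus derivation_closed derivation_bracket[OF X Y])
qed

section \<open>Simplicity of the symmetric powers\<close>

lemma derivation_mat_unit:
  assumes "i < m" "j < m"
  shows "derivation m (mat_unit m i j) f = indet i * partial_deriv j f"
proof -
  have "derivation m (mat_unit m i j) f =
      (\<Sum>a<m. \<Sum>b<m. if a = i then if b = j then indet i * partial_deriv j f else 0 else 0)"
    unfolding derivation_def
    by (intro sum.cong refl) (auto simp: mat_unit_index)
  also have "\<dots> = (\<Sum>a<m. if a = i then \<Sum>b<m. if b = j then indet i * partial_deriv j f else 0 else 0)"
    by (intro sum.cong refl) simp
  finally show ?thesis using assms by simp
qed

definition top_exp :: "nat \<Rightarrow> nat \<Rightarrow>\<^sub>0 nat" where
  "top_exp k = single 0 k"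

lemma lookup_top_exp: "lookup (top_exp k) i = (if i = 0 then k else 0)"
  by (simp add: top_exp_def lookup_single when_def)

lemma top_exp_exponents: "m \<ge> 1 \<Longrightarrow> top_exp k \<in> exponents m k"
  by (simp add: exponents_iff lookup_top_exp)

lemma eq_top_exp:
  assumes "K \<in> exponents m k" "m \<ge> 1" "lookup K 0 = k"
  shows "K = top_exp k"
proof (rule poly_mapping_eqI)
  fix i
  have "(\<Sum>i<m. lookup K i) = k + (\<Sum>i<m - 1. lookup K (Suc i))"
    using assms(2,3) by (simp add: sum_lessThan_shift[of m])
  then have "lookup K (Suc i) = 0" if "i < m - 1" for i
    using assms(1) that by (simp add: exponents_iff)
  moreover have "lookup K i = 0" if "i \<ge> m"
    using assms(1) that by (simp add: exponents_iff)
  ultimately show "lookup K i = lookup (top_exp k) i"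
    using assms(2,3) by (cases i) (force simp: lookup_top_exp)+
qed

lemma exponent_positive:
  assumes "K \<in> exponents m k" "m \<ge> 1" "lookup K 0 < k"
  obtains j where "0 < j" "j < m" "lookup K j > 0"
proof -
  have "(\<Sum>i<m. lookup K i) = lookup K 0 + (\<Sum>i<m - 1. lookup K (Suc i))"
    using assms(2) by (simp add: sum_lessThan_shift[of m])
  moreover have "(\<Sum>i<m. lookup K i) = k"
    using assms(1) by (simp add: exponents_iff)
  ultimately have "(\<Sum>i<m - 1. lookup K (Suc i)) \<noteq> 0"
    using assms(3) by linarith
  then obtain i where "i < m - 1" "lookup K (Suc i) \<noteq> 0"
    by (meson lessThan_iff sum.neutral)
  then show thesis using that[of "Suc i"] by simp
qed

lemma lookup_indet_mult: "lookup (indet i * f) (unit_exp i + M) = lookup f M"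
  by (induction f rule: sym_induct) (simp_all add: distrib_left lookup_add indet_mult_single lookup_single)

lemma keys_indet_mult: "K \<in> keys (indet i * f) \<Longrightarrow> \<exists>M\<in>keys f. K = unit_exp i + M"
  using keys_mult[of "indet i" f] by auto

lemma keys_partial_deriv:
  assumes "M \<in> keys (partial_deriv j f)"
  shows "M + unit_exp j \<in> keys f"
  using assms by (auto simp: in_keys_iff lookup_partial_deriv)

text \<open>
  The operator \<open>x\<^sub>i \<partial>\<^sub>j\<close> is the action of the matrix unit \<open>E\<^sub>i\<^sub>j\<close>, which has trace 0 for \<open>i \<noteq> j\<close>.
\<close>

locale sym_invariant_subspace =
  fixes m k :: nat and W :: "sym set"
  assumes m: "m \<ge> 1"
    and W_sub: "W \<subseteq> {f. keys f \<subseteq> exponents m k}"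
    and W_zero: "0 \<in> W"
    and W_add: "f \<in> W \<Longrightarrow> g \<in> W \<Longrightarrow> f + g \<in> W"
    and W_scale: "f \<in> W \<Longrightarrow> const c * f \<in> W"
    and W_move: "i < m \<Longrightarrow> j < m \<Longrightarrow> i \<noteq> j \<Longrightarrow> f \<in> W \<Longrightarrow> indet i * partial_deriv j f \<in> W"
begin

lemma single_in_W:
  assumes "single K c \<in> W" "c \<noteq> 0"
  shows "single K d \<in> W"
  using W_scale[OF assms(1), of "d / c"] assms(2) by (simp add: mult_single)

text \<open>
  For \<open>j > 0\<close> the operator \<open>x\<^sub>0 \<partial>\<^sub>j\<close> raises the exponent of \<open>x\<^sub>0\<close> in each monomial that it does not kill,
  and it maps distinct monomials that it does not kill to multiples of distinct monomials. Choosing \<open>j\<close>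
  such that a monomial of \<open>f\<close> with the lowest exponent of \<open>x\<^sub>0\<close> survives, one lowers the bound \<open>N\<close> on the
  number of remaining steps.
\<close>

lemma raise_to_top:
  assumes "f \<in> W" "f \<noteq> 0" "\<And>K. K \<in> keys f \<Longrightarrow> k - lookup K 0 \<le> N"
  shows "single (top_exp k) 1 \<in> W"
  using assms
proof (induction N arbitrary: f)
  case 0
  have keys: "K = top_exp k" if "K \<in> keys f" for K
  proof -
    have K: "K \<in> exponents m k" using that 0(1) W_sub by blast
    show ?thesis
      using 0(3)[OF that] exponents_lookup_le[OF K, of 0] by (intro eq_top_exp[OF K m]) simp
  qed
  then have "lookup f K = 0" if "K \<noteq> top_exp k" for K
    using that by (auto simp: in_keys_iff)
  then have f: "f = single (top_exp k) (lookup f (top_exp k))"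
    by (intro poly_mapping_eqI) (auto simp: lookup_single when_def)
  with 0(2) have "lookup f (top_exp k) \<noteq> 0" by (metis single_zero)
  with f 0(1) show ?case using single_in_W by metis
next
  case (Suc N)
  show ?case
  proof (cases "\<forall>K\<in>keys f. k - lookup K 0 \<le> N")
    case True
    then show ?thesis using Suc by blast
  next
    case False
    then obtain K where K: "K \<in> keys f" "lookup K 0 < k" by force
    have Ke: "K \<in> exponents m k" using K(1) Suc(2) W_sub by blast
    obtain j where j: "0 < j" "j < m" "lookup K j > 0"
      using exponent_positive[OF Ke m K(2)] .
    \<comment> \<open>\<open>K\<close> has the lowest exponent of \<open>x\<^sub>0\<close>, and the coefficient of \<open>?g\<close> at the image of \<open>K\<close> is not 0.\<close>
    let ?g = "indet 0 * partial_deriv j f"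
    have g: "?g \<in> W" using W_move[of 0 j f] j Suc(2) m by simp
    have Kj: "(K - unit_exp j) + unit_exp j = K"
      using unit_exp_cancel[of K j] j(3) by (simp add: add.commute)
    have "lookup ?g (unit_exp 0 + (K - unit_exp j)) =
        of_nat (lookup (K - unit_exp j) j + 1) * lookup f K"
      unfolding lookup_indet_mult lookup_partial_deriv Kj ..
    also have "\<dots> \<noteq> 0" using K(1) unfolding in_keys_iff by (simp del: of_nat_add of_nat_Suc)
    finally have "?g \<noteq> 0" by auto
    moreover have "k - lookup M 0 \<le> N" if M: "M \<in> keys ?g" for M
    proof -
      obtain M' where M': "M = unit_exp 0 + M'" "M' \<in> keys (partial_deriv j f)"
        using keys_indet_mult[OF M] by blast
      from Suc(4)[OF keys_partial_deriv[OF M'(2)]] j(1) show ?thesis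
        by (simp add: M'(1) lookup_add lookup_unit_exp)
    qed
    ultimately show ?thesis using Suc.IH[OF g] by blast
  qed
qed

text \<open>
  The operator \<open>x\<^sub>j \<partial>\<^sub>0\<close> maps \<open>x\<^sup>K x\<^sub>0 / x\<^sub>j\<close> to a nonzero multiple of \<open>x\<^sup>K\<close>.
\<close>

lemma lower_from_top:
  assumes top: "single (top_exp k) 1 \<in> W" and K: "K \<in> exponents m k"
  shows "single K 1 \<in> W"
  using K
proof (induction "k - lookup K 0" arbitrary: K)
  case 0
  then have "K = top_exp k"
    using exponents_lookup_le[of K m k 0] by (intro eq_top_exp[OF _ m]) auto
  then show ?case using top by simp
next
  case (Suc N)
  then have "lookup K 0 < k" by simp
  then obtain j where j: "0 < j" "j < m" "lookup K j > 0"
    using exponent_positive[OF Suc(3) m] by blast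
  let ?K = "unit_exp 0 + (K - unit_exp j)"
  have "N = k - lookup ?K 0"
    using Suc(2) j(1) by (simp add: lookup_add lookup_unit_exp lookup_minus)
  moreover have "?K \<in> exponents m k" using exponents_move[OF Suc(3) _ j(3), of 0] m by simp
  ultimately have "single ?K 1 \<in> W" by (rule Suc(1))
  then have "indet j * partial_deriv 0 (single ?K 1) \<in> W"
    using W_move[of j 0] j m by simp
  moreover have "indet j * partial_deriv 0 (single ?K 1)
      = single K (of_nat (lookup ?K 0))"
    using unit_exp_cancel[of K j] j(3) by (simp add: partial_deriv_single indet_mult_single)
  moreover have "lookup ?K 0 \<noteq> 0" by (simp add: lookup_add lookup_unit_exp)
  ultimately show ?case using single_in_W[of K "of_nat (lookup ?K 0)" 1] by simp
qed

lemma W_trivial_or_all: "W = {0} \<or> W = {f. keys f \<subseteq> exponents m k}"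
proof (cases "W = {0}")
  case False
  then obtain f where f: "f \<in> W" "f \<noteq> 0" using W_zero by blast
  have top: "single (top_exp k) 1 \<in> W"
    by (rule raise_to_top[OF f, of k]) simp
  have "g \<in> W" if "keys g \<subseteq> exponents m k" for g
    using that
  proof (induction g rule: keys_induct)
    case (single K c)
    then show ?case using single_in_W[OF lower_from_top[OF top]] by simp
  qed (simp_all add: W_zero W_add)
  then show ?thesis using W_sub by blast
qed simp

end

lemma simple_rep_sym_rep:
  assumes m: "m \<ge> 1"
  shows "simple_rep (sl m) (sym_rep m k)"
  unfolding simple_rep_def
proof (intro conjI allI impI)
  show "lie_rep (sl m) (sym_rep m k)" by (rule lie_rep_sym_rep)
  have "single (top_exp k) 1 \<in> carrier (sym_rep m k)"
    using top_exp_exponents[OF m] by simp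
  moreover have "single (top_exp k) 1 \<noteq> (0 :: sym)"
    by (metis lookup_single_eq lookup_zero zero_neq_one)
  ultimately show "carrier (sym_rep m k) \<noteq> {\<zero>\<^bsub>sym_rep m k\<^esub>}"
    unfolding sym_rep_simps by blast
  fix W assume W: "VectorSpace.subspace CC W (sym_rep m k) \<and>
    (\<forall>X\<in>sl m. \<forall>w\<in>W. act (sym_rep m k) X w \<in> W)"
  then have sub: "LinearCombinations.submodule CC W (sym_rep m k)" by (simp add: subspace_def)
  have "sym_invariant_subspace m k W"
  proof
    show "W \<subseteq> {f. keys f \<subseteq> exponents m k}"
      using LinearCombinations.submodule.subset[OF sub] by simp
    show "0 \<in> W" using LinearCombinations.submodule.zero_closed[OF sub] by simp
    show "f + g \<in> W" if "f \<in> W" "g \<in> W" for f g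
      using LinearCombinations.submodule.m_closed[OF sub that] by simp
    show "const c * f \<in> W" if "f \<in> W" for c f
      using LinearCombinations.submodule.smult_closed[OF sub _ that, of c] by (simp add: const_mult_eq_scale)
    show "indet i * partial_deriv j f \<in> W" if "i < m" "j < m" "i \<noteq> j" "f \<in> W" for i j f
      using W that mat_unit_sl[OF that(3), of m] derivation_mat_unit[OF that(1,2), of f] by force
  qed (rule m)
  then show "W = {\<zero>\<^bsub>sym_rep m k\<^esub>} \<or> W = carrier (sym_rep m k)"
    using sym_invariant_subspace.W_trivial_or_all by simp
qed

lemma fin_dim_sym_rep: "vectorspace.fin_dim CC (sym_rep m k)"
proof -
  have vs: "vectorspace CC (sym_rep m k)" by (rule vectorspace_CCI[OF module_sym_rep])
  let ?B = "(\<lambda>K. single K 1 :: sym) ` exponents m k"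
  have B: "?B \<subseteq> carrier (sym_rep m k)" by (simp add: image_subset_iff)
  note sub = module.span_is_submodule[OF module_sym_rep B]
  have "f \<in> LinearCombinations.module.span CC (sym_rep m k) ?B" if "keys f \<subseteq> exponents m k" for f
    using that
  proof (induction f rule: keys_induct)
    case zero
    then show ?case using LinearCombinations.submodule.zero_closed[OF sub] by simp
  next
    case (single K c)
    then have "single K 1 \<in> LinearCombinations.module.span CC (sym_rep m k) ?B"
      using module.in_own_span[OF module_sym_rep B] by blast
    from LinearCombinations.submodule.smult_closed[OF sub _ this, of c] show ?case
      by (simp add: scale_single)
  next
    case (add f g)
    then show ?case using LinearCombinations.submodule.m_closed[OF sub] by simp
  qed
  then have "carrier (sym_rep m k) \<subseteq> LinearCombinations.module.span CC (sym_rep m k) ?B"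
    unfolding sym_rep_simps by blast
  then have gen: "LinearCombinations.module.span CC (sym_rep m k) ?B = carrier (sym_rep m k)"
    using LinearCombinations.submodule.subset[OF sub] by (rule subset_antisym[rotated])
  show ?thesis
    unfolding vectorspace.fin_dim_def[OF vs]
    by (rule exI[of _ ?B]) (intro conjI B finite_imageI[OF finite_exponents] gen)
qed

text \<open>
  The only partial derivative of \<open>x\<^sub>0\<^sup>k\<close> that does not vanish is the one in direction \<open>x\<^sub>0\<close>, so only the
  first column of \<open>X\<close> matters.
\<close>

lemma derivation_top:
  assumes "m \<ge> 1" "\<And>i. 0 < i \<Longrightarrow> i < m \<Longrightarrow> X $$ (i, 0) = 0"
  shows "derivation m X (single (top_exp k) c)
    = single (top_exp k) (of_nat k * X $$ (0, 0) * c)"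
proof -
  have pd: "partial_deriv j (single (top_exp k) c) =
      (if j = 0 then single (top_exp k - unit_exp 0) (of_nat k * c) else 0)" for j
    by (simp add: partial_deriv_single lookup_top_exp)
  have "derivation m X (single (top_exp k) c) =
      (\<Sum>i<m. if i = 0 then const (X $$ (0, 0)) * (indet 0 * partial_deriv 0 (single (top_exp k) c)) else 0)"
    unfolding derivation_def
  proof (rule sum.cong[OF refl])
    fix i assume i: "i \<in> {..<m}"
    have "(\<Sum>j<m. const (X $$ (i, j)) * (indet i * partial_deriv j (single (top_exp k) c)))
        = (\<Sum>j<m. if j = 0 then const (X $$ (i, 0)) * (indet i * partial_deriv 0 (single (top_exp k) c)) else 0)"
      by (rule sum.cong[OF refl]) (simp add: pd)
    then show "(\<Sum>j<m. const (X $$ (i, j)) * (indet i * partial_deriv j (single (top_exp k) c)))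
        = (if i = 0 then const (X $$ (0, 0)) * (indet 0 * partial_deriv 0 (single (top_exp k) c)) else 0)"
      using assms i by simp
  qed
  also have "\<dots> = const (X $$ (0, 0)) * (indet 0 * partial_deriv 0 (single (top_exp k) c))"
    using assms(1) by simp
  also have "\<dots> = single (top_exp k) (of_nat k * X $$ (0, 0) * c)"
  proof (cases "k = 0")
    case False
    then have "unit_exp 0 + (top_exp k - unit_exp 0) = top_exp k"
      by (intro unit_exp_cancel) (simp add: lookup_top_exp)
    then show ?thesis by (simp add: pd indet_mult_single mult_single mult_ac)
  next
    case True
    then show ?thesis using pd[of 0] by simp
  qed
  finally show ?thesis .
qed

section \<open>Highest weights of the trivial representation and of the symmetric powers\<close>

lemma lie_rep_triv_rep: "lie_rep (sl m) triv_rep"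
proof -
  have mod: "Module.module CC triv_rep"
    by (rule module_criteria)
       (auto simp: triv_rep_def cring_CC algebra_simps intro: exI[of _ "- _"])
  interpret CC_module "triv_rep" by (simp add: CC_module_def mod)
  have minus: "x \<ominus>\<^bsub>triv_rep\<^esub> y = x - y" for x y
    using smult_minus1[of y] by (simp add: a_minus_def triv_rep_def)
  show ?thesis
    unfolding lie_rep_def minus using vectorspace_CCI[OF mod]
    by (simp add: linear_maps_def triv_rep_def algebra_simps)
qed

lemma triv_rep_simps [simp]:
  "carrier triv_rep = UNIV" "zero triv_rep = 0" "add triv_rep = (+)" "smult triv_rep = (*)"
  "act triv_rep X c = 0"
  by (simp_all add: triv_rep_def)

lemma simple_rep_triv_rep: "simple_rep (sl m) triv_rep"
  unfolding simple_rep_def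
proof (intro conjI allI impI)
  show "lie_rep (sl m) triv_rep" by (rule lie_rep_triv_rep)
  show "carrier triv_rep \<noteq> {\<zero>\<^bsub>triv_rep\<^esub>}" by (metis UNIV_I singletonD zero_neq_one triv_rep_simps(1,2))
  fix W assume "VectorSpace.subspace CC W triv_rep \<and> (\<forall>X\<in>sl m. \<forall>w\<in>W. act triv_rep X w \<in> W)"
  then have sub: "LinearCombinations.submodule CC W triv_rep" by (simp add: subspace_def)
  have "c \<in> W" if "w \<in> W" "w \<noteq> 0" for w c
    using LinearCombinations.submodule.smult_closed[OF sub _ that(1), of "c / w"] that(2) by simp
  then show "W = {\<zero>\<^bsub>triv_rep\<^esub>} \<or> W = carrier triv_rep"
    using LinearCombinations.submodule.zero_closed[OF sub] by auto
qed

lemma fin_dim_triv_rep: "vectorspace.fin_dim CC triv_rep"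
proof -
  have vs: "vectorspace CC triv_rep" using lie_rep_triv_rep[of 0] by (simp add: lie_rep_def)
  then have mod: "Module.module CC triv_rep" by (simp add: vectorspace_def)
  have B: "{1} \<subseteq> carrier triv_rep" by simp
  note sub = module.span_is_submodule[OF mod B]
  have "c \<in> LinearCombinations.module.span CC triv_rep {1}" for c
    using LinearCombinations.submodule.smult_closed[OF sub, of c 1] module.in_own_span[OF mod B] by simp
  then have gen: "LinearCombinations.module.span CC triv_rep {1} = carrier triv_rep" by auto
  show ?thesis
    unfolding vectorspace.fin_dim_def[OF vs]
    by (rule exI[of _ "{1}"]) (intro conjI B gen, simp)
qed

lemma rho_carrier [simp]: "rho n \<in> carrier_vec n"
  by (simp add: rho_def)

lemma dchi_carrier [simp]: "dchi n \<in> carrier_vec n"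
  by (simp add: dchi_def)

lemma omega1_carrier [simp]: "omega1 n \<in> carrier_vec n"
  by (simp add: omega1_def)

lemma weight_vec_dims [simp]: "dim_vec (rho n) = n" "dim_vec (dchi n) = n" "dim_vec (omega1 n) = n"
  by (simp_all add: rho_def dchi_def omega1_def)

lemma rho_index:
  assumes l: "l < n"
  shows "rho n $ l = (of_nat n - 1 - 2 * of_nat l) / 2"
proof -
  have S: "{(i, j). i < j \<and> j < n} = (\<lambda>(j, i). (i, j)) ` (SIGMA j:{..<n}. {..<j})"
    by auto
  have "(\<Sum>(i, j)\<in>{(i, j). i < j \<and> j < n}. (unit_vec n i - unit_vec n j) $ l) =
      (\<Sum>(j, i)\<in>(SIGMA j:{..<n}. {..<j}). (unit_vec n i - unit_vec n j) $ l :: complex)"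
    unfolding S by (subst sum.reindex) (auto simp: inj_on_def case_prod_unfold)
  also have "\<dots> = (\<Sum>j<n. \<Sum>i<j. (unit_vec n i - unit_vec n j) $ l)"
    by (subst sum.Sigma) auto
  also have "\<dots> = (\<Sum>j<n. (if l < j then 1 else 0) - (if j = l then of_nat l else 0))"
  proof (rule sum.cong[OF refl])
    fix j assume j: "j \<in> {..<n}"
    have "(\<Sum>i<j. (unit_vec n i - unit_vec n j) $ l :: complex) =
        (\<Sum>i<j. (if i = l then 1 else 0) - (if j = l then 1 else 0))"
      using l j by (intro sum.cong) (auto simp: unit_vec_def)
    also have "\<dots> = (if l < j then 1 else 0) - (if j = l then of_nat l else 0)"
      by (auto simp: sum_subtractf)
    finally show "(\<Sum>i<j. (unit_vec n i - unit_vec n j) $ l :: complex)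
      = (if l < j then 1 else 0) - (if j = l then of_nat l else 0)" .
  qed
  also have "\<dots> = of_nat n - 1 - 2 * of_nat l"
  proof -
    have "(\<Sum>j<n. if l < j then 1 else 0 :: complex) = (\<Sum>j\<in>{l<..<n}. 1)"
      by (rule sum.mono_neutral_cong_right) auto
    also have "\<dots> = of_nat n - 1 - of_nat l"
      using l by (simp add: of_nat_diff algebra_simps)
    finally show ?thesis using l by (simp add: sum_subtractf)
  qed
  finally show ?thesis using l by (simp add: rho_def)
qed

lemma mat_unit_dim [simp]: "dim_row (mat_unit n i j) = n" "dim_col (mat_unit n i j) = n"
  by (simp_all add: mat_unit_def)

lemma weight_coroot:
  assumes "u \<in> carrier_vec n" "i < n" "j < n"
  shows "weight u (coroot n i j) = u $ i - u $ j"
proof -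
  have "weight u (coroot n i j) = (\<Sum>l<n. (if l = i then u $ i else 0) - (if l = j then u $ j else 0))"
    unfolding weight_eq[OF assms(1)] coroot_def
    by (intro sum.cong) (auto simp: mat_unit_index algebra_simps)
  then show ?thesis using assms by (simp add: sum_subtractf)
qed

lemma weight_lincomb:
  assumes "u \<in> carrier_vec n" "v \<in> carrier_vec n"
  shows "weight (a \<cdot>\<^sub>v u + b \<cdot>\<^sub>v v) X = a * weight u X + b * weight v X"
  using assms by (simp add: weight_eq[of _ n] sum_distrib_left sum.distrib algebra_simps)

lemma weight_scale:
  assumes "u \<in> carrier_vec n"
  shows "weight (a \<cdot>\<^sub>v u) X = a * weight u X"
  using assms by (simp add: weight_eq[of _ n] sum_distrib_left algebra_simps)

text \<open>
  The diagonal entries after the first one add up to minus the first one.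
\<close>

lemma weight_dchi:
  assumes n: "n \<ge> 2" and X: "X \<in> sl n"
  shows "weight (dchi n) X = X $$ (0, 0)"
proof -
  have tr: "(\<Sum>i<n - 1. X $$ (Suc i, Suc i)) = - X $$ (0, 0)"
    using sl_trace[OF X] n sum_lessThan_shift[of n "\<lambda>i. X $$ (i, i)"] by (simp add: eq_neg_iff_add_eq_0 add.commute)
  have nz: "of_nat n \<noteq> (0 :: complex)" using n by simp
  have "weight (dchi n) X = of_nat (n - 1) / of_nat n * X $$ (0, 0)
      + (\<Sum>i<n - 1. (- 1 / of_nat n) * X $$ (Suc i, Suc i))"
    using n unfolding weight_eq[OF dchi_carrier] sum_lessThan_shift[OF order.trans[OF one_le_numeral n]]
    by (simp add: dchi_def)
  also have "\<dots> = X $$ (0, 0)"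
    unfolding sum_distrib_left[symmetric] tr using n nz by (simp add: of_nat_diff field_simps)
  finally show ?thesis .
qed

lemma weight_omega1:
  assumes n: "n \<ge> 3" and X: "X \<in> sl n"
  shows "weight (omega1 n) X = X $$ (1, 1) + X $$ (0, 0) / of_nat (n - 1)"
proof -
  have split: "(\<Sum>i<n. f i) = f 0 + (f 1 + (\<Sum>i<n - 2. f (Suc (Suc i))))" for f :: "nat \<Rightarrow> complex"
    using n sum_lessThan_shift[of n f] sum_lessThan_shift[of "n - 1" "\<lambda>i. f (Suc i)"]
    by (simp add: numeral_2_eq_2)
  have tr: "(\<Sum>i<n - 2. X $$ (Suc (Suc i), Suc (Suc i))) = - X $$ (0, 0) - X $$ (1, 1)"
    using sl_trace[OF X] split[of "\<lambda>i. X $$ (i, i)"] by (simp add: algebra_simps eq_neg_iff_add_eq_0)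
  have "weight (omega1 n) X = of_nat (n - 2) / of_nat (n - 1) * X $$ (1, 1)
      + (\<Sum>i<n - 2. (- 1 / of_nat (n - 1)) * X $$ (Suc (Suc i), Suc (Suc i)))"
    using n unfolding weight_eq[OF omega1_carrier] split
    by (simp add: omega1_def)
  also have "\<dots> = X $$ (1, 1) + X $$ (0, 0) / of_nat (n - 1)"
  proof -
    have "of_nat (n - 1) \<noteq> (0 :: complex)" using n by (simp only: of_nat_eq_0_iff)
    moreover have "of_nat (n - 2) = of_nat (n - 1) - (1 :: complex)" using n by (simp add: of_nat_diff)
    moreover have "(a - 1) / a * x + - 1 / a * (- y - x) = x + y / a" if "a \<noteq> 0" for a x y :: complex
      using that by (simp add: field_simps)
    ultimately show ?thesis unfolding sum_distrib_left[symmetric] tr by metis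
  qed
  finally show ?thesis .
qed

lemma mu_minus_rho: "mu n k - rho n = of_nat k \<cdot>\<^sub>v omega1 n + sym_param n k \<cdot>\<^sub>v dchi n"
  by (intro eq_vecI) (auto simp: mu_def)

lemma eta_minus_rho: "eta n k - rho n = (of_nat k - 1) \<cdot>\<^sub>v dchi n"
  by (intro eq_vecI) (auto simp: eta_def)

lemma mu_minus_rho_carrier [simp]: "mu n k - rho n \<in> carrier_vec n"
  unfolding mu_minus_rho by simp

lemma eta_minus_rho_carrier [simp]: "eta n k - rho n \<in> carrier_vec n"
  unfolding eta_minus_rho by simp

lemma weight_mu_minus_rho:
  "n \<ge> 3 \<Longrightarrow> X \<in> sl n \<Longrightarrow> weight (mu n k - rho n) X =
    of_nat k * (X $$ (1, 1) + X $$ (0, 0) / of_nat (n - 1)) + sym_param n k * X $$ (0, 0)"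
  unfolding mu_minus_rho
  by (subst weight_lincomb[of _ n]) (simp_all add: weight_omega1 weight_dchi)

lemma weight_eta_minus_rho:
  "n \<ge> 2 \<Longrightarrow> X \<in> sl n \<Longrightarrow> weight (eta n k - rho n) X = (of_nat k - 1) * X $$ (0, 0)"
  by (simp add: eta_minus_rho weight_scale[OF dchi_carrier] weight_dchi)

lemma mu_P_levi:
  assumes n: "n \<ge> 3"
  shows "mu n k \<in> P_levi n"
  unfolding P_levi_def
proof (intro CollectI conjI ballI)
  show c: "mu n k \<in> carrier_vec n" by (simp add: mu_def)
  fix i assume i: "i \<in> {1..<n - 1}"
  have wt: "weight (mu n k) (coroot n i (i + 1)) = mu n k $ i - mu n k $ (i + 1)"
    by (rule weight_coroot[OF c]) (use i in auto)
  have "weight (mu n k) (coroot n i (i + 1)) = 1 + of_nat (if i = 1 then k else 0)"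
  proof -
    have nz: "of_nat (n - 1) \<noteq> (0 :: complex)" using n by (simp only: of_nat_eq_0_iff)
    have "of_nat (n - 2) = of_nat (n - 1) - (1 :: complex)" using n by (simp add: of_nat_diff)
    with nz have omega: "omega1 n $ i = omega1 n $ (i + 1) + (if i = 1 then 1 else 0)"
      using i by (auto simp: omega1_def field_simps simp del: of_nat_diff)
    have dchi: "dchi n $ i = dchi n $ (i + 1)" using i by (auto simp: dchi_def)
    have rho: "rho n $ i = rho n $ (i + 1) + 1" using i by (auto simp: rho_index field_simps)
    have mu: "mu n k $ j = of_nat k * omega1 n $ j + sym_param n k * dchi n $ j + rho n $ j" if "j < n" for j
      using that by (simp add: mu_def)
    have "i < n" "i + 1 < n" using i by auto
    then show ?thesis unfolding wt mu[OF \<open>i < n\<close>] mu[OF \<open>i + 1 < n\<close>] omega dchi rho by (simp add: algebra_simps)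
  qed
  then show "\<exists>d::nat. weight (mu n k) (coroot n i (i + 1)) = 1 + of_nat d" by blast
qed

lemma eta_P_levi:
  assumes n: "n \<ge> 3"
  shows "eta n k \<in> P_levi n"
  unfolding P_levi_def
proof (intro CollectI conjI ballI)
  show c: "eta n k \<in> carrier_vec n" by (simp add: eta_def)
  fix i assume i: "i \<in> {1..<n - 1}"
  have wt: "weight (eta n k) (coroot n i (i + 1)) = eta n k $ i - eta n k $ (i + 1)"
    by (rule weight_coroot[OF c]) (use i in auto)
  have "weight (eta n k) (coroot n i (i + 1)) = 1 + of_nat 0"
    unfolding wt using i by (auto simp: eta_def rho_index dchi_def field_simps)
  then show "\<exists>d::nat. weight (eta n k) (coroot n i (i + 1)) = 1 + of_nat d" by blast
qed

text \<open>
  A highest weight vector spans a line on which the whole Borel subalgebra acts by the weight, extended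
  by 0 to the strictly upper triangular matrices.
\<close>

lemma highest_weight_vectorI:
  assumes "v \<in> carrier V" "v \<noteq> \<zero>\<^bsub>V\<^esub>" and lam: "lam \<in> carrier_vec n"
    and act: "\<And>X. X \<in> borel n \<Longrightarrow> act V X v = weight lam X \<odot>\<^bsub>V\<^esub> v"
    and zero: "0 \<odot>\<^bsub>V\<^esub> v = \<zero>\<^bsub>V\<^esub>"
  shows "highest_weight_vector n lam V v"
  unfolding highest_weight_vector_def
proof (intro conjI ballI allI impI)
  fix H assume "H \<in> cartan n"
  then have "H \<in> borel n" by (intro borelI) (auto simp: cartan_def diagonal_mat_def sl_def)
  then show "act V H v = weight lam H \<odot>\<^bsub>V\<^esub> v" by (rule act)
next
  fix i j assume ij: "1 \<le> i \<and> i < j \<and> j < n"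
  then have "mat_unit n i j \<in> borel n"
    by (intro borelI) (auto simp: mat_unit_sl mat_unit_index)
  moreover have "weight lam (mat_unit n i j) = 0"
    using ij by (auto simp: weight_eq[OF lam] mat_unit_index intro!: sum.neutral)
  ultimately show "act V (mat_unit n i j) v = \<zero>\<^bsub>V\<^esub>" using act zero by simp
qed (use assms in auto)

lemma borel_act_sym_top:
  assumes n: "n \<ge> 3" and X: "X \<in> borel n"
  shows "act (parabolic_rep n (sym_rep (n - 1) k) (sym_param n k)) X (single (top_exp k) 1)
    = single (top_exp k) (weight (mu n k - rho n) X)"
proof -
  note Xc = sl_carrier[OF borel_sl[OF X]]
  have "derivation (n - 1) (levi_ss_part n X) (single (top_exp k) 1)
      = single (top_exp k) (of_nat k * levi_ss_part n X $$ (0, 0) * 1)"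
    using n X Xc borel_D[OF X] by (intro derivation_top) (simp_all add: levi_ss_part_index)
  then show ?thesis
    using n X Xc
    by (simp add: weight_mu_minus_rho borel_sl levi_ss_part_index scale_single single_add)
qed

lemma highest_weight_vector_sym:
  assumes n: "n \<ge> 3"
  shows "highest_weight_vector n (mu n k - rho n) (parabolic_rep n (sym_rep (n - 1) k) (sym_param n k))
    (single (top_exp k) 1)"
proof (rule highest_weight_vectorI)
  show "single (top_exp k) 1 \<noteq> \<zero>\<^bsub>parabolic_rep n (sym_rep (n - 1) k) (sym_param n k)\<^esub>"
    by simp (metis lookup_single_eq lookup_zero zero_neq_one)
qed (use n borel_act_sym_top[OF n] in \<open>simp_all add: top_exp_exponents scale_single del: parabolic_rep_simps(5)\<close>)

lemma highest_weight_vector_triv: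
  assumes n: "n \<ge> 3"
  shows "highest_weight_vector n (eta n k - rho n) (parabolic_rep n triv_rep (of_nat k - 1)) 1"
  by (rule highest_weight_vectorI)
     (use n in \<open>simp_all add: weight_eta_minus_rho borel_sl\<close>)

section \<open>Polynomials in the lowering operators\<close>

definition lowering :: "nat \<Rightarrow> nat \<Rightarrow> nc_poly" where
  "lowering n i = letter (mat_unit n (i + 1) 0)"

text \<open>
  A representative of \<^const>\<open>N_monomial\<close> in the free algebra.
\<close>

definition free_monomial :: "nat \<Rightarrow> (nat \<Rightarrow>\<^sub>0 nat) \<Rightarrow> nc_poly" where
  "free_monomial n K = foldr (\<lambda>i a. lowering n i ^ lookup K i * a) [0..<n - 1] 1"

interpretation sl: matrix_lie_algebra "sl n" for n
  by (rule matrix_lie_algebra_sl)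

lemma lowering_closed [simp]: "lowering n i \<in> free_elems (sl n)"
  by (simp add: lowering_def mat_unit_sl)

lemma foldr_lowering_closed: "foldr (\<lambda>i a. lowering n i ^ lookup K i * a) is 1 \<in> free_elems (sl n)"
  by (induction "is") simp_all

lemma free_monomial_closed [simp]: "free_monomial n K \<in> free_elems (sl n)"
  unfolding free_monomial_def by (rule foldr_lowering_closed)

lemma env_class_free_monomial: "env_class (sl n) (free_monomial n K) = N_monomial n K"
proof -
  have "env_class (sl n) (foldr (\<lambda>i a. lowering n i ^ lookup K i * a) is 1) =
     foldr (\<lambda>i a. (env_gen (sl n) (mat_unit n (i + 1) 0) [^]\<^bsub>env_alg (sl n)\<^esub> lookup K i)
                    \<otimes>\<^bsub>env_alg (sl n)\<^esub> a) is \<one>\<^bsub>env_alg (sl n)\<^esub>" for "is"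
  proof (induction "is")
    case (Cons i "is")
    then show ?case
      by (simp add: sl.env_class_mult sl.env_class_power foldr_lowering_closed)
         (simp add: lowering_def env_gen_def)
  qed (simp add: sl.env_class_one)
  then show ?thesis unfolding free_monomial_def N_monomial_def .
qed

lemma free_monomial_0: "free_monomial n 0 = 1"
proof -
  have "foldr (\<lambda>i a. lowering n i ^ lookup 0 i * a) is 1 = 1" for "is"
    by (induction "is") simp_all
  then show ?thesis by (simp add: free_monomial_def)
qed

lemma free_monomial_top:
  assumes "n \<ge> 2"
  shows "free_monomial n (top_exp k) = lowering n 0 ^ k"
proof -
  have "foldr (\<lambda>i a. lowering n i ^ lookup (top_exp k) i * a) is 1 = 1" if "0 \<notin> set is" for "is"
    using that by (induction "is") (simp_all add: lookup_top_exp)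
  moreover have "[0..<n - 1] = 0 # [1..<n - 1]" using assms by (simp add: upt_conv_Cons)
  ultimately show ?thesis by (simp add: free_monomial_def lookup_top_exp)
qed

lemma letter_zero_mat: "letter (0\<^sub>m n n) \<in> env_ideal (sl n)"
proof -
  have 0: "0\<^sub>m n n \<in> sl n" by (simp add: sl_def)
  have "letter (0 \<cdot>\<^sub>m 0\<^sub>m n n) - scalar 0 * letter (0\<^sub>m n n) \<in> env_rels (sl n)"
    unfolding env_rels_def using 0 by blast
  then show ?thesis using sl.env_rels_in_ideal[of n] by (auto simp: scalar_zero)
qed

lemma lowering_commute: "lowering n i * lowering n j - lowering n j * lowering n i \<in> env_ideal (sl n)"
proof -
  let ?X = "mat_unit n (i + 1) 0" and ?Y = "mat_unit n (j + 1) 0"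
  have XY: "?X \<in> sl n" "?Y \<in> sl n" by (simp_all add: mat_unit_sl)
  have "lie_bracket ?X ?Y = 0\<^sub>m n n"
    using lie_bracket_carrier[of ?X n ?Y]
    by (intro eq_matI) (auto simp: lie_bracket_index[OF mat_unit_carrier mat_unit_carrier] mat_unit_index intro!: sum.neutral)
  moreover have "letter (lie_bracket ?X ?Y) - (letter ?X * letter ?Y - letter ?Y * letter ?X) \<in> env_ideal (sl n)"
    by (rule subsetD[OF sl.env_rels_in_ideal]) (use XY in \<open>unfold env_rels_def, blast\<close>)
  ultimately show ?thesis
    using sl.env_ideal_diff[OF letter_zero_mat[of n], of "letter (0\<^sub>m n n) - (letter ?X * letter ?Y - letter ?Y * letter ?X)"]
    by (simp add: lowering_def)
qed

lemma lowering_power_commute: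
  "lowering n i ^ r * lowering n j - lowering n j * lowering n i ^ r \<in> env_ideal (sl n)"
proof (induction r)
  case (Suc r)
  let ?a = "lowering n i" and ?b = "lowering n j"
  have "?a ^ Suc r * ?b - ?b * ?a ^ Suc r = ?a * (?a ^ r * ?b - ?b * ?a ^ r) + (?a * ?b - ?b * ?a) * ?a ^ r"
    by (simp add: algebra_simps)
  then show ?case
    using Suc by (simp only:) (intro sl.env_ideal_add sl.env_ideal_lmult sl.env_ideal_rmult lowering_commute, simp_all)
qed (simp add: sl.env_ideal_zero)

text \<open>
  The lowering operators commute in \<open>U(sl(n))\<close>, so an additional factor can be moved to its place in the
  ordered product. This is proved for the partial products over a list of indices, from the right.
\<close>

lemma free_monomial_add_unit:
  assumes "i < n - 1"
  shows "free_monomial n (unit_exp i + K) - lowering n i * free_monomial n K \<in> env_ideal (sl n)"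
proof -
  let ?F = "\<lambda>K is. foldr (\<lambda>i a. lowering n i ^ lookup K i * a) is 1"
  \<comment> \<open>As long as the index \<open>i\<close> has not been met, the two products agree.\<close>
  have "?F (unit_exp i + K) is - (if i \<in> set is then lowering n i else 1) * ?F K is \<in> env_ideal (sl n)"
    if "distinct is" for "is"
    using that
  proof (induction "is")
    case (Cons j "is")
    let ?p = "lowering n j ^ lookup K j"
    note IH = Cons.IH[OF distinct.simps(2)[THEN iffD1, THEN conjunct2, OF Cons.prems]]
    show ?case
    proof (cases "j = i")
      case True
      then have "?F (unit_exp i + K) (j # is) - (if i \<in> set (j # is) then lowering n i else 1) * ?F K (j # is)
          = lowering n i ^ Suc (lookup K i) * (?F (unit_exp i + K) is - ?F K is)"
        by (simp add: lookup_add lookup_unit_exp algebra_simps)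
      moreover have "?F (unit_exp i + K) is - ?F K is \<in> env_ideal (sl n)"
        using IH Cons.prems True by simp
      ultimately show ?thesis by (simp only:) (intro sl.env_ideal_lmult free_elems_power lowering_closed)
    next
      case False
      let ?q = "if i \<in> set is then lowering n i else 1"
      have "?F (unit_exp i + K) (j # is) - (if i \<in> set (j # is) then lowering n i else 1) * ?F K (j # is)
          = ?p * (?F (unit_exp i + K) is - ?q * ?F K is) + (?p * ?q - ?q * ?p) * ?F K is"
        using False by (simp add: lookup_add lookup_unit_exp algebra_simps)
      moreover have "?p * ?q - ?q * ?p \<in> env_ideal (sl n)"
        by (simp add: lowering_power_commute sl.env_ideal_zero)
      ultimately show ?thesis
        using IH by (simp only:) (intro sl.env_ideal_add sl.env_ideal_lmult sl.env_ideal_rmult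
            foldr_lowering_closed free_elems_power lowering_closed)
    qed
  qed (simp add: sl.env_ideal_zero)
  from this[of "[0..<n - 1]"] show ?thesis
    using assms by (simp add: free_monomial_def)
qed

lemma exponents_remove:
  assumes "K \<in> exponents m (Suc d)" "lookup K i \<noteq> 0"
  shows "K - unit_exp i \<in> exponents m d"
proof -
  have i: "i < m" using assms by (metis exponents_iff not_less)
  have "(\<Sum>l<m. lookup (unit_exp i) l) + (\<Sum>l<m. lookup (K - unit_exp i) l) = Suc d"
    using assms unit_exp_cancel[OF assms(2)]
    by (metis (no_types, lifting) exponents_iff lookup_add sum.cong sum.distrib)
  then show ?thesis
    using assms(1) i by (auto simp: exponents_iff lookup_unit_exp lookup_minus)
qed

text \<open>
  Homogeneous polynomials arise from constants by multiplication with indeterminates and by addition.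
  The degree is recorded in \<open>Q\<close> because the raising operators act by degree dependent scalars.
\<close>

lemma homogeneous_induct [consumes 1, case_names const indet zero add]:
  fixes f :: sym
  assumes "keys f \<subseteq> exponents m d"
    and const: "\<And>c. Q 0 (const c)"
    and indet: "\<And>d i f. i < m \<Longrightarrow> keys f \<subseteq> exponents m d \<Longrightarrow> Q d f \<Longrightarrow> Q (Suc d) (indet i * f)"
    and zero: "\<And>d. Q d 0"
    and add: "\<And>d f g. keys f \<subseteq> exponents m d \<Longrightarrow> keys g \<subseteq> exponents m d \<Longrightarrow>
      Q d f \<Longrightarrow> Q d g \<Longrightarrow> Q d (f + g)"
  shows "Q d f"
  using assms(1)
proof (induction d arbitrary: f)
  case 0
  then show ?case
  proof (induction f rule: keys_induct)
    case (single K c)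
    then have "K = 0" by (intro poly_mapping_eqI) (metis exponents_lookup_le le_zero_eq lookup_zero)
    then show ?case using const by simp
  qed (use zero add in auto)
next
  case (Suc d)
  note IH = Suc.IH
  from Suc.prems show ?case
  proof (induction f rule: keys_induct)
    case (single K c)
    then have "(\<Sum>i<m. lookup K i) \<noteq> 0" by (simp add: exponents_iff)
    then obtain i where i: "i < m" "lookup K i \<noteq> 0"
      by (meson lessThan_iff sum.neutral)
    have K: "K - unit_exp i \<in> exponents m d" by (rule exponents_remove[OF single i(2)])
    have "Q (Suc d) (indet i * single (K - unit_exp i) c)"
      using i(1) K by (intro indet IH) simp_all
    then show ?case using unit_exp_cancel[OF i(2)] by (simp add: indet_mult_single)
  qed (use zero add in auto)
qed

lemma derivation_indet_mult:
  assumes "i < m"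
  shows "derivation m X (indet i * f) = (\<Sum>j<m. const (X $$ (j, i)) * (indet j * f)) + indet i * derivation m X f"
proof -
  have "derivation m X (indet i * f) = (\<Sum>a<m. \<Sum>b<m. (if b = i then const (X $$ (a, i)) * (indet a * f) else 0) +
      indet i * (const (X $$ (a, b)) * (indet a * partial_deriv b f)))"
    unfolding derivation_def partial_deriv_indet_mult
    by (intro sum.cong refl) (simp add: distrib_left mult.left_commute)
  then show ?thesis
    using assms by (simp add: sum.distrib derivation_def sum_distrib_left)
qed

text \<open>
  The type \<^typ>\<open>complex mat\<close> comprises the matrices of all dimensions and has no common zero, so sums of
  \<open>n\<close> by \<open>n\<close> matrices are built up from the zero matrix of this size.
\<close>

primrec mat_sum :: "nat \<Rightarrow> (nat \<Rightarrow> complex mat) \<Rightarrow> nat \<Rightarrow> complex mat" where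
  "mat_sum n F 0 = 0\<^sub>m n n"
| "mat_sum n F (Suc r) = mat_sum n F r + F r"

lemma mat_sum_carrier: "(\<And>l. l < r \<Longrightarrow> F l \<in> carrier_mat n n) \<Longrightarrow> mat_sum n F r \<in> carrier_mat n n"
  by (induction r) simp_all

lemma mat_sum_sl: "(\<And>l. l < r \<Longrightarrow> F l \<in> sl n) \<Longrightarrow> mat_sum n F r \<in> sl n"
  by (induction r) (simp_all add: sl_add, simp add: sl_def)

lemma mat_sum_index:
  "(\<And>l. l < r \<Longrightarrow> F l \<in> carrier_mat n n) \<Longrightarrow> i < n \<Longrightarrow> j < n \<Longrightarrow>
    mat_sum n F r $$ (i, j) = (\<Sum>l<r. F l $$ (i, j))"
proof (induction r)
  case (Suc r)
  have "F r \<in> carrier_mat n n" using Suc.prems by simp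
  then have "dim_row (F r) = n" "dim_col (F r) = n" by auto
  then show ?case using Suc by simp
qed simp

text \<open>
  The setting for the generalized Verma module \<open>M\<^sub>p(triv, s)\<close>.
\<close>

locale scalar_gvm =
  fixes n :: nat and s :: complex
  assumes n: "n \<ge> 2"

sublocale scalar_gvm \<subseteq> triv: levi_rep n triv_rep
  by (rule levi_repI[OF n lie_rep_triv_rep])

sublocale scalar_gvm \<subseteq> ind: induced_rep "sl n" "parabolic n" "parabolic_rep n triv_rep s"
  by (rule induced_rep_parabolic[OF n triv.lie_rep_parabolic_rep])

context scalar_gvm
begin

abbreviation gvm :: "((env \<times> complex) \<Rightarrow>\<^sub>0 complex) set rep" where
  "gvm \<equiv> induced (sl n) (parabolic n) (parabolic_rep n triv_rep s)"

text \<open>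
  The vector \<open>f(N\<^sub>1, \<dots>, N\<^sub>n\<^sub>-\<^sub>1) \<otimes> 1\<close>; indeterminates are numbered from 0.
\<close>

definition poly_vec :: "sym \<Rightarrow> ((env \<times> complex) \<Rightarrow>\<^sub>0 complex) set" where
  "poly_vec = lin_ext gvm (\<lambda>K. ind.tens (free_monomial n K) 1)"

lemma monomial_tens_closed: "(\<lambda>K. ind.tens (free_monomial n K) 1) \<in> UNIV \<rightarrow> carrier gvm"
  by simp

lemma poly_vec_closed [simp]: "poly_vec f \<in> carrier gvm"
  unfolding poly_vec_def by (rule ind.M.lin_ext_closed[OF subset_UNIV monomial_tens_closed])

lemma poly_vec_add: "poly_vec (f + g) = poly_vec f \<oplus>\<^bsub>gvm\<^esub> poly_vec g"
  unfolding poly_vec_def by (rule ind.M.lin_ext_add[OF subset_UNIV subset_UNIV monomial_tens_closed])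

lemma poly_vec_const_mult: "poly_vec (const c * f) = c \<odot>\<^bsub>gvm\<^esub> poly_vec f"
  unfolding poly_vec_def const_mult_eq_scale
  by (rule ind.M.lin_ext_scale[OF subset_UNIV monomial_tens_closed])

lemma poly_vec_zero: "poly_vec 0 = \<zero>\<^bsub>gvm\<^esub>"
  by (simp add: poly_vec_def ind.M.lin_ext_zero)

lemma poly_vec_single: "poly_vec (single K c) = c \<odot>\<^bsub>gvm\<^esub> ind.tens (free_monomial n K) 1"
  unfolding poly_vec_def by (rule ind.M.lin_ext_single) simp

text \<open>
  Multiplication by an indeterminate becomes the action of a lowering operator. This relation is what
  makes inductions over polynomials possible.
\<close>

lemma poly_vec_indet_mult:
  assumes "i < n - 1"
  shows "poly_vec (indet i * f) = act gvm (mat_unit n (i + 1) 0) (poly_vec f)"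
proof (induction f rule: sym_induct)
  case zero
  then show ?case
    using ind.M.act_smult[of "mat_unit n (i + 1) 0" "\<zero>\<^bsub>gvm\<^esub>" 0]
    by (simp add: poly_vec_zero mat_unit_sl)
next
  case (single K c)
  have "ind.tens (free_monomial n (unit_exp i + K)) 1 = ind.tens (lowering n i * free_monomial n K) 1"
    by (rule ind.tens_eqI[OF free_monomial_add_unit[OF assms]])
  then show ?case
    by (simp add: indet_mult_single poly_vec_single ind.M.act_smult mat_unit_sl ind.act_tens)
       (simp add: lowering_def)
next
  case (add f g)
  then show ?case by (simp add: distrib_left poly_vec_add ind.M.act_add mat_unit_sl)
qed

lemma act_generator:
  assumes "X \<in> parabolic n"
  shows "act gvm X (ind.tens 1 1) = (s * X $$ (0, 0)) \<odot>\<^bsub>gvm\<^esub> ind.tens 1 1"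
proof -
  have "act gvm X (ind.tens 1 1) = ind.tens 1 ((s * X $$ (0, 0)) * 1)"
    using assms ind.tens_letter[of 1 X 1] ind.act_tens[of X 1 1] parabolic_sl[OF n] by simp
  then show ?thesis
    using ind.tens_smult[of 1 1 "s * X $$ (0, 0)"] by simp
qed

lemma poly_vec_const: "poly_vec (const c) = c \<odot>\<^bsub>gvm\<^esub> ind.tens 1 1"
  by (simp add: poly_vec_single free_monomial_0)

lemma act_mat_sum:
  assumes "\<And>l. l < r \<Longrightarrow> F l \<in> sl n" "\<And>l. l < r \<Longrightarrow> act gvm (F l) v = poly_vec (p l)"
    and v: "v \<in> carrier gvm"
  shows "act gvm (mat_sum n F r) v = poly_vec (\<Sum>l<r. p l)"
  using assms(1,2)
proof (induction r)
  case 0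
  have 0: "0\<^sub>m n n \<in> sl n" by (simp add: sl_def)
  have "0 \<cdot>\<^sub>m 0\<^sub>m n n = (0\<^sub>m n n :: complex mat)" by (intro eq_matI) simp_all
  then show ?case
    using ind.M.act_mat_smult[OF 0 v, of 0] ind.M.act_closed[OF 0 v] by (simp add: poly_vec_zero)
next
  case (Suc r)
  then show ?case
    using v mat_sum_sl[of r F n] by (simp add: ind.M.act_mat_add poly_vec_add)
qed

end

lemma derivation_mat_add:
  assumes "X \<in> carrier_mat m m" "Y \<in> carrier_mat m m"
  shows "derivation m (X + Y) f = derivation m X f + derivation m Y f"
  using assms by (simp add: derivation_def single_add distrib_right sum.distrib)

lemma derivation_mat_smult:
  assumes "X \<in> carrier_mat m m"
  shows "derivation m (c \<cdot>\<^sub>m X) f = const c * derivation m X f"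
  using assms by (simp add: derivation_def sum_distrib_left mult_single flip: mult.assoc)

lemma derivation_one_mat:
  assumes "keys f \<subseteq> exponents m d"
  shows "derivation m (1\<^sub>m m) f = const (of_nat d) * f"
proof -
  have "derivation m (1\<^sub>m m) f = (\<Sum>i<m. \<Sum>j<m. if j = i then indet i * partial_deriv i f else 0)"
    unfolding derivation_def by (intro sum.cong refl) auto
  then show ?thesis using euler_formula[OF assms] by simp
qed

lemma derivation_const: "derivation m X (const c) = 0"
  by (simp add: derivation_def partial_deriv_single)

section \<open>The action of the parabolic subalgebra on polynomials in the lowering operators\<close>

context scalar_gvm
begin

text \<open>
  For \<open>X\<close> in the Levi subalgebra this is the matrix of \<open>ad X\<close> on \<open>n\<^sub>-\<close> with respect to the basis \<open>N\<^sub>1, \<dots>, N\<^sub>n\<^sub>-\<^sub>1\<close>.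
\<close>

definition adjoint_block :: "complex mat \<Rightarrow> complex mat" where
  "adjoint_block X = mat (n - 1) (n - 1) (\<lambda>(i, j). X $$ (i + 1, j + 1) - (if i = j then X $$ (0, 0) else 0))"

lemma adjoint_block_carrier [simp]: "adjoint_block X \<in> carrier_mat (n - 1) (n - 1)"
  by (simp add: adjoint_block_def)

lemma adjoint_block_index:
  "i < n - 1 \<Longrightarrow> j < n - 1 \<Longrightarrow>
    adjoint_block X $$ (i, j) = X $$ (i + 1, j + 1) - (if i = j then X $$ (0, 0) else 0)"
  by (simp add: adjoint_block_def)

lemma bracket_lowering:
  assumes X: "X \<in> sl n" and X0: "\<forall>j. 0 < j \<and> j < n \<longrightarrow> X $$ (0, j) = 0 \<and> X $$ (j, 0) = 0"
    and i: "i < n - 1"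
  shows "lie_bracket X (mat_unit n (i + 1) 0)
    = mat_sum n (\<lambda>j. adjoint_block X $$ (j, i) \<cdot>\<^sub>m mat_unit n (j + 1) 0) (n - 1)" (is "?L = ?R")
proof (rule eq_matI)
  have R: "?R \<in> carrier_mat n n" by (rule mat_sum_carrier) simp
  have L: "?L \<in> carrier_mat n n" by (rule lie_bracket_carrier[OF sl_carrier[OF X]]) simp
  show "dim_row ?L = dim_row ?R" "dim_col ?L = dim_col ?R" using L R by auto
  fix a b assume "a < dim_row ?R" "b < dim_col ?R"
  then have ab: "a < n" "b < n" using R by auto
  have "?L $$ (a, b) = (\<Sum>l<n. if l = i + 1 then (if b = 0 then X $$ (a, i + 1) else 0) else 0)
      - (\<Sum>l<n. if l = 0 then (if a = i + 1 then X $$ (0, b) else 0) else 0)"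
    unfolding lie_bracket_index[OF sl_carrier[OF X] mat_unit_carrier ab]
    using ab i by (intro arg_cong2[where f = "(-)"] sum.cong) (auto simp: mat_unit_index)
  also have "\<dots> = (if b = 0 then X $$ (a, i + 1) else 0) - (if a = i + 1 then X $$ (0, b) else 0)"
    using i n by simp
  also have "\<dots> = (\<Sum>j<n - 1. if j + 1 = a then (if b = 0 then adjoint_block X $$ (j, i) else 0) else 0)"
  proof (cases a)
    case 0
    then show ?thesis using X0[rule_format, of "i + 1"] i by simp
  next
    case (Suc a')
    have "(\<Sum>j<n - 1. if j + 1 = a then (if b = 0 then adjoint_block X $$ (j, i) else 0) else 0)
        = (\<Sum>j<n - 1. if j = a' then (if b = 0 then adjoint_block X $$ (a', i) else 0) else 0)"
      by (intro sum.cong) (auto simp: Suc)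
    also have "\<dots> = (if b = 0 then adjoint_block X $$ (a', i) else 0)"
      using ab Suc by simp
    finally show ?thesis
      using ab i Suc X0[rule_format, of b] by (auto simp: adjoint_block_index)
  qed
  also have "\<dots> = ?R $$ (a, b)"
    using ab by (subst mat_sum_index) (auto simp: mat_unit_index intro!: sum.cong)
  finally show "?L $$ (a, b) = ?R $$ (a, b)" .
qed

lemma lowering_act_poly_vec:
  assumes "j < n - 1"
  shows "act gvm (c \<cdot>\<^sub>m mat_unit n (j + 1) 0) (poly_vec f) = poly_vec (const c * (indet j * f))"
  unfolding poly_vec_const_mult poly_vec_indet_mult[OF assms]
  by (rule ind.M.act_mat_smult) (simp_all add: mat_unit_sl)

text \<open>
  Moving \<open>X\<close> to the right through a product of lowering operators produces the commutators \<open>[X, N\<^sub>i]\<close>, which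
  are combinations of lowering operators. So \<open>X\<close> acts as the derivation extending \<open>ad X\<close>, plus the scalar
  by which it acts on \<open>1 \<otimes> 1\<close>.
\<close>

lemma levi_act_poly_vec:
  assumes X: "X \<in> sl n" and X0: "\<forall>j. 0 < j \<and> j < n \<longrightarrow> X $$ (0, j) = 0 \<and> X $$ (j, 0) = 0"
    and f: "keys f \<subseteq> exponents (n - 1) d"
  shows "act gvm X (poly_vec f) = poly_vec (derivation (n - 1) (adjoint_block X) f + const (s * X $$ (0, 0)) * f)"
  using f
proof (induction f rule: homogeneous_induct)
  case (const c)
  have "X \<in> parabolic n" using X X0 n by (simp add: parabolic_eq)
  from act_generator[OF this] show ?case
    by (simp add: poly_vec_const ind.M.act_smult X derivation_const mult_single mult.commute
        flip: ind.M.smult_mult)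
next
  case (indet d i f)
  let ?N = "mat_unit n (i + 1) 0" and ?D = "derivation (n - 1) (adjoint_block X)"
  have N: "?N \<in> sl n" by (simp add: mat_unit_sl)
  have v: "poly_vec f \<in> carrier gvm" by simp
  have bracket: "act gvm (lie_bracket X ?N) (poly_vec f)
      = poly_vec (\<Sum>j<n - 1. const (adjoint_block X $$ (j, i)) * (indet j * f))"
    unfolding bracket_lowering[OF X X0 indet(1)]
    by (rule act_mat_sum[OF _ lowering_act_poly_vec v]) (simp_all add: mat_unit_sl sl_smult)
  have "act gvm X (poly_vec (indet i * f)) = act gvm X (act gvm ?N (poly_vec f))"
    by (simp only: poly_vec_indet_mult[OF indet(1)])
  also have "\<dots> = act gvm (lie_bracket X ?N) (poly_vec f) \<oplus>\<^bsub>gvm\<^esub> act gvm ?N (act gvm X (poly_vec f))"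
    using X N v by (rule ind.M.act_act)
  also have "act gvm ?N (act gvm X (poly_vec f)) = poly_vec (indet i * (?D f + const (s * X $$ (0, 0)) * f))"
    by (simp only: poly_vec_indet_mult[OF indet(1)] indet(3))
  finally show ?case
    unfolding bracket derivation_indet_mult[OF indet(1)]
    by (simp add: poly_vec_add[symmetric] algebra_simps)
next
  case (zero d)
  then show ?case
    using ind.M.act_smult[OF X ind.M.zero_closed, of 0] ind.M.act_closed[OF X ind.M.zero_closed]
    by (simp add: poly_vec_zero derivation_zero)
next
  case (add d f g)
  then show ?case
    using X by (simp add: poly_vec_add ind.M.act_add derivation_add distrib_left ind.M.a_ac)
qed

text \<open>
  The many-variable form of the identity \<open>E N\<^sup>d v = d (s - d + 1) N\<^sup>d\<^sup>-\<^sup>1 v\<close> in \<open>sl\<^sub>2\<close>; the factor \<open>d\<close> is part of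
  the derivative. The commutator of a raising and a lowering operator lies in the Levi subalgebra,
  whose action is known.
\<close>

lemma raising_act_poly_vec:
  assumes j: "j < n - 1" and f: "keys f \<subseteq> exponents (n - 1) d"
  shows "act gvm (mat_unit n 0 (j + 1)) (poly_vec f) = poly_vec (const (s - of_nat d + 1) * partial_deriv j f)"
  using f
proof (induction f rule: homogeneous_induct)
  case (const c)
  have E: "mat_unit n 0 (j + 1) \<in> sl n" by (simp add: mat_unit_sl)
  then have "mat_unit n 0 (j + 1) \<in> parabolic n"
    using n by (simp add: parabolic_eq mat_unit_index)
  from act_generator[OF this] show ?case
    using E n by (simp add: poly_vec_const ind.M.act_smult mat_unit_index partial_deriv_single poly_vec_zero)
next
  case (indet d i f)
  let ?N = "mat_unit n (i + 1) 0" and ?E = "mat_unit n 0 (j + 1)"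
  define Z where "Z = lie_bracket ?E ?N"
  have N: "?N \<in> sl n" and E: "?E \<in> sl n" by (simp_all add: mat_unit_sl)
  have Z: "Z \<in> sl n" unfolding Z_def by (rule lie_bracket_sl) simp_all
  have v: "poly_vec f \<in> carrier gvm" by simp
  have Z_index: "Z $$ (a, b) = (if i = j \<and> a = 0 \<and> b = 0 then 1 else 0) - (if a = i + 1 \<and> b = j + 1 then 1 else 0)"
    if ab: "a < n" "b < n" for a b
  proof -
    have "Z $$ (a, b) = (\<Sum>l<n. if l = j + 1 then (if i = j \<and> a = 0 \<and> b = 0 then 1 else 0) else 0)
        - (\<Sum>l<n. if l = 0 then (if a = i + 1 \<and> b = j + 1 then 1 else 0) else 0)"
      unfolding Z_def lie_bracket_index[OF mat_unit_carrier mat_unit_carrier ab]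
      using ab by (intro arg_cong2[where f = "(-)"] sum.cong) (auto simp: mat_unit_index)
    then show ?thesis using j n by simp
  qed
  have Z_block: "\<forall>b. 0 < b \<and> b < n \<longrightarrow> Z $$ (0, b) = 0 \<and> Z $$ (b, 0) = 0"
    using n by (simp add: Z_index)
  let ?\<delta> = "if i = j then 1 else 0 :: complex"
  have Z0: "Z $$ (0, 0) = ?\<delta>" using n by (simp add: Z_index)
  have "adjoint_block Z = (-1) \<cdot>\<^sub>m mat_unit (n - 1) i j + (- ?\<delta>) \<cdot>\<^sub>m 1\<^sub>m (n - 1)"
    using n by (intro eq_matI) (auto simp: adjoint_block_def Z_index mat_unit_index)
  then have "derivation (n - 1) (adjoint_block Z) f
      = const (-1) * (indet i * partial_deriv j f) + const (- ?\<delta>) * (const (of_nat d) * f)"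
    using derivation_mat_unit[OF indet(1) j, of f] derivation_one_mat[OF indet(2)]
      derivation_mat_add[of "(-1) \<cdot>\<^sub>m mat_unit (n - 1) i j" "n - 1" "(- ?\<delta>) \<cdot>\<^sub>m 1\<^sub>m (n - 1)" f]
      derivation_mat_smult[of "mat_unit (n - 1) i j" "n - 1" "-1" f]
      derivation_mat_smult[of "1\<^sub>m (n - 1)" "n - 1" "- ?\<delta>" f]
    by simp
  then have bracket: "act gvm Z (poly_vec f) = poly_vec (const (-1) * (indet i * partial_deriv j f)
      + const (- ?\<delta>) * (const (of_nat d) * f) + const (s * ?\<delta>) * f)"
    using levi_act_poly_vec[OF Z Z_block indet(2)] Z0 by simp
  have "act gvm ?E (poly_vec (indet i * f)) = act gvm ?E (act gvm ?N (poly_vec f))"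
    by (simp only: poly_vec_indet_mult[OF indet(1)])
  also have "\<dots> = act gvm Z (poly_vec f) \<oplus>\<^bsub>gvm\<^esub> act gvm ?N (act gvm ?E (poly_vec f))"
    using E N v unfolding Z_def by (rule ind.M.act_act)
  also have "act gvm ?N (act gvm ?E (poly_vec f))
      = poly_vec (indet i * (const (s - of_nat d + 1) * partial_deriv j f))"
    by (simp only: poly_vec_indet_mult[OF indet(1)] indet(3))
  also have "act gvm Z (poly_vec f) \<oplus>\<^bsub>gvm\<^esub> \<dots> =
      poly_vec (const (s - of_nat (Suc d) + 1) * partial_deriv j (indet i * f))"
    unfolding bracket poly_vec_add[symmetric] partial_deriv_indet_mult
    by (rule arg_cong[where f = poly_vec])
       (simp add: single_diff single_add single_uminus algebra_simps del: single_of_nat)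
  finally show ?case .
next
  case (zero d)
  have E: "mat_unit n 0 (j + 1) \<in> sl n" by (simp add: mat_unit_sl)
  then show ?case
    using ind.M.act_smult[OF E ind.M.zero_closed, of 0] ind.M.act_closed[OF E ind.M.zero_closed]
    by (simp add: poly_vec_zero partial_deriv_zero)
next
  case (add d f g)
  then show ?case
    by (simp add: mat_unit_sl poly_vec_add ind.M.act_add partial_deriv_add distrib_left)
qed

text \<open>
  For \<open>s = k - 1\<close> the scalar of the raising operators vanishes in degree \<open>k\<close>, so the nilradical acts by 0.
  On the Levi subalgebra, \<^const>\<open>adjoint_block\<close> and \<^const>\<open>levi_ss_part\<close> differ by a multiple of the identity,
  which acts on polynomials of degree \<open>k\<close> as \<open>k\<close> times that multiple by Euler's formula; the value
  \<^const>\<open>sym_param\<close> is the one that compensates for it.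
\<close>

lemma parabolic_act_poly_vec:
  assumes s: "s = of_nat k - 1" and X: "X \<in> parabolic n"
    and f: "keys f \<subseteq> exponents (n - 1) k"
  shows "act gvm X (poly_vec f) =
    poly_vec (act (parabolic_rep n (sym_rep (n - 1) k) (sym_param n k)) X f)"
proof -
  note Xc = parabolic_carrier[OF n X]
  \<comment> \<open>\<open>Y\<close> is the component of \<open>X\<close> in the nilradical and \<open>Z\<close> the one in the Levi subalgebra.\<close>
  define F where "F = (\<lambda>j. X $$ (0, j + 1) \<cdot>\<^sub>m mat_unit n 0 (j + 1))"
  define Y where "Y = mat_sum n F (n - 1)"
  define Z where "Z = X - Y"
  have F: "F l \<in> sl n" for l by (simp add: F_def mat_unit_sl sl_smult)
  have Y: "Y \<in> sl n" unfolding Y_def using F by (rule mat_sum_sl)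
  note Yc = sl_carrier[OF Y]
  have Zc: "Z \<in> carrier_mat n n" unfolding Z_def by (rule minus_carrier_mat[OF Yc])
  have XYZ: "X = Z + Y" using Xc Yc unfolding Z_def by (intro eq_matI) auto
  have Z: "Z \<in> sl n"
  proof -
    have "Z = X + (-1) \<cdot>\<^sub>m Y" using Xc Yc unfolding Z_def by (intro eq_matI) auto
    then show ?thesis using parabolic_sl[OF n X] Y by (simp add: sl_add sl_smult)
  qed
  have Y_index: "Y $$ (a, b) = (if a = 0 \<and> 0 < b then X $$ (0, b) else 0)" if ab: "a < n" "b < n" for a b
  proof -
    have "Y $$ (a, b) = (\<Sum>l<n - 1. F l $$ (a, b))"
      unfolding Y_def using F sl_carrier ab by (intro mat_sum_index) blast+
    also have "\<dots> = (\<Sum>l<n - 1. if l + 1 = b then (if a = 0 then X $$ (0, b) else 0) else 0)"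
      using ab by (intro sum.cong) (auto simp: F_def mat_unit_index)
    also have "\<dots> = (if a = 0 \<and> 0 < b then X $$ (0, b) else 0)"
      using ab by (cases b) (simp_all add: less_diff_conv)
    finally show ?thesis .
  qed
  have Z_index: "Z $$ (a, b) = (if a = 0 \<and> 0 < b then 0 else X $$ (a, b))" if "a < n" "b < n" for a b
    using that Xc Yc Y_index[OF that] by (simp add: Z_def)
  have raise: "act gvm Y (poly_vec f) = \<zero>\<^bsub>gvm\<^esub>"
  proof -
    have "act gvm (F l) (poly_vec f) = poly_vec 0" if "l < n - 1" for l
    proof -
      have E: "mat_unit n 0 (l + 1) \<in> sl n" by (simp add: mat_unit_sl)
      have "s - of_nat k + 1 = 0" using s by simp
      then have "act gvm (mat_unit n 0 (l + 1)) (poly_vec f) = \<zero>\<^bsub>gvm\<^esub>"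
        using raising_act_poly_vec[OF that f] by (simp only: single_zero mult_zero_left poly_vec_zero)
      then show ?thesis
        unfolding F_def ind.M.act_mat_smult[OF E poly_vec_closed] by (simp add: poly_vec_zero)
    qed
    then have "act gvm Y (poly_vec f) = poly_vec (\<Sum>l<n - 1. 0)"
      unfolding Y_def using F by (intro act_mat_sum) simp_all
    then show ?thesis by (simp add: poly_vec_zero)
  qed
  let ?x = "X $$ (0, 0)"
  have Zact: "act gvm Z (poly_vec f) = poly_vec (derivation (n - 1) (adjoint_block Z) f + const (s * Z $$ (0, 0)) * f)"
    using parabolic_D[OF n X] by (intro levi_act_poly_vec[OF Z _ f]) (simp add: Z_index)
  have Z00: "Z $$ (0, 0) = ?x" using n by (simp add: Z_index)
  have ss: "levi_ss_part n X = adjoint_block Z + (?x + ?x / of_nat (n - 1)) \<cdot>\<^sub>m 1\<^sub>m (n - 1)"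
    using n Xc by (intro eq_matI) (auto simp: levi_ss_part_index adjoint_block_def Z_index)
  have "derivation (n - 1) (levi_ss_part n X) f =
      derivation (n - 1) (adjoint_block Z) f + const (?x + ?x / of_nat (n - 1)) * (const (of_nat k) * f)"
    unfolding ss derivation_mat_add[OF adjoint_block_carrier smult_carrier_mat[OF one_carrier_mat]]
      derivation_mat_smult[OF one_carrier_mat] derivation_one_mat[OF f] ..
  then have "act (parabolic_rep n (sym_rep (n - 1) k) (sym_param n k)) X f =
      derivation (n - 1) (adjoint_block Z) f
      + const ((?x + ?x / of_nat (n - 1)) * of_nat k + sym_param n k * ?x) * f"
    by (simp add: const_mult_eq_scale[symmetric] single_add distrib_right mult_single
        del: single_of_nat flip: mult.assoc)
  also have "(?x + ?x / of_nat (n - 1)) * of_nat k + sym_param n k * ?x = s * ?x"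
    unfolding s sym_param_def by (simp add: algebra_simps)
  finally have "poly_vec (act (parabolic_rep n (sym_rep (n - 1) k) (sym_param n k)) X f) = act gvm Z (poly_vec f)"
    using Zact Z00 by simp
  also have "\<dots> = act gvm X (poly_vec f)"
    using raise ind.M.act_mat_add[OF Z Y poly_vec_closed, of f] Z by (simp flip: XYZ)
  finally show ?thesis ..
qed

end

section \<open>Powers of a lowering operator in a Verma module\<close>

text \<open>
  The setting for a Verma module whose highest weight is a multiple \<open>s d\<chi>\<close>, that is, extends to a
  character of the parabolic subalgebra.
\<close>

locale scalar_verma =
  fixes n :: nat and s :: complex and lam :: "complex vec"
  assumes n: "n \<ge> 2" and lam: "lam \<in> carrier_vec n"
    and weight_lam: "X \<in> sl n \<Longrightarrow> weight lam X = s * X $$ (0, 0)"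

lemma induced_rep_weight_rep:
  assumes "lam \<in> carrier_vec n"
  shows "induced_rep (sl n) (borel n) (weight_rep lam)"
  by (intro induced_rep.intro lie_representation.intro lie_representation_axioms.intro
      induced_rep_axioms.intro matrix_lie_algebra_sl matrix_lie_algebra_borel lie_rep_weight_rep
      borel_subset_sl assms)

sublocale scalar_verma \<subseteq> ind: induced_rep "sl n" "borel n" "weight_rep lam"
  by (rule induced_rep_weight_rep[OF lam])

lemma weight_rep_simps [simp]:
  "carrier (weight_rep lam) = UNIV" "zero (weight_rep lam) = 0" "add (weight_rep lam) = (+)"
  "smult (weight_rep lam) = (*)" "act (weight_rep lam) X c = weight lam X * c"
  by (simp_all add: weight_rep_def)

context scalar_verma
begin

abbreviation vmod :: "((env \<times> complex) \<Rightarrow>\<^sub>0 complex) set rep" where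
  "vmod \<equiv> induced (sl n) (borel n) (weight_rep lam)"

definition lowered :: "nat \<Rightarrow> ((env \<times> complex) \<Rightarrow>\<^sub>0 complex) set" where
  "lowered r = ind.tens (lowering n 0 ^ r) 1"

lemma lowered_closed [simp]: "lowered r \<in> carrier vmod"
  by (simp add: lowered_def)

lemma lowering_act_lowered: "act vmod (mat_unit n 1 0) (lowered r) = lowered (Suc r)"
proof -
  have "act vmod (mat_unit n 1 0) (lowered r) = ind.tens (letter (mat_unit n 1 0) * lowering n 0 ^ r) 1"
    unfolding lowered_def by (rule ind.act_tens) (simp_all add: mat_unit_sl)
  then show ?thesis by (simp add: lowered_def lowering_def)
qed

text \<open>
  Write \<open>N\<close> for the first lowering operator. Then \<open>[X, N] = h N + B\<close> with \<open>h = X\<^sub>2\<^sub>2 - X\<^sub>1\<^sub>1\<close> and \<open>B\<close> in the Borel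
  subalgebra, so induction over \<open>r\<close> applies to \<open>B\<close>. As \<open>B\<close> has the entry 0 in place \<open>(1, 2)\<close>, it multiplies
  \<open>N\<^sup>r v\<close> by a scalar. For \<open>r = 0\<close> the second summand vanishes.
\<close>

lemma borel_act_lowered:
  assumes "X \<in> borel n"
  shows "act vmod X (lowered r) =
    (s * X $$ (0, 0) + of_nat r * (X $$ (1, 1) - X $$ (0, 0))) \<odot>\<^bsub>vmod\<^esub> lowered r
    \<oplus>\<^bsub>vmod\<^esub> (of_nat r * (s - of_nat r + 1) * X $$ (0, 1)) \<odot>\<^bsub>vmod\<^esub> lowered (r - 1)"
  using assms
proof (induction r arbitrary: X)
  case 0
  have "act vmod X (ind.tens 1 1) = ind.tens 1 ((s * X $$ (0, 0)) * 1)"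
    using 0 ind.tens_letter[of 1 X 1] ind.act_tens[of X 1 1] borel_sl[of X n] weight_lam[of X] by simp
  then have "act vmod X (lowered 0) = (s * X $$ (0, 0)) \<odot>\<^bsub>vmod\<^esub> lowered 0"
    using ind.tens_smult[of 1 1 "s * X $$ (0, 0)"] by (simp add: lowered_def)
  then show ?case by simp
next
  case (Suc r)
  let ?N = "mat_unit n 1 0"
  note Xc = sl_carrier[OF borel_sl[OF Suc.prems]]
  have X: "X \<in> sl n" by (rule borel_sl[OF Suc.prems])
  have N: "?N \<in> sl n" by (simp add: mat_unit_sl)
  define h where "h = X $$ (1, 1) - X $$ (0, 0)"
  define B where "B = lie_bracket X ?N + (- h) \<cdot>\<^sub>m ?N"
  have LB: "lie_bracket X ?N \<in> sl n" by (rule lie_bracket_sl[OF Xc]) simp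
  have B: "B \<in> sl n" unfolding B_def using LB N by (simp add: sl_add sl_smult)
  have LB_eq: "lie_bracket X ?N = h \<cdot>\<^sub>m ?N + B"
    using sl_carrier[OF LB] unfolding B_def by (intro eq_matI) auto
  have B_index: "B $$ (a, b) = (if b = 0 then X $$ (a, 1) else 0) - (if a = 1 then X $$ (0, b) else 0)
      - (if a = 1 \<and> b = 0 then h else 0)" if ab: "a < n" "b < n" for a b
  proof -
    have "lie_bracket X ?N $$ (a, b) = (\<Sum>l<n. if l = 1 then (if b = 0 then X $$ (a, 1) else 0) else 0)
        - (\<Sum>l<n. if l = 0 then (if a = 1 then X $$ (0, b) else 0) else 0)"
      unfolding lie_bracket_index[OF Xc mat_unit_carrier ab]
      using ab by (intro arg_cong2[where f = "(-)"] sum.cong) (auto simp: mat_unit_index)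
    then show ?thesis
      using ab n sl_carrier[OF LB] unfolding B_def by (simp add: mat_unit_index)
  qed
  have "B $$ (i, j) = 0" if "j < i" "i < n" for i j
    using that n borel_D[OF Suc.prems, of 1 i] borel_D[OF Suc.prems, of j i]
    by (cases "i = 1") (auto simp: B_index h_def)
  then have Bb: "B \<in> borel n" using B by (intro borelI)
  have B00: "B $$ (0, 0) = X $$ (0, 1)" "B $$ (1, 1) = - X $$ (0, 1)" "B $$ (0, 1) = 0"
    using n by (simp_all add: B_index)
  let ?c = "s * X $$ (0, 0) + of_nat r * h" and ?d = "of_nat r * (s - of_nat r + 1) * X $$ (0, 1)"
  let ?e = "(s - 2 * of_nat r) * X $$ (0, 1)"
  have "act vmod B (lowered r) = ?e \<odot>\<^bsub>vmod\<^esub> lowered r"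
    using Suc.IH[OF Bb] unfolding B00 by (simp add: algebra_simps)
  then have bracket: "act vmod (lie_bracket X ?N) (lowered r)
      = h \<odot>\<^bsub>vmod\<^esub> lowered (Suc r) \<oplus>\<^bsub>vmod\<^esub> ?e \<odot>\<^bsub>vmod\<^esub> lowered r"
    using N B sl_smult[OF N, of h]
    by (simp only: LB_eq ind.M.act_mat_add lowered_closed ind.M.act_mat_smult lowering_act_lowered)
  \<comment> \<open>For \<open>r = 0\<close> the vectors differ, but the coefficient is 0.\<close>
  have d: "?d \<odot>\<^bsub>vmod\<^esub> lowered (Suc (r - 1)) = ?d \<odot>\<^bsub>vmod\<^esub> lowered r"
    by (cases r) simp_all
  have "act vmod ?N (act vmod X (lowered r)) = ?c \<odot>\<^bsub>vmod\<^esub> lowered (Suc r) \<oplus>\<^bsub>vmod\<^esub> ?d \<odot>\<^bsub>vmod\<^esub> lowered r"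
    unfolding Suc.IH[OF Suc.prems] h_def[symmetric]
    using N d by (simp only: ind.M.act_add ind.M.act_smult ind.M.smult_closed' lowered_closed lowering_act_lowered)
  moreover have "act vmod X (act vmod ?N (lowered r))
      = act vmod (lie_bracket X ?N) (lowered r) \<oplus>\<^bsub>vmod\<^esub> act vmod ?N (act vmod X (lowered r))"
    using X N lowered_closed by (rule ind.M.act_act)
  ultimately have "act vmod X (lowered (Suc r)) = (h \<odot>\<^bsub>vmod\<^esub> lowered (Suc r) \<oplus>\<^bsub>vmod\<^esub> ?e \<odot>\<^bsub>vmod\<^esub> lowered r)
      \<oplus>\<^bsub>vmod\<^esub> (?c \<odot>\<^bsub>vmod\<^esub> lowered (Suc r) \<oplus>\<^bsub>vmod\<^esub> ?d \<odot>\<^bsub>vmod\<^esub> lowered r)"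
    unfolding lowering_act_lowered bracket by simp
  also have "\<dots> = (h + ?c) \<odot>\<^bsub>vmod\<^esub> lowered (Suc r) \<oplus>\<^bsub>vmod\<^esub> (?e + ?d) \<odot>\<^bsub>vmod\<^esub> lowered r"
    by (simp add: ind.M.smult_add_left ind.M.a_ac)
  also have "h + ?c = s * X $$ (0, 0) + of_nat (Suc r) * (X $$ (1, 1) - X $$ (0, 0))"
    by (simp add: h_def algebra_simps)
  also have "?e + ?d = of_nat (Suc r) * (s - of_nat (Suc r) + 1) * X $$ (0, 1)"
    by (simp add: algebra_simps)
  finally show ?case by simp
qed

end

section \<open>Canonical projections\<close>

lemma verma_induced: "verma n kap = induced (sl n) (borel n) (weight_rep (kap - rho n))"
  by (simp add: verma_def)

text \<open>
  The canonical projection is the map provided by Frobenius reciprocity for \<open>c \<mapsto> 1 \<otimes> c v\<close>. It is the only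
  linear map with the prescribed values as pure tensors span the Verma module.
\<close>

lemma canonical_proj:
  fixes V :: "'v rep"
  assumes n: "n \<ge> 2" and V: "lie_rep (parabolic n) V"
    and lam: "kap - rho n \<in> carrier_vec n" and v: "v \<in> carrier V"
    and act: "\<And>X. X \<in> borel n \<Longrightarrow> act V X v = weight (kap - rho n) X \<odot>\<^bsub>V\<^esub> v"
  shows "canonical_proj n kap V v \<in> linear_maps (verma n kap) (induced (sl n) (parabolic n) V)"
    and "a \<in> free_elems (sl n) \<Longrightarrow>
      canonical_proj n kap V v (tensor (sl n) (borel n) (weight_rep (kap - rho n)) (env_class (sl n) a) c) =
        tensor (sl n) (parabolic n) V (env_class (sl n) a) (c \<odot>\<^bsub>V\<^esub> v)"
proof -
  interpret V: induced_rep "sl n" "parabolic n" V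
    by (rule induced_rep_parabolic[OF n V])
  interpret N: induced_rep "sl n" "borel n" "weight_rep (kap - rho n)"
    by (rule induced_rep_weight_rep[OF lam])
  let ?g = "\<lambda>c. V.tens 1 (c \<odot>\<^bsub>V\<^esub> v)"
  have g: "?g \<in> linear_maps (weight_rep (kap - rho n)) (induced (sl n) (parabolic n) V)"
    using v by (simp add: linear_maps_def V.smult_add_left V.tens_add_right V.smult_mult V.tens_smult
      V.M.smult_add_left V.M.smult_mult)
  have equiv: "?g (act (weight_rep (kap - rho n)) X c) = act (induced (sl n) (parabolic n) V) X (?g c)"
    if X: "X \<in> borel n" for X c
  proof -
    have "X \<in> parabolic n" using borel_subset_parabolic[OF n] X by blast
    then have "act (induced (sl n) (parabolic n) V) X (?g c) = V.tens 1 (act V X (c \<odot>\<^bsub>V\<^esub> v))"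
      using v X borel_sl[OF X] V.tens_letter[of 1 X "c \<odot>\<^bsub>V\<^esub> v"] by (simp add: V.act_tens)
    also have "act V X (c \<odot>\<^bsub>V\<^esub> v) = (weight (kap - rho n) X * c) \<odot>\<^bsub>V\<^esub> v"
      using v \<open>X \<in> parabolic n\<close> act[OF X] by (simp add: V.act_smult mult.commute flip: V.smult_mult)
    finally show ?thesis by simp
  qed
  obtain F where F: "F \<in> rep_hom (sl n) (verma n kap) (induced (sl n) (parabolic n) V)"
      "F \<in> extensional (carrier (verma n kap))"
      "\<And>a c. a \<in> free_elems (sl n) \<Longrightarrow> F (N.tens a c) = free_act (induced (sl n) (parabolic n) V) a (?g c)"
    using N.frobenius_reciprocity[OF V.M.lie_representation_axioms g equiv] unfolding verma_induced by auto
  have F_tens: "F (N.tens a c) = V.tens a (c \<odot>\<^bsub>V\<^esub> v)" if "a \<in> free_elems (sl n)" for a c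
    using that v by (simp add: F(3) V.free_act_tens)
  have F_hom: "F \<in> linear_maps (verma n kap) (induced (sl n) (parabolic n) V)"
    using F(1) by (simp add: rep_hom_def)
  have "canonical_proj n kap V v = F"
    unfolding canonical_proj_def
  proof (rule the_equality)
    let ?spec = "\<lambda>f. f \<in> linear_maps (verma n kap) (induced (sl n) (parabolic n) V) \<and>
      f \<in> extensional (carrier (verma n kap)) \<and>
      (\<forall>u\<in>carrier (env_alg (sl n)). \<forall>c. f (tensor (sl n) (borel n) (weight_rep (kap - rho n)) u c) =
         tensor (sl n) (parabolic n) V u (c \<odot>\<^bsub>V\<^esub> v))"
    show "?spec F"
      using F_hom F(2) F_tens by (auto elim!: sl.env_algE)
    fix f assume f: "?spec f"
    show "f = F"
    proof (rule extensionalityI)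
      fix x assume "x \<in> carrier (verma n kap)"
      then show "f x = F x"
        using f F_hom F_tens unfolding verma_induced
        by (intro N.induced_hom_eqI[of f _ F x]) auto
    qed (use f F(2) in auto)
  qed
  then show "canonical_proj n kap V v \<in> linear_maps (verma n kap) (induced (sl n) (parabolic n) V)"
    "a \<in> free_elems (sl n) \<Longrightarrow>
      canonical_proj n kap V v (N.tens a c) = V.tens a (c \<odot>\<^bsub>V\<^esub> v)"
    using F_hom F_tens by auto
qed

section \<open>The homomorphism and its lift to the Verma modules\<close>

text \<open>
  The map \<^const>\<open>phi\<close> is the one that Frobenius reciprocity provides for \<open>poly_vec\<close>. Its definition
  prescribes values only where the second factor is a monomial; linearity in the second factor determines the
  other values.
\<close>

lemma (in scalar_gvm) phi_hom:
  assumes s: "s = of_nat k - 1"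
  shows "phi n k \<in> rep_hom (sl n)
      (induced (sl n) (parabolic n) (parabolic_rep n (sym_rep (n - 1) k) (sym_param n k))) gvm"
    and "a \<in> free_elems (sl n) \<Longrightarrow> keys f \<subseteq> exponents (n - 1) k \<Longrightarrow>
      phi n k (tensor (sl n) (parabolic n) (parabolic_rep n (sym_rep (n - 1) k) (sym_param n k))
        (env_class (sl n) a) f) = free_act gvm a (poly_vec f)"
proof -
  let ?V = "parabolic_rep n (sym_rep (n - 1) k) (sym_param n k)"
  interpret S: levi_rep n "sym_rep (n - 1) k"
    by (rule levi_repI[OF n lie_rep_sym_rep])
  interpret V: induced_rep "sl n" "parabolic n" ?V
    by (rule induced_rep_parabolic[OF n S.lie_rep_parabolic_rep])
  have M: "M_par n (sym_rep (n - 1) k) (sym_param n k) = induced (sl n) (parabolic n) ?V"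
    "M_par n triv_rep s = gvm"
    by (simp_all add: M_par_def)
  have poly_vec_hom: "poly_vec \<in> linear_maps ?V gvm"
    by (simp add: linear_maps_def poly_vec_add poly_vec_const_mult flip: const_mult_eq_scale)
  have equiv: "poly_vec (act ?V X f) = act gvm X (poly_vec f)" if "X \<in> parabolic n" "f \<in> carrier ?V" for X f
    using parabolic_act_poly_vec[OF s that(1), of f] that(2) by (simp del: parabolic_rep_simps(5))
  obtain F where F: "F \<in> rep_hom (sl n) (induced (sl n) (parabolic n) ?V) gvm"
      "F \<in> extensional (carrier (induced (sl n) (parabolic n) ?V))"
      "\<And>a f. a \<in> free_elems (sl n) \<Longrightarrow> f \<in> carrier ?V \<Longrightarrow> F (V.tens a f) = free_act gvm a (poly_vec f)"
    using V.frobenius_reciprocity[OF ind.M.lie_representation_axioms poly_vec_hom equiv] by auto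
  have F_hom: "F \<in> linear_maps (induced (sl n) (parabolic n) ?V) gvm"
    using F(1) by (simp add: rep_hom_def)
  have F_monomial: "F (tensor (sl n) (parabolic n) ?V u (single K 1)) =
      tensor (sl n) (parabolic n) (parabolic_rep n triv_rep s) (u \<otimes>\<^bsub>env_alg (sl n)\<^esub> N_monomial n K) 1"
    if u: "u \<in> carrier (env_alg (sl n))" and K: "K \<in> exponents (n - 1) k" for u K
  proof -
    obtain a where a: "a \<in> free_elems (sl n)" "u = env_class (sl n) a" using u sl.env_algE by blast
    then have "F (tensor (sl n) (parabolic n) ?V u (single K 1))
        = free_act gvm a (ind.tens (free_monomial n K) 1)"
      using K F(3)[OF a(1), of "single K 1"] by (simp add: poly_vec_single)
    also have "\<dots> = ind.tens (a * free_monomial n K) 1"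
      using a(1) by (simp add: ind.free_act_tens)
    finally show ?thesis
      using a by (simp add: sl.env_class_mult env_class_free_monomial)
  qed
  have "phi n k = F"
    unfolding phi_def s[symmetric] M
  proof (rule the_equality)
    let ?spec = "\<lambda>f. f \<in> linear_maps (induced (sl n) (parabolic n) ?V) gvm \<and>
      f \<in> extensional (carrier (induced (sl n) (parabolic n) ?V)) \<and>
      (\<forall>u\<in>carrier (env_alg (sl n)). \<forall>K\<in>exponents (n - 1) k.
         f (tensor (sl n) (parabolic n) ?V u (single K 1)) =
         tensor (sl n) (parabolic n) (parabolic_rep n triv_rep s) (u \<otimes>\<^bsub>env_alg (sl n)\<^esub> N_monomial n K) 1)"
    show "?spec F"
      using F_hom F(2) F_monomial by blast
    fix f assume f: "?spec f"
    then have f_hom: "f \<in> linear_maps (induced (sl n) (parabolic n) ?V) gvm" by blast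
    have "f (V.tens a q) = F (V.tens a q)" if a: "a \<in> free_elems (sl n)" and q: "q \<in> carrier ?V" for a q
    proof -
      have "keys q \<subseteq> exponents (n - 1) k" using q by simp
      then show ?thesis
      proof (induction q rule: keys_induct)
        case zero
        have t: "V.tens a 0 \<in> carrier (induced (sl n) (parabolic n) ?V)"
          by (rule V.tens_closed[OF a]) simp
        have "V.tens a 0 = 0 \<odot>\<^bsub>induced (sl n) (parabolic n) ?V\<^esub> V.tens a 0"
          using V.tens_smult[OF a, of 0 0] by (simp add: scale_zero)
        then have zero: "h (V.tens a 0) = \<zero>\<^bsub>gvm\<^esub>"
          if h: "h \<in> linear_maps (induced (sl n) (parabolic n) ?V) gvm" for h
          using linear_map_smult[OF h _ t, of 0]
            funcset_mem[OF linear_map_closed[OF h] t]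
          by (metis UNIV_I ind.M.smult_0 partial_object.select_convs(1))
        show ?case by (simp only: zero[OF f_hom] zero[OF F_hom])
      next
        case (single K c)
        have K: "single K 1 \<in> carrier ?V" using single by simp
        have eq: "f (V.tens a (single K 1)) = F (V.tens a (single K 1))"
          using f F_monomial single a by simp
        have t: "V.tens a (single K 1) \<in> carrier (induced (sl n) (parabolic n) ?V)"
          by (rule V.tens_closed[OF a K])
        have tc: "V.tens a (single K c)
            = c \<odot>\<^bsub>induced (sl n) (parabolic n) ?V\<^esub> V.tens a (single K 1)"
          using V.tens_smult[OF a K, of c] by (simp add: scale_single)
        have smult: "h (V.tens a (single K c)) = c \<odot>\<^bsub>gvm\<^esub> h (V.tens a (single K 1))"
          if h: "h \<in> linear_maps (induced (sl n) (parabolic n) ?V) gvm" for h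
          unfolding tc by (rule linear_map_smult[OF h _ t]) simp
        show ?case unfolding smult[OF f_hom] smult[OF F_hom] eq ..
      next
        case (add p q)
        then have pq: "p \<in> carrier ?V" "q \<in> carrier ?V" by simp_all
        have tens: "V.tens a (p + q) = V.tens a p \<oplus>\<^bsub>induced (sl n) (parabolic n) ?V\<^esub> V.tens a q"
          using V.tens_add_right[OF a pq] by simp
        have "h (V.tens a (p + q)) = h (V.tens a p) \<oplus>\<^bsub>gvm\<^esub> h (V.tens a q)"
          if h: "h \<in> linear_maps (induced (sl n) (parabolic n) ?V) gvm" for h
          unfolding tens
          by (rule linear_map_add[OF h V.tens_closed[OF a pq(1)] V.tens_closed[OF a pq(2)]])
        from this[OF f_hom] this[OF F_hom] show ?case unfolding add.IH by simp
      qed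
    qed
    then show "f = F"
      using f F(2) V.induced_hom_eqI[OF f_hom F_hom]
      by (intro extensionalityI[of f "carrier (induced (sl n) (parabolic n) ?V)"]) blast+
  qed
  then show "phi n k \<in> rep_hom (sl n) (induced (sl n) (parabolic n) ?V) gvm"
    "a \<in> free_elems (sl n) \<Longrightarrow> keys f \<subseteq> exponents (n - 1) k \<Longrightarrow>
      phi n k (V.tens a f) = free_act gvm a (poly_vec f)"
    using F by simp_all
qed

text \<open>
  For \<open>s = k - 1\<close> and \<open>r = k\<close> the factor \<open>s - r + 1\<close> in \<open>borel_act_lowered\<close> vanishes. So the Borel subalgebra
  acts on \<open>N\<^sub>1\<^sup>k \<otimes> 1\<close> through a character, which is \<open>\<mu> - \<rho>\<close>.
\<close>

lemma verma_hom:
  assumes n: "n \<ge> 3"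
  obtains F where "F \<in> rep_hom (sl n) (verma n (mu n k)) (verma n (eta n k))"
    "\<And>a c. a \<in> free_elems (sl n) \<Longrightarrow>
      F (tensor (sl n) (borel n) (weight_rep (mu n k - rho n)) (env_class (sl n) a) c) =
        tensor (sl n) (borel n) (weight_rep (eta n k - rho n)) (env_class (sl n) (a * lowering n 0 ^ k)) c"
proof -
  interpret E: scalar_verma n "of_nat k - 1" "eta n k - rho n"
    by unfold_locales (use n in \<open>simp_all add: weight_eta_minus_rho\<close>)
  interpret N: induced_rep "sl n" "borel n" "weight_rep (mu n k - rho n)"
    by (rule induced_rep_weight_rep) simp
  let ?g = "\<lambda>c. c \<odot>\<^bsub>E.vmod\<^esub> E.lowered k"
  have g: "?g \<in> linear_maps (weight_rep (mu n k - rho n)) E.vmod"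
    by (simp add: linear_maps_def E.ind.M.smult_add_left E.ind.M.smult_mult)
  have equiv: "?g (act (weight_rep (mu n k - rho n)) X c) = act E.vmod X (?g c)" if X: "X \<in> borel n" for X c
  proof -
    have w: "(of_nat k - 1) * X $$ (0, 0) + of_nat k * (X $$ (1, 1) - X $$ (0, 0)) = weight (mu n k - rho n) X"
      using n X by (simp add: weight_mu_minus_rho borel_sl sym_param_def algebra_simps)
    have "act E.vmod X (E.lowered k) = weight (mu n k - rho n) X \<odot>\<^bsub>E.vmod\<^esub> E.lowered k"
      unfolding E.borel_act_lowered[OF X] w by simp
    then show ?thesis
      using borel_sl[OF X] by (simp add: E.ind.M.act_smult mult.commute flip: E.ind.M.smult_mult)
  qed
  obtain F where F: "F \<in> rep_hom (sl n) (verma n (mu n k)) (verma n (eta n k))"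
      "\<And>a c. a \<in> free_elems (sl n) \<Longrightarrow> F (N.tens a c) = free_act E.vmod a (?g c)"
    unfolding verma_induced
  proof (rule N.frobenius_reciprocity[OF E.ind.M.lie_representation_axioms g equiv])
    fix F
    assume "F \<in> rep_hom (sl n) (induced (sl n) (borel n) (weight_rep (mu n k - rho n))) E.vmod"
      "\<And>a c. a \<in> free_elems (sl n) \<Longrightarrow> c \<in> carrier (weight_rep (mu n k - rho n)) \<Longrightarrow>
        F (N.tens a c) = free_act E.vmod a (?g c)"
    then show thesis by (intro that[unfolded verma_induced]) simp_all
  qed
  have "F (N.tens a c) = E.ind.tens (a * lowering n 0 ^ k) c" if a: "a \<in> free_elems (sl n)" for a c
    using a E.ind.tens_smult[of "a * lowering n 0 ^ k" 1 c]
    by (simp add: F(2) E.ind.M.free_act_vec_smult E.lowered_def E.ind.free_act_tens)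
  with F(1) show thesis by (rule that)
qed

theorem theorem7p4:
  fixes n k :: nat
  assumes "n \<ge> 3"
  shows "standard_hom n (mu n k) (eta n k)
           (parabolic_rep n (sym_rep (n - 1) k) (sym_param n k))
           (parabolic_rep n triv_rep (of_nat k - 1))
           (phi n k)"
proof -
  have n: "n \<ge> 2" using assms by simp
  let ?V = "parabolic_rep n (sym_rep (n - 1) k) (sym_param n k)"
  let ?W = "parabolic_rep n triv_rep (of_nat k - 1)"
  let ?v = "single (top_exp k) 1 :: sym"
  interpret G: scalar_gvm n "of_nat k - 1" by unfold_locales (rule n)
  interpret S: levi_rep n "sym_rep (n - 1) k"
    by (rule levi_repI[OF n lie_rep_sym_rep])
  interpret N: induced_rep "sl n" "borel n" "weight_rep (mu n k - rho n)"
    by (rule induced_rep_weight_rep) simp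
  have E_V: "is_E n (mu n k - rho n) ?V"
    using assms by (intro S.is_E_parabolic_rep[OF _ fin_dim_sym_rep highest_weight_vector_sym] simple_rep_sym_rep) auto
  have E_W: "is_E n (eta n k - rho n) ?W"
    using assms by (intro G.triv.is_E_parabolic_rep[OF simple_rep_triv_rep fin_dim_triv_rep highest_weight_vector_triv])
  note phi = G.phi_hom[OF refl]
  obtain F where F: "F \<in> rep_hom (sl n) (verma n (mu n k)) (verma n (eta n k))"
    "\<And>a c. a \<in> free_elems (sl n) \<Longrightarrow> F (N.tens a c) =
        tensor (sl n) (borel n) (weight_rep (eta n k - rho n)) (env_class (sl n) (a * lowering n 0 ^ k)) c"
    using verma_hom[OF assms] by blast
  let ?p = "canonical_proj n (mu n k) ?V ?v" and ?q = "canonical_proj n (eta n k) ?W 1"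
  have v: "?v \<in> carrier ?V" using top_exp_exponents[of "n - 1" k] assms by simp
  have act_v: "act ?V X ?v = weight (mu n k - rho n) X \<odot>\<^bsub>?V\<^esub> ?v" if "X \<in> borel n" for X
    using borel_act_sym_top[OF assms that] by (simp add: scale_single del: parabolic_rep_simps(5))
  have act_w: "act ?W X 1 = weight (eta n k - rho n) X \<odot>\<^bsub>?W\<^esub> 1" if "X \<in> borel n" for X
    using that n by (simp add: weight_eta_minus_rho borel_sl)
  note p = canonical_proj[OF n S.lie_rep_parabolic_rep mu_minus_rho_carrier v act_v]
  note q = canonical_proj[OF n G.triv.lie_rep_parabolic_rep eta_minus_rho_carrier _ act_w]
  have F_hom: "F \<in> linear_maps (verma n (mu n k)) (verma n (eta n k))"
    using F(1) by (simp add: rep_hom_def)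
  have phi_hom: "phi n k \<in> linear_maps (induced (sl n) (parabolic n) ?V) G.gvm"
    using phi(1) by (simp add: rep_hom_def)
  \<comment> \<open>Both composites send \<open>a \<otimes> c\<close> to \<open>c\<close> times \<open>a N\<^sub>1\<^sup>k \<otimes> 1\<close>.\<close>
  have "phi n k (?p x) = ?q (F x)" if "x \<in> carrier (verma n (mu n k))" for x
    using that unfolding verma_induced
  proof (induction x rule: N.induced_induct)
    case (tens a c)
    have "phi n k (?p (N.tens a c)) = free_act G.gvm a (G.poly_vec (single (top_exp k) c))"
    proof -
      have keys: "keys (single (top_exp k) c) \<subseteq> exponents (n - 1) k"
        using top_exp_exponents[of "n - 1" k] assms by simp
      have "?p (N.tens a c) = tensor (sl n) (parabolic n) ?V (env_class (sl n) a) (single (top_exp k) c)"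
        using p(2)[OF _ tens(1), of c] by (simp add: scale_single)
      then show ?thesis using phi(2)[OF tens(1) keys] by simp
    qed
    also have "\<dots> = c \<odot>\<^bsub>G.gvm\<^esub> G.ind.tens (a * lowering n 0 ^ k) 1"
      using tens n by (simp add: G.poly_vec_single G.ind.M.free_act_vec_smult G.ind.free_act_tens free_monomial_top)
    also have "\<dots> = G.ind.tens (a * lowering n 0 ^ k) (c * 1)"
      using tens G.ind.tens_smult[of "a * lowering n 0 ^ k" 1 c] by simp
    also have "\<dots> = ?q (F (N.tens a c))"
      using tens by (simp add: F(2) q(2))
    finally show ?case .
  next
    case (add x y)
    let ?N = "verma n (mu n k)"
    have xy: "x \<in> carrier ?N" "y \<in> carrier ?N" using add unfolding verma_induced by blast+
    have pc: "?p x \<in> carrier (induced (sl n) (parabolic n) ?V)" "?p y \<in> carrier (induced (sl n) (parabolic n) ?V)"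
      using xy linear_map_closed[OF p(1)] by auto
    have Fc: "F x \<in> carrier (verma n (eta n k))" "F y \<in> carrier (verma n (eta n k))"
      using xy linear_map_closed[OF F_hom] by auto
    have "phi n k (?p (x \<oplus>\<^bsub>?N\<^esub> y)) = phi n k (?p x) \<oplus>\<^bsub>G.gvm\<^esub> phi n k (?p y)"
      using linear_map_add[OF p(1) xy] linear_map_add[OF phi_hom pc] by simp
    also have "\<dots> = ?q (F x) \<oplus>\<^bsub>G.gvm\<^esub> ?q (F y)" using add by simp
    also have "\<dots> = ?q (F (x \<oplus>\<^bsub>?N\<^esub> y))"
      using linear_map_add[OF F_hom xy] linear_map_add[OF q(1) Fc] by simp
    finally show ?case unfolding verma_induced .
  qed
  then show ?thesis
    unfolding standard_hom_def
    using mu_P_levi[OF assms] eta_P_levi[OF assms] E_V E_W phi(1) F(1)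
      highest_weight_vector_sym[OF assms] highest_weight_vector_triv[OF assms] by blast
qed

end
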